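(* Let $2<p<N$ and fix $\alpha>0$. For $k\ge1$ let $\lambda_k=\alpha/\beta_k$, where $$\beta_k=\sup_{A\in\mathcal{A}_k}\ \inf_{u\in A}B(u),$$ be the eigenvalues of the Dirichlet eigenvalue problem $-(x_1x_2)^{-p}\mathrm{div}_{\mathbb{M}}(|\nabla_{\mathbb{M}}u|^{p-2}\nabla_{\mathbb{M}}u)=\lambda|u|^{p-2}u$ in $\mathrm{int}\,\mathbb{M}$, $u=0$ on $\partial\mathbb{M}$. Then $\lambda_k\to\infty$ as $k\to\infty$.
   Context: Setting. $n\ge 1$ is an integer, $N=n+2$, $\delta>0$ is a fixed small constant, $X$ is a bounded open set with coordinates $x'=(x_1',\dots,x_n')$, and $\mathbb{M}=(0,\delta)\times(0,\delta)\times X$ with points $(x_1,x_2,x')$ and boundary part $\partial\mathbb{M}=\{0\}\times\{0\}\times X$. Put $\nabla_{\mathbb{M}}=(x_1\partial_{x_1},\,x_1x_2\partial_{x_2},\,\partial_{x_1'},\dots,\partial_{x_n'})$, $\mathrm{div}_{\mathbb{M}}=\nabla_{\mathbb{M}}\cdot$, and $d\sigma=\frac{dx_1}{x_1}\frac{dx_2}{x_1x_2}dx'$. All functions are real-valued. Weighted spaces. For $1\le p<\infty$ and $\gamma_1,\gamma_2\in\mathbb{R}$, $L_p^{\gamma_1,\gamma_2}(\mathbb{M})$ has norm $\|u\|_{L_p^{\gamma_1,\gamma_2}(\mathbb{M})}=\big(\int_{\mathbb{M}}|x_1^{\frac Np-\gamma_1}x_2^{\frac Np-\gamma_2}u|^p\,d\sigma\big)^{1/p}$.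 $\mathcal{H}_p^{1,(\gamma_1,\gamma_2)}(\mathbb{M})$ is the space of $u\in W^{1,p}_{\mathrm{loc}}(\mathrm{int}\,\mathbb{M})$ such that $u$ and all components of $\nabla_{\mathbb{M}}u$ lie in $L_p^{\gamma_1,\gamma_2}(\mathbb{M})$, and $\mathcal{H}_{p,0}^{1,(\gamma_1,\gamma_2)}(\mathbb{M})$ is the closure of $C_0^\infty(\mathrm{int}\,\mathbb{M})$ in it. Write $E=\mathcal{H}_{p,0}^{1,(\frac{N-1}{p},\frac Np)}(\mathbb{M})$, normed (equivalently, by a Poincaré inequality) by $\|u\|_E=\big(\int_{\mathbb{M}}x_1|\nabla_{\mathbb{M}}u|^p\,d\sigma\big)^{1/p}$. Further definitions. $B(u)=\frac1p\int_{\mathbb{M}}x_1^{p+1}x_2^p|u|^p\,d\sigma$ for $u\in E$; $M=\{u\in E:\frac1p\int_{\mathbb{M}}x_1|\nabla_{\mathbb{M}}u|^p\,d\sigma=\alpha\}$; $\mathcal{A}_k=\{A\subset M: A\text{ closed},\ A=-A,\ \gamma(A)\ge k\}$. Here $\gamma$ is the (Krasnoselskii) genus of a closed symmetric set: $\gamma(\emptyset)=0$; otherwise $\gamma(A)$ is the least integer $m\ge1$ such that there is an odd continuous map $A\to\mathbb{R}^m\setminus\{0\}$, and $\gamma(A)=\infty$ if no such $m$ exists. *)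

theory Defs
  imports "HOL-Analysis.Analysis"
begin

section \<open>Test functions and Sobolev functions on an open set\<close>

primrec Ck :: "nat \<Rightarrow> ('a::euclidean_space \<Rightarrow> real) \<Rightarrow> bool" where
  "Ck 0 f \<longleftrightarrow> continuous_on UNIV f"
| "Ck (Suc k) f \<longleftrightarrow>
     (\<forall>x. f differentiable (at x)) \<and> (\<forall>b\<in>Basis. Ck k (\<lambda>x. frechet_derivative f (at x) b))"

definition test_functions :: "'a::euclidean_space set \<Rightarrow> ('a \<Rightarrow> real) set" where
  "test_functions \<Omega> =
     {\<phi>. (\<forall>k. Ck k \<phi>) \<and> compact (closure {x. \<phi> x \<noteq> 0}) \<and> closure {x. \<phi> x \<noteq> 0} \<subseteq> \<Omega>}"

text \<open>
  A function on \<open>\<Omega>\<close> is represented by any extension to the whole type; every notion below only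
  depends on the almost everywhere class of its restriction to \<open>\<Omega>\<close>.
\<close>

definition Lp_loc :: "'a::euclidean_space set \<Rightarrow> real \<Rightarrow> ('a \<Rightarrow> real) set" where
  "Lp_loc \<Omega> p =
     {u \<in> borel_measurable (lebesgue_on \<Omega>).
        \<forall>K. compact K \<longrightarrow> K \<subseteq> \<Omega> \<longrightarrow> integrable (lebesgue_on K) (\<lambda>x. \<bar>u x\<bar> powr p)}"

definition has_weak_partial ::
    "'a::euclidean_space set \<Rightarrow> 'a \<Rightarrow> ('a \<Rightarrow> real) \<Rightarrow> ('a \<Rightarrow> real) \<Rightarrow> bool" where
  "has_weak_partial \<Omega> b u v \<longleftrightarrow>
     u \<in> Lp_loc \<Omega> 1 \<and> v \<in> Lp_loc \<Omega> 1 \<and>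
     (\<forall>\<phi>\<in>test_functions \<Omega>.
        (\<integral>x. u x * frechet_derivative \<phi> (at x) b \<partial>lebesgue_on \<Omega>) =
        - (\<integral>x. v x * \<phi> x \<partial>lebesgue_on \<Omega>))"

text \<open>The choice is unique up to a null set whenever a weak derivative exists.\<close>

definition weak_partial ::
    "'a::euclidean_space set \<Rightarrow> 'a \<Rightarrow> ('a \<Rightarrow> real) \<Rightarrow> 'a \<Rightarrow> real" where
  "weak_partial \<Omega> b u = (SOME v. has_weak_partial \<Omega> b u v)"

definition W1p_loc :: "'a::euclidean_space set \<Rightarrow> real \<Rightarrow> ('a \<Rightarrow> real) set" where
  "W1p_loc \<Omega> p =
     {u \<in> Lp_loc \<Omega> p. \<forall>b\<in>Basis. \<exists>v. has_weak_partial \<Omega> b u v \<and> v \<in> Lp_loc \<Omega> p}"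


section \<open>The stretched corner manifold and its weighted spaces\<close>

type_synonym 'n point = "real \<times> real \<times> (real ^ 'n)"

abbreviation dimN :: "'n::finite itself \<Rightarrow> real" where
  "dimN _ \<equiv> real (CARD('n) + 2)"

definition MM :: "real \<Rightarrow> (real ^ 'n) set \<Rightarrow> 'n::finite point set" where
  "MM \<delta> X = {0<..<\<delta>} \<times> {0<..<\<delta>} \<times> X"

definition sigma :: "real \<Rightarrow> (real ^ 'n) set \<Rightarrow> 'n::finite point measure" where
  "sigma \<delta> X =
     density (lebesgue_on (MM \<delta> X)) (\<lambda>(x1, x2, x'). ennreal (1 / x1 * (1 / (x1 * x2))))"

definition grad_M ::
    "real \<Rightarrow> (real ^ 'n) set \<Rightarrow> ('n::finite point \<Rightarrow> real) \<Rightarrow> 'n point \<Rightarrow> 'n point" where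
  "grad_M \<delta> X u = (\<lambda>(x1, x2, x').
     (x1 * weak_partial (MM \<delta> X) (1, 0, 0) u (x1, x2, x'),
      x1 * x2 * weak_partial (MM \<delta> X) (0, 1, 0) u (x1, x2, x'),
      (\<chi> i. weak_partial (MM \<delta> X) (0, 0, axis i 1) u (x1, x2, x'))))"

definition Lp_integrand ::
    "real \<Rightarrow> real \<Rightarrow> real \<Rightarrow> ('n::finite point \<Rightarrow> real) \<Rightarrow> 'n point \<Rightarrow> real" where
  "Lp_integrand p \<gamma>1 \<gamma>2 u = (\<lambda>(x1, x2, x').
     \<bar>x1 powr (dimN TYPE('n) / p - \<gamma>1) * x2 powr (dimN TYPE('n) / p - \<gamma>2)
        * u (x1, x2, x')\<bar> powr p)"

definition Lp_space ::
    "real \<Rightarrow> (real ^ 'n) set \<Rightarrow> real \<Rightarrow> real \<Rightarrow> real \<Rightarrow> ('n::finite point \<Rightarrow> real) set" where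
  "Lp_space \<delta> X p \<gamma>1 \<gamma>2 =
     {u \<in> borel_measurable (lebesgue_on (MM \<delta> X)).
        integrable (sigma \<delta> X) (Lp_integrand p \<gamma>1 \<gamma>2 u)}"

definition Lp_norm ::
    "real \<Rightarrow> (real ^ 'n) set \<Rightarrow> real \<Rightarrow> real \<Rightarrow> real \<Rightarrow> ('n::finite point \<Rightarrow> real) \<Rightarrow> real" where
  "Lp_norm \<delta> X p \<gamma>1 \<gamma>2 u = (\<integral>x. Lp_integrand p \<gamma>1 \<gamma>2 u x \<partial>sigma \<delta> X) powr (1 / p)"

definition H_space ::
    "real \<Rightarrow> (real ^ 'n) set \<Rightarrow> real \<Rightarrow> real \<Rightarrow> real \<Rightarrow> ('n::finite point \<Rightarrow> real) set" where
  "H_space \<delta> X p \<gamma>1 \<gamma>2 =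
     {u \<in> W1p_loc (MM \<delta> X) p. u \<in> Lp_space \<delta> X p \<gamma>1 \<gamma>2 \<and>
        (\<forall>b\<in>Basis. (\<lambda>x. grad_M \<delta> X u x \<bullet> b) \<in> Lp_space \<delta> X p \<gamma>1 \<gamma>2)}"

definition H_norm ::
    "real \<Rightarrow> (real ^ 'n) set \<Rightarrow> real \<Rightarrow> real \<Rightarrow> real \<Rightarrow> ('n::finite point \<Rightarrow> real) \<Rightarrow> real" where
  "H_norm \<delta> X p \<gamma>1 \<gamma>2 u =
     Lp_norm \<delta> X p \<gamma>1 \<gamma>2 u
     + (\<Sum>b\<in>Basis. Lp_norm \<delta> X p \<gamma>1 \<gamma>2 (\<lambda>x. grad_M \<delta> X u x \<bullet> b))"

definition H0_space ::
    "real \<Rightarrow> (real ^ 'n) set \<Rightarrow> real \<Rightarrow> real \<Rightarrow> real \<Rightarrow> ('n::finite point \<Rightarrow> real) set" where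
  "H0_space \<delta> X p \<gamma>1 \<gamma>2 =
     {u \<in> H_space \<delta> X p \<gamma>1 \<gamma>2.
        \<forall>\<epsilon>>0. \<exists>\<phi>\<in>test_functions (MM \<delta> X). H_norm \<delta> X p \<gamma>1 \<gamma>2 (\<lambda>x. u x - \<phi> x) < \<epsilon>}"


section \<open>The energy space\<close>

definition E_space ::
    "real \<Rightarrow> (real ^ 'n) set \<Rightarrow> real \<Rightarrow> ('n::finite point \<Rightarrow> real) set" where
  "E_space \<delta> X p = H0_space \<delta> X p ((dimN TYPE('n) - 1) / p) (dimN TYPE('n) / p)"

definition E_energy ::
    "real \<Rightarrow> (real ^ 'n) set \<Rightarrow> real \<Rightarrow> ('n::finite point \<Rightarrow> real) \<Rightarrow> real" where
  "E_energy \<delta> X p u = (\<integral>x. fst x * norm (grad_M \<delta> X u x) powr p \<partial>sigma \<delta> X)"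

definition E_norm ::
    "real \<Rightarrow> (real ^ 'n) set \<Rightarrow> real \<Rightarrow> ('n::finite point \<Rightarrow> real) \<Rightarrow> real" where
  "E_norm \<delta> X p u = E_energy \<delta> X p u powr (1 / p)"

text \<open>
  Elements of \<open>E_space\<close> are functions, not classes, so \<open>E_norm\<close> is a seminorm and the topology
  below is not Hausdorff: it identifies exactly the functions that agree almost everywhere on
  \<open>MM \<delta> X\<close>.  Its closed sets are unions of such classes, and a continuous map into a Hausdorff space
  is constant on each class, so closedness and the genus are those of the quotient Banach space.
\<close>

definition E_topology ::
    "real \<Rightarrow> (real ^ 'n) set \<Rightarrow> real \<Rightarrow> ('n::finite point \<Rightarrow> real) topology" where
  "E_topology \<delta> X p = topology (\<lambda>U. U \<subseteq> E_space \<delta> X p \<and>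
     (\<forall>u\<in>U. \<exists>\<epsilon>>0. \<forall>v\<in>E_space \<delta> X p. E_norm \<delta> X p (\<lambda>x. v x - u x) < \<epsilon> \<longrightarrow> v \<in> U))"

lemma openin_E_topology:
  "openin (E_topology \<delta> X p) U \<longleftrightarrow> U \<subseteq> E_space \<delta> X p \<and>
     (\<forall>u\<in>U. \<exists>\<epsilon>>0. \<forall>v\<in>E_space \<delta> X p. E_norm \<delta> X p (\<lambda>x. v x - u x) < \<epsilon> \<longrightarrow> v \<in> U)"
proof -
  let ?P = "\<lambda>U. U \<subseteq> E_space \<delta> X p \<and>
     (\<forall>u\<in>U. \<exists>\<epsilon>>0. \<forall>v\<in>E_space \<delta> X p. E_norm \<delta> X p (\<lambda>x. v x - u x) < \<epsilon> \<longrightarrow> v \<in> U)"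
  have "?P (S \<inter> T)" if S: "?P S" and T: "?P T" for S T
  proof (intro conjI ballI)
    show "S \<inter> T \<subseteq> E_space \<delta> X p" using S by blast
    fix u assume u: "u \<in> S \<inter> T"
    obtain e where e: "e > 0" "\<forall>v\<in>E_space \<delta> X p. E_norm \<delta> X p (\<lambda>x. v x - u x) < e \<longrightarrow> v \<in> S"
      using S u by blast
    obtain d where d: "d > 0" "\<forall>v\<in>E_space \<delta> X p. E_norm \<delta> X p (\<lambda>x. v x - u x) < d \<longrightarrow> v \<in> T"
      using T u by blast
    show "\<exists>\<epsilon>>0. \<forall>v\<in>E_space \<delta> X p. E_norm \<delta> X p (\<lambda>x. v x - u x) < \<epsilon> \<longrightarrow> v \<in> S \<inter> T"
      using e d by (intro exI[of _ "min e d"]) auto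
  qed
  moreover have "?P (\<Union>\<K>)" if K: "\<forall>K\<in>\<K>. ?P K" for \<K>
  proof (intro conjI ballI)
    show "\<Union>\<K> \<subseteq> E_space \<delta> X p" using K by blast
    fix u assume "u \<in> \<Union>\<K>"
    then obtain K where "K \<in> \<K>" "u \<in> K" by blast
    moreover obtain e where
      "e > 0" "\<forall>v\<in>E_space \<delta> X p. E_norm \<delta> X p (\<lambda>x. v x - u x) < e \<longrightarrow> v \<in> K"
      using K calculation by blast
    ultimately show "\<exists>\<epsilon>>0. \<forall>v\<in>E_space \<delta> X p. E_norm \<delta> X p (\<lambda>x. v x - u x) < \<epsilon> \<longrightarrow> v \<in> \<Union>\<K>"
      by blast
  qed
  ultimately have "istopology ?P"
    unfolding istopology_def by presburger
  then show ?thesis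
    unfolding E_topology_def by (simp add: topology_inverse')
qed


section \<open>Genus and the minimax values\<close>

text \<open>
  \<^term>\<open>Euclidean_space m\<close> is the copy of $m$-dimensional Euclidean space consisting of the sequences
  that vanish from index \<open>m\<close> on.  The infimum of the empty set in \<^typ>\<open>enat\<close> is \<open>\<infinity>\<close>.
\<close>

definition genus :: "('a \<Rightarrow> real) topology \<Rightarrow> ('a \<Rightarrow> real) set \<Rightarrow> enat" where
  "genus T A =
     (if A = {} then 0
      else Inf {enat m | m. 1 \<le> m \<and>
        (\<exists>f. continuous_map (subtopology T A)
                (subtopology (Euclidean_space m) (- {\<lambda>i. 0})) f \<and>
             (\<forall>u\<in>A. f (\<lambda>x. - u x) = (\<lambda>i. - f u i)))})"

definition B_fun ::
    "real \<Rightarrow> (real ^ 'n) set \<Rightarrow> real \<Rightarrow> ('n::finite point \<Rightarrow> real) \<Rightarrow> real" where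
  "B_fun \<delta> X p u =
     1 / p * (\<integral>(x1, x2, x'). x1 powr (p + 1) * x2 powr p * \<bar>u (x1, x2, x')\<bar> powr p \<partial>sigma \<delta> X)"

definition M_set ::
    "real \<Rightarrow> (real ^ 'n) set \<Rightarrow> real \<Rightarrow> real \<Rightarrow> ('n::finite point \<Rightarrow> real) set" where
  "M_set \<delta> X p \<alpha> = {u \<in> E_space \<delta> X p. 1 / p * E_energy \<delta> X p u = \<alpha>}"

definition A_class ::
    "real \<Rightarrow> (real ^ 'n) set \<Rightarrow> real \<Rightarrow> real \<Rightarrow> nat \<Rightarrow> ('n::finite point \<Rightarrow> real) set set" where
  "A_class \<delta> X p \<alpha> k =
     {A. A \<subseteq> M_set \<delta> X p \<alpha> \<and> closedin (E_topology \<delta> X p) A \<and> A = (\<lambda>u x. - u x) ` A \<and>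
         enat k \<le> genus (E_topology \<delta> X p) A}"

definition beta :: "real \<Rightarrow> (real ^ 'n::finite) set \<Rightarrow> real \<Rightarrow> real \<Rightarrow> nat \<Rightarrow> real" where
  "beta \<delta> X p \<alpha> k = (SUP A\<in>A_class \<delta> X p \<alpha> k. INF u\<in>A. B_fun \<delta> X p u)"

definition lambda_ev :: "real \<Rightarrow> (real ^ 'n::finite) set \<Rightarrow> real \<Rightarrow> real \<Rightarrow> nat \<Rightarrow> real" where
  "lambda_ev \<delta> X p \<alpha> k = \<alpha> / beta \<delta> X p \<alpha> k"

end

(*
  With the exponents of the energy space all norms are plain L^p norms for dx1 dx2 dx' / (x1 x2), and
  B(u) is the p-th power of the norm of x1 x2 u, up to the factor 1/p.

  The beta_k tend to 0: where x1 or x2 is small the weight x1 x2 is small, and the Poincare inequality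
  in the x' directions applies; on the rest the stretched gradient controls the ordinary one. Cutting
  that part into small cells gives B(u) <= eps * |grad u|^p + C * sum over finitely many cells Q of
  |int_Q u|^p, first for test functions and then on E by density. The finitely many integrals define an
  odd continuous map into R^m that does not vanish where B > eps on M, so a set of genus larger than m
  meets {B <= eps}.

  The beta_k are positive: bumps with disjoint supports span an odd copy of the sphere S^(k-1) in M on
  which B is bounded below. By the Borsuk-Ulam theorem the closed set of all u in M with this lower bound
  has genus at least k. Borsuk-Ulam follows from the fact that odd self-maps of a sphere have odd degree.
*)

theory Submission
  imports Defs "HOL-Homology.Homology" "HOL-Real_Asymp.Real_Asymp"
begin

section \<open>The Borsuk-Ulam theorem\<close>

text \<open>Divergence needs both bounds on \<open>beta\<close>: a quotient by 0 is 0 in HOL, so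
  smallness of \<open>beta\<close> without positivity would not make \<open>lambda_ev\<close> large.

  No regularity of the boundary of \<open>X\<close> is available, and this shapes the compactness
  estimate. Test functions vanish outside \<open>Om\<close>, so line integrals may leave it, and no
  cell has to fit inside \<open>X\<close>. Every term of the estimate is continuous in the norm of
  \<open>E\<close>, which is all that is needed to leave the test functions. A compact embedding is
  never stated; averages over finitely many cells are the finite rank part that the genus argument
  uses.

  In the Borsuk-Ulam part the step from one dimension to the next compares the degree of an odd map
  with that of its restriction to the equator, and thus requires that the equator be preserved. The
  obstacle is that a continuous image of the equator can fill the whole sphere and leave no
  direction in which to push. A Lipschitz image cannot, by a count of grid points, and odd Lipschitz
  maps are dense among the odd continuous ones by Stone-Weierstrass.\<close>

definition sph :: "nat \<Rightarrow> (nat \<Rightarrow> real) set" where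
  "sph n = {x. (\<Sum>i\<le>n. (x i)\<^sup>2) = 1 \<and> (\<forall>i>n. x i = 0)}"

lemma nsphere_eq_sph: "nsphere n = top_of_set (sph n)"
  by (simp add: nsphere sph_def euclidean_product_topology)

lemma topspace_nsphere_sph [simp]: "topspace (nsphere n) = sph n"
  by (simp add: nsphere_eq_sph)

lemma Euclidean_space_eq_top_of_set: "Euclidean_space n = top_of_set {x. \<forall>i\<ge>n. x i = 0}"
  by (simp add: Euclidean_space_def euclidean_product_topology)

lemma continuous_map_sph_iff:
  "continuous_map (nsphere n) (nsphere m) f \<longleftrightarrow>
     (\<forall>i. continuous_on (sph n) (\<lambda>x. f x i)) \<and> f \<in> sph n \<rightarrow> sph m"
  by (auto simp: nsphere_eq_sph intro: continuous_on_coordinatewise_then_product continuous_on_product_then_coordinatewise)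

lemma uminus_sph: "x \<in> sph n \<Longrightarrow> (\<lambda>i. - x i) \<in> sph n"
  by (simp add: sph_def)

lemma sph_mono: "x \<in> sph m \<Longrightarrow> m \<le> n \<Longrightarrow> x \<in> sph n"
proof -
  assume x: "x \<in> sph m" and "m \<le> n"
  then have "(\<Sum>i\<le>n. (x i)\<^sup>2) = (\<Sum>i\<le>m. (x i)\<^sup>2)"
    by (intro sum.mono_neutral_right) (auto simp: sph_def)
  then show ?thesis using x \<open>m \<le> n\<close> by (simp add: sph_def)
qed

lemma abs_coord_sph_le: "x \<in> sph n \<Longrightarrow> \<bar>x i\<bar> \<le> 1"
proof (cases "i \<le> n")
  case True
  assume x: "x \<in> sph n"
  have "(x i)\<^sup>2 \<le> (\<Sum>i\<le>n. (x i)\<^sup>2)"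
    using True by (intro member_le_sum) auto
  then show ?thesis using x by (simp add: sph_def abs_square_le_1)
qed (simp add: sph_def)

text \<open>The ambient space of sequences is infinite-dimensional, so compactness comes from
  Tychonoff: the sphere is a closed subset of a product of compact intervals.\<close>

lemma compact_sph: "compact (sph n)"
proof -
  have "compactin (powertop_real UNIV) (PiE UNIV (\<lambda>i. {-1..1::real}))"
    by (simp add: compactin_PiE)
  then have "compact (PiE UNIV (\<lambda>i::nat. {-1..1::real}))"
    by (simp add: euclidean_product_topology)
  moreover have "closed (sph n)"
  proof -
    have eq: "sph n = {x. (\<Sum>i\<le>n. (x i)\<^sup>2) = 1} \<inter> (\<Inter>i\<in>{n<..}. {x. x i = 0})"
      by (auto simp: sph_def)
    show ?thesis unfolding eq
      by (intro closed_Int closed_INT closed_Collect_eq ballI continuous_intros continuous_on_product_coordinates)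
  qed
  moreover have "sph n \<subseteq> PiE UNIV (\<lambda>i. {-1..1})"
  proof
    fix x assume "x \<in> sph n"
    then have "\<bar>x i\<bar> \<le> 1" for i by (rule abs_coord_sph_le)
    then have "-1 \<le> x i \<and> x i \<le> 1" for i by (smt (verit))
    then show "x \<in> PiE UNIV (\<lambda>i. {-1..1})" by (simp add: PiE_iff)
  qed
  ultimately show ?thesis
    using compact_Int_closed[of "PiE UNIV (\<lambda>i. {-1..1::real})" "sph n"] by (simp add: inf.absorb2)
qed

section \<open>Radial projection and degrees of nowhere vanishing maps\<close>

definition nmlz :: "nat \<Rightarrow> (nat \<Rightarrow> real) \<Rightarrow> nat \<Rightarrow> real" where
  "nmlz n v = (\<lambda>i. v i / sqrt (\<Sum>j\<le>n. (v j)\<^sup>2))"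

lemma nmlz_uminus: "nmlz n (\<lambda>i. - v i) = (\<lambda>i. - nmlz n v i)"
  by (simp add: nmlz_def)

lemma nmlz_sph: "v \<in> sph n \<Longrightarrow> nmlz n v = v"
  by (simp add: nmlz_def sph_def)

lemma sum_squares_pos: "i \<le> (n::nat) \<Longrightarrow> v i \<noteq> 0 \<Longrightarrow> (\<Sum>j\<le>n. (v j)\<^sup>2) > (0::real)"
  using sum_pos2[of "{..n}" i "\<lambda>j. (v j)\<^sup>2"] by simp

lemma nmlz_in_sph:
  assumes "\<forall>i>n. v i = 0" and "i \<le> n" "v i \<noteq> 0"
  shows "nmlz n v \<in> sph n"
proof -
  have "(\<Sum>j\<le>n. (v j)\<^sup>2) > 0" using assms(2,3) by (rule sum_squares_pos)
  then have "(\<Sum>i\<le>n. (v i / sqrt (\<Sum>j\<le>n. (v j)\<^sup>2))\<^sup>2) = 1"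
    by (simp add: power_divide flip: sum_divide_distrib)
  then show ?thesis using assms(1) by (simp add: nmlz_def sph_def)
qed

lemma continuous_on_nmlz:
  fixes F :: "'a::topological_space \<Rightarrow> nat \<Rightarrow> real"
  assumes "\<And>i. continuous_on S (\<lambda>x. F x i)" and "\<And>x. x \<in> S \<Longrightarrow> \<exists>i\<le>n. F x i \<noteq> 0"
  shows "continuous_on S (\<lambda>x. nmlz n (F x) i)"
  unfolding nmlz_def
proof (intro continuous_intros assms(1) ballI)
  fix x assume "x \<in> S"
  then have "(\<Sum>j\<le>n. (F x j)\<^sup>2) > 0" using assms(2) sum_squares_pos by blast
  then show "sqrt (\<Sum>j\<le>n. (F x j)\<^sup>2) \<noteq> 0" by simp
qed

text \<open>Homotopies can thus be taken as straight lines in R^(n+1), with nonvanishing as the only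
  real obligation, and projected to the sphere afterwards.\<close>

lemma degree_nmlz_homotopic:
  fixes H :: "real \<times> (nat \<Rightarrow> real) \<Rightarrow> nat \<Rightarrow> real"
  assumes cont: "\<And>i. continuous_on ({0..1} \<times> sph n) (\<lambda>y. H y i)"
    and nz: "\<And>t x. t \<in> {0..1::real} \<Longrightarrow> x \<in> sph n \<Longrightarrow> \<exists>i\<le>n. H (t, x) i \<noteq> 0"
    and z: "\<And>t x i. t \<in> {0..1} \<Longrightarrow> x \<in> sph n \<Longrightarrow> i > n \<Longrightarrow> H (t, x) i = 0"
  shows "Brouwer_degree2 n (\<lambda>x. nmlz n (H (0, x))) = Brouwer_degree2 n (\<lambda>x. nmlz n (H (1, x)))"
proof (rule Brouwer_degree2_homotopic)
  have "continuous_map (prod_topology (top_of_set {0..1}) (nsphere n)) (nsphere n) (\<lambda>y. nmlz n (H y))"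
  proof -
    have eq: "prod_topology (top_of_set {0..1::real}) (nsphere n) = top_of_set ({0..1} \<times> sph n)"
      by (simp add: nsphere_eq_sph prod_topology_subtopology_eu)
    have "continuous_on ({0..1} \<times> sph n) (\<lambda>y. nmlz n (H y))"
      using nz by (intro continuous_on_coordinatewise_then_product continuous_on_nmlz cont) auto
    moreover have "(\<lambda>y. nmlz n (H y)) \<in> {0..1} \<times> sph n \<rightarrow> sph n"
    proof
      fix y :: "real \<times> (nat \<Rightarrow> real)" assume "y \<in> {0..1} \<times> sph n"
      then obtain t x where y: "y = (t, x)" "t \<in> {0..1}" "x \<in> sph n" by auto
      then obtain i where "i \<le> n" "H (t, x) i \<noteq> 0" using nz by blast
      then show "nmlz n (H y) \<in> sph n" using y z[OF y(2,3)] by (auto intro: nmlz_in_sph)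
    qed
    ultimately show ?thesis by (simp add: eq, simp add: nsphere_eq_sph)
  qed
  then show "homotopic_with (\<lambda>x. True) (nsphere n) (nsphere n)
     (\<lambda>x. nmlz n (H (0, x))) (\<lambda>x. nmlz n (H (1, x)))"
    unfolding homotopic_with_def by (intro exI[of _ "\<lambda>y. nmlz n (H y)"]) auto
qed

section \<open>Lipschitz functions on the sphere and odd approximation\<close>

definition lip_on :: "nat \<Rightarrow> ((nat \<Rightarrow> real) \<Rightarrow> real) \<Rightarrow> bool" where
  "lip_on n g \<longleftrightarrow> (\<exists>L\<ge>0. \<forall>x\<in>sph n. \<forall>y\<in>sph n. \<bar>g x - g y\<bar> \<le> L * (\<Sum>i\<le>n. \<bar>x i - y i\<bar>))"

lemma lip_on_continuous: assumes "lip_on n g" shows "continuous_on (sph n) g"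
proof -
  obtain L where L: "\<And>x y. x\<in>sph n \<Longrightarrow> y\<in>sph n \<Longrightarrow> \<bar>g x - g y\<bar> \<le> L * (\<Sum>i\<le>n. \<bar>x i - y i\<bar>)"
    using assms by (auto simp: lip_on_def)
  show ?thesis unfolding continuous_on
  proof
    fix x assume x: "x \<in> sph n"
    have "continuous_on UNIV (\<lambda>y::nat\<Rightarrow>real. L * (\<Sum>i\<le>n. \<bar>y i - x i\<bar>))"
      by (intro continuous_intros continuous_on_product_coordinates)
    then have "((\<lambda>y::nat\<Rightarrow>real. L * (\<Sum>i\<le>n. \<bar>y i - x i\<bar>)) \<longlongrightarrow> L * (\<Sum>i\<le>n. \<bar>x i - x i\<bar>)) (at x within sph n)"
      by (meson UNIV_I continuous_on continuous_on_subset subset_UNIV x)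
    then have "((\<lambda>y. L * (\<Sum>i\<le>n. \<bar>y i - x i\<bar>)) \<longlongrightarrow> 0) (at x within sph n)" by simp
    moreover have "\<forall>\<^sub>F y in at x within sph n. norm (g y - g x) \<le> L * (\<Sum>i\<le>n. \<bar>y i - x i\<bar>)"
      using L x by (auto simp: eventually_at_filter)
    ultimately have "((\<lambda>y. g y - g x) \<longlongrightarrow> 0) (at x within sph n)"
      by (rule Lim_null_comparison[rotated])
    then show "(g \<longlongrightarrow> g x) (at x within sph n)" using LIM_zero_cancel by blast
  qed
qed

lemma lip_on_bounded: assumes "lip_on n g" shows "\<exists>B\<ge>0. \<forall>x\<in>sph n. \<bar>g x\<bar> \<le> B"
proof -
  have "compact (g ` sph n)"
    using assms compact_continuous_image compact_sph lip_on_continuous by blast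
  then obtain B where "\<forall>x\<in>sph n. norm (g x) \<le> B"
    using compact_imp_bounded bounded_iff by (metis (no_types, lifting) imageI)
  then show ?thesis by (intro exI[of _ "max B 0"]) force
qed

lemma lip_on_add: assumes "lip_on n f" "lip_on n g" shows "lip_on n (\<lambda>x. f x + g x)"
proof -
  obtain L M where L: "L \<ge> 0" "\<And>x y. x\<in>sph n \<Longrightarrow> y\<in>sph n \<Longrightarrow> \<bar>f x - f y\<bar> \<le> L * (\<Sum>i\<le>n. \<bar>x i - y i\<bar>)"
    and M: "M \<ge> 0" "\<And>x y. x\<in>sph n \<Longrightarrow> y\<in>sph n \<Longrightarrow> \<bar>g x - g y\<bar> \<le> M * (\<Sum>i\<le>n. \<bar>x i - y i\<bar>)"
    using assms by (auto simp: lip_on_def)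
  have "\<bar>(f x + g x) - (f y + g y)\<bar> \<le> (L + M) * (\<Sum>i\<le>n. \<bar>x i - y i\<bar>)" if "x \<in> sph n" "y \<in> sph n" for x y
    using L(2)[OF that] M(2)[OF that] by (simp add: distrib_right)
  then show ?thesis using L M unfolding lip_on_def by (intro exI[of _ "L+M"]) auto
qed

lemma lip_on_const: "lip_on n (\<lambda>x. c)"
  by (auto simp: lip_on_def intro!: exI[of _ 0])

lemma lip_on_mult: assumes "lip_on n f" "lip_on n g" shows "lip_on n (\<lambda>x. f x * g x)"
proof -
  obtain L M where L: "L \<ge> 0" "\<And>x y. x\<in>sph n \<Longrightarrow> y\<in>sph n \<Longrightarrow> \<bar>f x - f y\<bar> \<le> L * (\<Sum>i\<le>n. \<bar>x i - y i\<bar>)"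
    and M: "M \<ge> 0" "\<And>x y. x\<in>sph n \<Longrightarrow> y\<in>sph n \<Longrightarrow> \<bar>g x - g y\<bar> \<le> M * (\<Sum>i\<le>n. \<bar>x i - y i\<bar>)"
    using assms by (auto simp: lip_on_def)
  obtain A where A: "A \<ge> 0" "\<forall>x\<in>sph n. \<bar>f x\<bar> \<le> A" using lip_on_bounded assms by blast
  obtain B where B: "B \<ge> 0" "\<forall>x\<in>sph n. \<bar>g x\<bar> \<le> B" using lip_on_bounded assms by blast
  have "\<bar>f x * g x - f y * g y\<bar> \<le> (A * M + L * B) * (\<Sum>i\<le>n. \<bar>x i - y i\<bar>)" if "x \<in> sph n" "y \<in> sph n" for x y
  proof -
    have "f x * g x - f y * g y = f x * (g x - g y) + (f x - f y) * g y" by (simp add: algebra_simps)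
    then have "\<bar>f x * g x - f y * g y\<bar> \<le> \<bar>f x\<bar> * \<bar>g x - g y\<bar> + \<bar>f x - f y\<bar> * \<bar>g y\<bar>"
      by (metis abs_mult abs_triangle_ineq)
    also have "\<dots> \<le> A * (M * (\<Sum>i\<le>n. \<bar>x i - y i\<bar>)) + (L * (\<Sum>i\<le>n. \<bar>x i - y i\<bar>)) * B"
      using A B L(1,2) M(1,2) that by (intro add_mono mult_mono) (auto intro!: mult_nonneg_nonneg sum_nonneg)
    finally show ?thesis by (simp add: algebra_simps)
  qed
  then show ?thesis using A B L M unfolding lip_on_def by (intro exI[of _ "A*M+L*B"]) auto
qed

lemma lip_on_coord: "i \<le> n \<Longrightarrow> lip_on n (\<lambda>x. x i)"
  unfolding lip_on_def by (intro exI[of _ 1]) (auto intro!: member_le_sum[of i _ "\<lambda>i. \<bar>_ i - _ i\<bar>"])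

lemma lip_on_uminus: assumes "lip_on n f" shows "lip_on n (\<lambda>x. f (\<lambda>i. - x i))"
proof -
  obtain L where L: "L \<ge> 0" "\<And>x y. x\<in>sph n \<Longrightarrow> y\<in>sph n \<Longrightarrow> \<bar>f x - f y\<bar> \<le> L * (\<Sum>i\<le>n. \<bar>x i - y i\<bar>)"
    using assms by (auto simp: lip_on_def)
  have "\<bar>f (\<lambda>i. - x i) - f (\<lambda>i. - y i)\<bar> \<le> L * (\<Sum>i\<le>n. \<bar>x i - y i\<bar>)" if "x \<in> sph n" "y \<in> sph n" for x y
    using L(2)[OF uminus_sph[OF that(1)] uminus_sph[OF that(2)]] by (simp add: abs_minus_commute)
  then show ?thesis using L unfolding lip_on_def by auto
qed

lemma lip_on_mono: assumes "lip_on n f" "m \<le> n" shows "lip_on m f"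
proof -
  obtain L where L: "L \<ge> 0" "\<And>x y. x\<in>sph n \<Longrightarrow> y\<in>sph n \<Longrightarrow> \<bar>f x - f y\<bar> \<le> L * (\<Sum>i\<le>n. \<bar>x i - y i\<bar>)"
    using assms by (auto simp: lip_on_def)
  have "\<bar>f x - f y\<bar> \<le> L * (\<Sum>i\<le>m. \<bar>x i - y i\<bar>)" if "x \<in> sph m" "y \<in> sph m" for x y
  proof -
    have "(\<Sum>i\<le>n. \<bar>x i - y i\<bar>) = (\<Sum>i\<le>m. \<bar>x i - y i\<bar>)"
      using that assms(2) by (intro sum.mono_neutral_right) (auto simp: sph_def)
    then show ?thesis using L(2)[of x y] that assms(2) sph_mono by metis
  qed
  then show ?thesis using L(1) unfolding lip_on_def by blast
qed

text \<open>The Lipschitz functions form an algebra that separates points, so Stone-Weierstrass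
  applies. Passing to the odd part of an approximation does not increase the error, because the
  function approximated is odd.\<close>

lemma odd_lipschitz_approximation:
  assumes f: "continuous_on (sph n) f" and odd: "\<And>x. x \<in> sph n \<Longrightarrow> f (\<lambda>i. - x i) = - f x" and "e > 0"
  shows "\<exists>g. lip_on n g \<and> (\<forall>x\<in>sph n. g (\<lambda>i. - x i) = - g x) \<and> (\<forall>x\<in>sph n. \<bar>f x - g x\<bar> < e)"
proof -
  interpret function_ring_on "{g. lip_on n g}" "sph n"
  proof
    show "\<exists>f\<in>{g. lip_on n g}. f x \<noteq> f y" if xy: "x \<in> sph n" "y \<in> sph n" "x \<noteq> y" for x y
    proof -
      obtain i where "x i \<noteq> y i" using xy(3) by blast
      moreover then have "i \<le> n" using xy by (force simp: sph_def not_le)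
      ultimately show ?thesis by (intro bexI[of _ "\<lambda>x. x i"]) (auto intro: lip_on_coord)
    qed
  qed (auto simp: compact_sph lip_on_continuous lip_on_add lip_on_mult lip_on_const)
  obtain g where g: "lip_on n g" "\<forall>x\<in>sph n. \<bar>f x - g x\<bar> < e"
    using Stone_Weierstrass_basic[OF f \<open>e > 0\<close>] by auto
  define h where "h = (\<lambda>x. (1/2) * (g x + (-1) * g (\<lambda>i. - x i)))"
  have "lip_on n h" unfolding h_def
    by (intro lip_on_mult lip_on_add lip_on_const g(1) lip_on_uminus)
  moreover have "h (\<lambda>i. - x i) = - h x" for x by (simp add: h_def field_simps)
  moreover have "\<bar>f x - h x\<bar> < e" if "x \<in> sph n" for x
    using g(2)[rule_format, OF that] g(2)[rule_format, OF uminus_sph[OF that]] odd[OF that]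
    unfolding h_def abs_less_iff by (simp add: field_simps)
  ultimately show ?thesis by blast
qed

section \<open>Counting: a Lipschitz image of a sphere misses a line\<close>

lemma sph_large_coordinate:
  assumes "x \<in> sph n" shows "\<exists>j\<le>n. (x j)\<^sup>2 \<ge> 1 / real (Suc n)"
proof (rule ccontr)
  assume "\<not> ?thesis"
  then have "(x j)\<^sup>2 < 1 / real (Suc n)" if "j \<le> n" for j using that by (meson not_le)
  then have "(\<Sum>j\<le>n. (x j)\<^sup>2) < (\<Sum>j\<le>n. 1 / real (Suc n))"
    by (intro sum_strict_mono) auto
  then show False using assms by (simp add: sph_def)
qed

text \<open>On each of the patches where one coordinate is large and has a fixed sign, the sphere is a
  Lipschitz graph over the remaining coordinates; this is what makes it \<open>n\<close>-dimensional.\<close>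

lemma sph_patch:
  assumes x: "x \<in> sph n" and y: "y \<in> sph n" and j: "j \<le> n"
    and xj: "(x j)\<^sup>2 \<ge> 1 / real (Suc n)" and yj: "(y j)\<^sup>2 \<ge> 1 / real (Suc n)"
    and sgn: "x j > 0 \<longleftrightarrow> y j > 0"
    and close: "\<And>i. i \<le> n \<Longrightarrow> i \<noteq> j \<Longrightarrow> \<bar>x i - y i\<bar> \<le> e" and e: "e \<ge> 0"
  shows "(\<Sum>i\<le>n. \<bar>x i - y i\<bar>) \<le> 3 * (real (Suc n))\<^sup>2 * e"
proof -
  define N where "N = real (Suc n)"
  have N: "N \<ge> 1" by (simp add: N_def)
  have rest: "(\<Sum>i\<in>{..n}-{j}. \<bar>x i - y i\<bar>) \<le> (N - 1) * e"
  proof -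
    have "(\<Sum>i\<in>{..n}-{j}. \<bar>x i - y i\<bar>) \<le> real (card ({..n}-{j})) * e"
      using close by (intro sum_bounded_above) auto
    then show ?thesis using j by (simp add: N_def)
  qed
  have abs1: "\<bar>x j\<bar> \<ge> 1 / N" "\<bar>y j\<bar> \<ge> 1 / N"
  proof -
    have "1 / N \<ge> (1 / N)\<^sup>2" using N by (simp add: power2_eq_square field_simps)
    then have "(1 / N)\<^sup>2 \<le> (x j)\<^sup>2" "(1 / N)\<^sup>2 \<le> (y j)\<^sup>2" using xj yj by (auto simp: N_def)
    then show "\<bar>x j\<bar> \<ge> 1 / N" "\<bar>y j\<bar> \<ge> 1 / N"
      using N by (simp_all add: abs_le_square_iff[symmetric])
  qed
  have same: "\<bar>x j + y j\<bar> = \<bar>x j\<bar> + \<bar>y j\<bar>" using sgn by (auto simp: abs_if)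
  \<comment> \<open>The equation of the sphere expresses the remaining coordinate through the
    others. Both values have the same sign and modulus at least 1 / N, so the factor
    \<open>x j + y j\<close> can be divided out.\<close>
  have "(x j)\<^sup>2 - (y j)\<^sup>2 = (\<Sum>i\<in>{..n}-{j}. (y i)\<^sup>2 - (x i)\<^sup>2)"
  proof -
    have "(\<Sum>i\<le>n. (x i)\<^sup>2) = (x j)\<^sup>2 + (\<Sum>i\<in>{..n}-{j}. (x i)\<^sup>2)"
         "(\<Sum>i\<le>n. (y i)\<^sup>2) = (y j)\<^sup>2 + (\<Sum>i\<in>{..n}-{j}. (y i)\<^sup>2)"
      using j by (auto intro: sum.remove)
    then show ?thesis using x y by (simp add: sph_def sum_subtractf)
  qed
  also have "\<bar>\<dots>\<bar> \<le> (\<Sum>i\<in>{..n}-{j}. 2 * \<bar>x i - y i\<bar>)"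
  proof (rule order_trans[OF sum_abs], rule sum_mono)
    fix i
    have "\<bar>(y i)\<^sup>2 - (x i)\<^sup>2\<bar> = \<bar>y i + x i\<bar> * \<bar>x i - y i\<bar>"
      by (simp add: power2_eq_square square_diff_square_factored abs_mult abs_minus_commute)
    also have "\<dots> \<le> 2 * \<bar>x i - y i\<bar>"
      using abs_coord_sph_le[OF x, of i] abs_coord_sph_le[OF y, of i]
      by (intro mult_right_mono) auto
    finally show "\<bar>(y i)\<^sup>2 - (x i)\<^sup>2\<bar> \<le> 2 * \<bar>x i - y i\<bar>" .
  qed
  also have "\<dots> \<le> 2 * ((N - 1) * e)" using rest by (simp flip: sum_distrib_left)
  finally have "\<bar>x j - y j\<bar> * \<bar>x j + y j\<bar> \<le> 2 * ((N - 1) * e)"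
    by (simp add: power2_eq_square square_diff_square_factored abs_mult mult.commute)
  moreover have "\<bar>x j - y j\<bar> * (2 / N) \<le> \<bar>x j - y j\<bar> * \<bar>x j + y j\<bar>"
    using abs1 same by (intro mult_left_mono) auto
  ultimately have "\<bar>x j - y j\<bar> * (2 / N) \<le> 2 * ((N - 1) * e)" by linarith
  then have "\<bar>x j - y j\<bar> \<le> N * ((N - 1) * e)" using N by (simp add: field_simps)
  moreover have "(\<Sum>i\<le>n. \<bar>x i - y i\<bar>) = \<bar>x j - y j\<bar> + (\<Sum>i\<in>{..n}-{j}. \<bar>x i - y i\<bar>)"
    using j by (intro sum.remove) auto
  ultimately have "(\<Sum>i\<le>n. \<bar>x i - y i\<bar>) \<le> (N + 1) * ((N - 1) * e)"
    using rest by (simp add: distrib_right)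
  also have "\<dots> \<le> 3 * N\<^sup>2 * e"
  proof -
    have "(N + 1) * (N - 1) \<le> 3 * N\<^sup>2" by (simp add: power2_eq_square algebra_simps add_nonneg_nonneg)
    then show ?thesis using e by (metis mult.assoc mult_right_mono)
  qed
  finally show ?thesis by (simp add: N_def)
qed

text \<open>The lines through the origin in R^(m+2) form an (m+1)-dimensional family, while a
  Lipschitz image of the m-sphere meets only an m-dimensional part of it. Quantitatively: among
  J^(m+1) directions on a grid of mesh 1 / J, each one that is hit is determined by one of O(J^m)
  cells of the sphere. The lower bound \<open>c\<close> keeps the image away from the origin, where
  all lines meet.\<close>

lemma lip_odd_misses_line:
  fixes F :: "(nat \<Rightarrow> real) \<Rightarrow> nat \<Rightarrow> real"
  assumes lip: "\<And>i. i \<le> Suc m \<Longrightarrow> lip_on m (\<lambda>x. F x i)"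
    and c: "c > 0" and big: "\<And>x. x \<in> sph m \<Longrightarrow> \<exists>i\<le>Suc m. \<bar>F x i\<bar> \<ge> c"
  shows "\<exists>p. p (Suc m) = 1 \<and> (\<forall>i>Suc m. p i = 0) \<and> (\<forall>x\<in>sph m. \<forall>s. \<exists>i\<le>Suc m. F x i \<noteq> s * p i)"
proof (rule ccontr)
  assume contr: "\<not> ?thesis"
  obtain L where L: "\<And>i x y. i \<le> Suc m \<Longrightarrow> x \<in> sph m \<Longrightarrow> y \<in> sph m \<Longrightarrow>
        \<bar>F x i - F y i\<bar> \<le> L i * (\<Sum>j\<le>m. \<bar>x j - y j\<bar>)"
    using lip unfolding lip_on_def by metis
  define La where "La = (\<Sum>i\<le>Suc m. \<bar>L i\<bar>)"
  have La: "\<bar>F x i - F y i\<bar> \<le> La * (\<Sum>j\<le>m. \<bar>x j - y j\<bar>)"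
    if "i \<le> Suc m" "x \<in> sph m" "y \<in> sph m" for i x y
  proof -
    have "L i \<le> \<bar>L i\<bar>" by simp
    also have "\<dots> \<le> La" unfolding La_def using that by (intro member_le_sum) auto
    finally show ?thesis using L[OF that] by (meson dual_order.trans mult_right_mono sum_nonneg abs_ge_zero)
  qed
  have La0: "La \<ge> 0" by (simp add: La_def sum_nonneg)
  define C where "C = La * (3 * (real (Suc m))\<^sup>2)"
  \<comment> \<open>Points of one cell of mesh 1 / (K J) have images within C / (K J) of each other.
    Distinct grid directions, scaled by at least \<open>c\<close>, differ by c / J in some
    coordinate, which would have to be covered by two such errors; \<open>K\<close> makes this
    impossible.\<close>
  obtain K :: nat where K: "K \<ge> 1" "real K * c > 2 * C"
  proof -
    obtain K :: nat where "real K > 2 * C / c" using reals_Archimedean2 by blast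
    then have "real (Suc K) > 2 * C / c" by simp
    then show ?thesis using c that[of "Suc K"] by (simp add: pos_divide_less_eq)
  qed
  \<comment> \<open>The sphere has at most 2 (m+1) (3 K J)^m labelled cells. \<open>J\<close>
    exceeds the factor in front of J^m, so there are fewer cells than the J^(m+1) grid
    points.\<close>
  define J where "J = 2 * Suc m * (3 * K) ^ m + 1"
  define N where "N = K * J"
  have J: "J \<ge> 1" and N: "N \<ge> 1" using K by (auto simp: J_def N_def)
  define G where "G = PiE {..m} (\<lambda>_. {1..J})"
  define pt where "pt = (\<lambda>a i. if i \<le> m then real (a i) / real J else if i = Suc m then 1 else (0::real))"
  have "\<exists>x s. x \<in> sph m \<and> (\<forall>i\<le>Suc m. F x i = s * pt a i)" for a
  proof -
    have "pt a (Suc m) = 1" "\<forall>i>Suc m. pt a i = 0" by (auto simp: pt_def)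
    with contr show ?thesis by blast
  qed
  then obtain X s where X: "\<And>a. X a \<in> sph m" and s: "\<And>a i. i \<le> Suc m \<Longrightarrow> F (X a) i = s a * pt a i"
    by metis
  have "\<exists>j\<le>m. (X a j)\<^sup>2 \<ge> 1 / real (Suc m)" for a by (rule sph_large_coordinate[OF X])
  then obtain jj where jj: "\<And>a. jj a \<le> m" "\<And>a. (X a (jj a))\<^sup>2 \<ge> 1 / real (Suc m)" by metis
  \<comment> \<open>The chosen large coordinate and its sign select a patch; the label rounds all
    the other coordinates to mesh 1 / N. On one patch the label determines the grid point.\<close>
  define T where "T = (\<lambda>(j, b). {a\<in>G. jj a = j \<and> (X a j > 0 \<longleftrightarrow> b)})"
  define lab where "lab = (\<lambda>j a. restrict (\<lambda>i. \<lfloor>real N * X a i\<rfloor>) ({..m} - {j}))"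
  have cardT: "card (T (j, b)) \<le> (2 * N + 1) ^ m" if "j \<le> m" for j b
  proof -
    have "inj_on (lab j) (T (j, b))"
    proof (rule inj_onI)
      fix a a' assume a: "a \<in> T (j, b)" and a': "a' \<in> T (j, b)" and eq: "lab j a = lab j a'"
      have close: "\<bar>X a i - X a' i\<bar> \<le> 1 / N" if "i \<le> m" "i \<noteq> j" for i
      proof -
        have "\<lfloor>real N * X a i\<rfloor> = \<lfloor>real N * X a' i\<rfloor>"
          using fun_cong[OF eq, of i] that by (simp add: lab_def)
        then have "\<bar>real N * X a i - real N * X a' i\<bar> \<le> 1" by linarith
        then have "real N * \<bar>X a i - X a' i\<bar> \<le> 1"
          by (simp add: abs_mult flip: right_diff_distrib)
        then show ?thesis using N by (simp add: field_simps)
      qed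
      have "(\<Sum>i\<le>m. \<bar>X a i - X a' i\<bar>) \<le> 3 * (real (Suc m))\<^sup>2 * (1 / N)"
        using a a' jj[of a] jj[of a'] close by (intro sph_patch[of _ _ _ j] X) (auto simp: T_def)
      then have "La * (\<Sum>i\<le>m. \<bar>X a i - X a' i\<bar>) \<le> La * (3 * (real (Suc m))\<^sup>2 * (1 / N))"
        using La0 by (rule mult_left_mono)
      then have F: "\<bar>F (X a) i - F (X a') i\<bar> \<le> C / N" if "i \<le> Suc m" for i
        using La[OF that X X, of a a'] by (simp add: C_def)
      have pt1: "\<bar>pt a i\<bar> \<le> 1" if "a \<in> G" for a i
        using that J by (auto simp: pt_def G_def PiE_iff)
      have aG: "a \<in> G" "a' \<in> G" using a a' by (auto simp: T_def)
      obtain i0 where i0: "i0 \<le> Suc m" "\<bar>F (X a) i0\<bar> \<ge> c" using big X by blast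
      have "c \<le> \<bar>s a\<bar> * \<bar>pt a i0\<bar>" using i0 s by (simp add: abs_mult)
      also have "\<dots> \<le> \<bar>s a\<bar> * 1" using pt1[OF aG(1)] by (intro mult_left_mono) auto
      finally have sc: "c \<le> \<bar>s a\<bar>" by simp
      \<comment> \<open>The last entry of every direction is 1, so \<open>s a\<close> is the last
        coordinate of \<open>F (X a)\<close> and inherits its estimate.\<close>
      have ss: "\<bar>s a - s a'\<bar> \<le> C / N"
        using F[of "Suc m"] s[of "Suc m" a] s[of "Suc m" a'] by (simp add: pt_def)
      have "a i = a' i" if "i \<le> m" for i
      proof (rule ccontr)
        assume "a i \<noteq> a' i"
        then have "1 \<le> \<bar>real (a i) - real (a' i)\<bar>" by linarith
        then have d: "1 / real J \<le> \<bar>pt a i - pt a' i\<bar>"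
          using that J by (simp add: pt_def divide_simps flip: diff_divide_distrib)
        have "s a * (pt a i - pt a' i) = (F (X a) i - F (X a') i) - (s a - s a') * pt a' i"
          using s[of i a] s[of i a'] that by (simp add: algebra_simps)
        then have "\<bar>s a\<bar> * \<bar>pt a i - pt a' i\<bar> \<le> \<bar>F (X a) i - F (X a') i\<bar> + \<bar>s a - s a'\<bar> * \<bar>pt a' i\<bar>"
          by (metis abs_mult abs_triangle_ineq4)
        also have "\<dots> \<le> C / N + C / N * 1"
          using F[of i] that ss pt1[OF aG(2), of i] by (intro add_mono mult_mono) auto
        finally have "\<bar>s a\<bar> * \<bar>pt a i - pt a' i\<bar> \<le> 2 * C / N" by simp
        moreover have "c * (1 / real J) \<le> \<bar>s a\<bar> * \<bar>pt a i - pt a' i\<bar>"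
          using sc d c by (intro mult_mono) auto
        ultimately have "c / J \<le> 2 * C / (real K * real J)" by (simp add: N_def)
        then have "c * K \<le> 2 * C" using J K by (simp add: field_simps)
        then show False using K by (simp add: mult.commute)
      qed
      then show "a = a'" using aG by (auto simp: G_def intro: PiE_ext)
    qed
    moreover have "lab j ` T (j, b) \<subseteq> PiE ({..m} - {j}) (\<lambda>_. {-int N..int N})"
    proof clarify
      fix a
      have "\<bar>real N * X a i\<bar> \<le> real N" for i
        using abs_coord_sph_le[OF X, of a i] N by (simp add: abs_mult)
      then have "- real N \<le> real N * X a i" "real N * X a i \<le> real N" for i
        by (simp_all add: abs_le_iff) (metis minus_le_iff)
      then have "- int N \<le> \<lfloor>real N * X a i\<rfloor>" "\<lfloor>real N * X a i\<rfloor> \<le> int N" for i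
        by (simp_all add: le_floor_iff floor_le_iff) (smt (verit, best))
      then show "lab j a \<in> PiE ({..m} - {j}) (\<lambda>_. {-int N..int N})"
        by (auto simp: lab_def)
    qed
    moreover have "card (PiE ({..m} - {j}) (\<lambda>_. {-int N..int N})) = (2 * N + 1) ^ m"
    proof -
      have "card ({..m} - {j}) = m" using that by simp
      moreover have "nat (2 * int N + 1) = 2 * N + 1" by simp
      ultimately show ?thesis by (simp add: card_PiE)
    qed
    ultimately show ?thesis
      by (metis card_inj_on_le finite_Diff finite_PiE finite_atLeastAtMost_int finite_atMost)
  qed
  have "G = (\<Union>z\<in>{..m} \<times> UNIV. T z)" using jj by (auto simp: T_def)
  then have "card G \<le> (\<Sum>z\<in>{..m} \<times> UNIV. card (T z))" by (simp add: card_UN_le)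
  also have "\<dots> \<le> (\<Sum>z\<in>{..m} \<times> (UNIV::bool set). (2 * N + 1) ^ m)"
    using cardT by (intro sum_mono) auto
  also have "\<dots> = 2 * Suc m * (2 * N + 1) ^ m" by (simp add: card_cartesian_product)
  also have "\<dots> \<le> 2 * Suc m * (3 * N) ^ m" using N by (intro mult_left_mono power_mono) auto
  also have "\<dots> = (2 * Suc m * (3 * K) ^ m) * J ^ m" by (simp add: N_def power_mult_distrib algebra_simps)
  also have "\<dots> < J * J ^ m" using J by (intro mult_strict_right_mono) (auto simp: J_def)
  finally show False by (simp add: G_def card_PiE)
qed

text \<open>A small perturbation keeps the equator away from some line; pushing the image of the equator
  along that line then gives an odd map that preserves the equator, to which the degree step applies.\<close>

theorem odd_degree_of_odd_map:
  assumes "continuous_map (nsphere n) (nsphere n) f"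
    and "\<And>x. x \<in> sph n \<Longrightarrow> f (\<lambda>i. - x i) = (\<lambda>i. - f x i)"
  shows "odd (Brouwer_degree2 n f)"
  using assms
proof (induction n arbitrary: f)
  case 0
  \<comment> \<open>The 0-sphere consists of two points, so an odd self-map is the identity or the
    reflection, of degree 1 or -1.\<close>
  define e :: "nat \<Rightarrow> real" where "e = (\<lambda>i. if i = 0 then 1 else 0)"
  have sph0: "x = e \<or> x = (\<lambda>i. - e i)" if "x \<in> sph 0" for x
  proof -
    have "x 0 = 1 \<or> x 0 = -1" using that by (simp add: sph_def power2_eq_1_iff)
    then show ?thesis using that by (auto simp: sph_def e_def fun_eq_iff)
  qed
  have e: "e \<in> sph 0" by (simp add: sph_def e_def)
  then have "f e \<in> sph 0" using 0 by (auto simp: continuous_map_sph_iff)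
  then consider "f e = e" | "f e = (\<lambda>i. - e i)" using sph0 by blast
  then show ?case
  proof cases
    case 1
    then have "f x = id x" if "x \<in> sph 0" for x using sph0[OF that] 0(2)[OF e] by auto
    then have "Brouwer_degree2 0 f = Brouwer_degree2 0 id" by (intro Brouwer_degree2_eq) simp
    then show ?thesis by simp
  next
    case 2
    then have "f x = (\<lambda>i. if i = 0 then - x i else x i)" if "x \<in> sph 0" for x
    proof -
      have "f x = (\<lambda>i. - x i)" using sph0[OF that] 0(2)[OF e] 2 by auto
      then show ?thesis using that by (auto simp: sph_def)
    qed
    then have "Brouwer_degree2 0 f = Brouwer_degree2 0 (\<lambda>x i. if i = 0 then - x i else x i)"
      by (intro Brouwer_degree2_eq) simp
    then show ?thesis by (simp add: Brouwer_degree2_reflection)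
  qed
next
  case (Suc m)
  define n where "n = Suc m"
  \<comment> \<open>A unit vector in R^(n+1) has a coordinate of modulus at least 1 / (n+1) = 2 c.
    An approximation with error below \<open>c\<close> keeps that coordinate at modulus at least
    \<open>c\<close>, and the segment from \<open>f\<close> to it avoids 0.\<close>
  define c where "c = 1 / (2 * real (Suc n))"
  have c: "c > 0" by (simp add: c_def)
  have fc: "continuous_on (sph n) (\<lambda>x. f x i)" and fs: "x \<in> sph n \<Longrightarrow> f x \<in> sph n" for i x
    using Suc.prems(1) by (auto simp: continuous_map_sph_iff n_def)
  have fodd: "x \<in> sph n \<Longrightarrow> f (\<lambda>i. - x i) i = - f x i" for x i
    using Suc.prems(2) by (simp add: n_def)
  have "\<exists>g. lip_on n g \<and> (\<forall>x\<in>sph n. g (\<lambda>i. - x i) = - g x) \<and> (\<forall>x\<in>sph n. \<bar>f x i - g x\<bar> < c)" for i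
    by (intro odd_lipschitz_approximation fc fodd c)
  then obtain g0 where g0: "\<And>i. lip_on n (g0 i)" "\<And>i x. x\<in>sph n \<Longrightarrow> g0 i (\<lambda>i. - x i) = - g0 i x"
      "\<And>i x. x\<in>sph n \<Longrightarrow> \<bar>f x i - g0 i x\<bar> < c"
    by metis
  define g where "g = (\<lambda>x i. if i \<le> n then g0 i x else 0)"
  have glip: "lip_on n (\<lambda>x. g x i)" for i
    unfolding g_def using g0(1)[of i] by (cases "i \<le> n") (auto simp: lip_on_const)
  have gc: "continuous_on (sph n) (\<lambda>x. g x i)" for i by (rule lip_on_continuous[OF glip])
  have godd: "x \<in> sph n \<Longrightarrow> g (\<lambda>i. - x i) i = - g x i" for x i using g0(2) by (simp add: g_def)
  have gz: "i > n \<Longrightarrow> g x i = 0" for i x by (simp add: g_def)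
  have close: "\<bar>f x i - g x i\<bar> < c" if "x \<in> sph n" "i \<le> n" for x i
    using g0(3) that by (simp add: g_def)
  have big: "\<exists>i\<le>n. \<bar>f x i\<bar> \<ge> 2 * c" if x: "x \<in> sph n" for x
  proof -
    obtain j where j: "j \<le> n" "(f x j)\<^sup>2 \<ge> 1 / real (Suc n)"
      using sph_large_coordinate[OF fs[OF x]] by blast
    have "(1 / real (Suc n))\<^sup>2 \<le> 1 / real (Suc n)"
      using power_decreasing[of 1 2 "1 / real (Suc n)"] by simp
    then have "(1 / real (Suc n))\<^sup>2 \<le> (f x j)\<^sup>2" using j by linarith
    then have "\<bar>f x j\<bar> \<ge> 1 / real (Suc n)" by (simp add: abs_le_square_iff[symmetric])
    then show ?thesis using j by (intro exI[of _ j]) (simp add: c_def field_simps)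
  qed
  have gbig: "\<exists>i\<le>n. \<bar>g x i\<bar> \<ge> c" if x: "x \<in> sph n" for x
  proof -
    obtain i where "i \<le> n" "\<bar>f x i\<bar> \<ge> 2 * c" using big[OF x] by blast
    then show ?thesis using close[OF x, of i] by (intro exI[of _ i]) linarith
  qed
  obtain p where p: "p n = 1" "\<And>i. i > n \<Longrightarrow> p i = 0"
    "\<And>x s. x \<in> sph m \<Longrightarrow> \<exists>i\<le>n. g x i \<noteq> s * p i"
  proof -
    have "\<exists>p. p (Suc m) = 1 \<and> (\<forall>i>Suc m. p i = 0) \<and> (\<forall>x\<in>sph m. \<forall>s. \<exists>i\<le>Suc m. g x i \<noteq> s * p i)"
      using gbig sph_mono[of _ m n] by (intro lip_odd_misses_line[OF lip_on_mono[OF glip] c]) (auto simp: n_def)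
    then show ?thesis using that by (auto simp: n_def)
  qed
  \<comment> \<open>As \<open>p n = 1\<close>, the only multiple of \<open>p\<close> that can equal
    \<open>g x\<close> is the one by \<open>g x n\<close>; so \<open>d\<close> vanishes exactly
    where \<open>g x\<close> lies on the line. The cutoff \<open>\<psi>\<close> is even, equals 1 on
    the equator \<open>x n = 0\<close>, and is 0 wherever \<open>d\<close> is.\<close>
  define d where "d = (\<lambda>x. \<Sum>i\<le>n. \<bar>g x i - g x n * p i\<bar>)"
  define \<psi> where "\<psi> = (\<lambda>x. d x / (d x + \<bar>x n\<bar>))"
  have d0: "d x \<ge> 0" for x by (simp add: d_def sum_nonneg)
  have dpos: "d x > 0" if x: "x \<in> sph m" for x
  proof -
    obtain i where "i \<le> n" "g x i \<noteq> g x n * p i" using p(3)[OF x] by blast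
    then have "0 < (\<Sum>i\<le>n. \<bar>g x i - g x n * p i\<bar>)" by (intro sum_pos2[of "{..n}" i]) auto
    then show ?thesis by (simp add: d_def)
  qed
  have eq0: "x \<in> sph m" if "x \<in> sph n" "x n = 0" for x
    using topspace_nsphere_minus1[of x n] that by (simp add: n_def)
  have den: "d x + \<bar>x n\<bar> > 0" if "x \<in> sph n" for x
  proof (cases "x n = 0")
    case True
    then show ?thesis using dpos[OF eq0[OF that]] by simp
  next
    case False
    then show ?thesis using d0[of x] by simp
  qed
  have dc: "continuous_on (sph n) d" unfolding d_def
    by (intro continuous_on_sum continuous_on_rabs continuous_on_diff continuous_on_mult continuous_on_const gc)
  have "continuous_on (sph n) (\<lambda>x. \<bar>x n\<bar>)"
    by (rule continuous_on_rabs[OF continuous_on_subset[OF continuous_on_product_coordinates subset_UNIV]])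
  then have "continuous_on (sph n) (\<lambda>x. d x + \<bar>x n\<bar>)" by (rule continuous_on_add[OF dc])
  moreover have "\<forall>x\<in>sph n. d x + \<bar>x n\<bar> \<noteq> 0" using den by (metis less_irrefl)
  ultimately have \<psi>c: "continuous_on (sph n) \<psi>"
    unfolding \<psi>_def by (rule continuous_on_divide[OF dc])
  have deven: "d (\<lambda>i. - x i) = d x" if "x \<in> sph n" for x
    unfolding d_def godd[OF that] by (intro sum.cong refl) (simp add: abs_minus_commute)
  have \<psi>even: "\<psi> (\<lambda>i. - x i) = \<psi> x" if "x \<in> sph n" for x
    by (simp add: \<psi>_def deven[OF that])
  \<comment> \<open>At time 1 the last coordinate of \<open>g x\<close> is removed on the equator,
    by a push along the line that the image of the equator avoids.\<close>
  define H where "H = (\<lambda>(t, x) i. g x i - t * \<psi> x * g x n * p i)"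
  define h where "h = (\<lambda>x. nmlz n (H (1, x)))"
  \<comment> \<open>A zero of \<open>H\<close> would put \<open>g x\<close> on the line, where the
    cutoff is 0 and \<open>H\<close> is just \<open>g x\<close>, which is not zero.\<close>
  have Hnz: "\<exists>i\<le>n. H (t, x) i \<noteq> 0" if x: "x \<in> sph n" for t x
  proof (rule ccontr)
    assume neg: "\<not> (\<exists>i\<le>n. H (t, x) i \<noteq> 0)"
    define k where "k = t * \<psi> x * g x n"
    have eq: "g x i = k * p i" if "i \<le> n" for i
    proof -
      have "H (t, x) i = 0" using neg that by blast
      then show ?thesis by (simp add: H_def k_def)
    qed
    have "g x n = k" using eq[OF order_refl] unfolding p(1) by (rule trans) (rule mult_1_right)
    then have "d x = 0" unfolding d_def using eq by (intro sum.neutral) (metis abs_zero atMost_iff diff_self)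
    then have "\<psi> x = 0" by (simp add: \<psi>_def)
    then have k0: "k = 0" by (simp add: k_def)
    obtain i where "i \<le> n" "c \<le> \<bar>g x i\<bar>" using gbig[OF x] by blast
    then show False using eq[of i] c unfolding k0 by simp
  qed
  have Hc: "continuous_on ({0..1} \<times> sph n) (\<lambda>y. H y i)" for i
  proof -
    have snd: "continuous_on ({0..1} \<times> sph n) (\<lambda>y. k (snd y))" if "continuous_on (sph n) k" for k :: "_ \<Rightarrow> real"
      by (rule continuous_on_compose2[OF that continuous_on_snd[OF continuous_on_id]]) auto
    have "continuous_on ({0..1} \<times> sph n) (\<lambda>y. g (snd y) i)" for i by (rule snd[OF gc])
    moreover have "continuous_on ({0..1} \<times> sph n) (\<lambda>y. \<psi> (snd y))" by (rule snd[OF \<psi>c])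
    ultimately show ?thesis unfolding H_def case_prod_unfold
      by (intro continuous_on_diff continuous_on_mult continuous_on_const continuous_on_fst continuous_on_id) auto
  qed
  have Hz: "i > n \<Longrightarrow> H (t, x) i = 0" for t x i by (simp add: H_def gz p(2))
  have "Brouwer_degree2 n f = Brouwer_degree2 n (\<lambda>x. nmlz n (g x))"
  proof -
    define H1 where "H1 = (\<lambda>(t, x) i. f x i + t * (g x i - f x i))"
    have "Brouwer_degree2 n (\<lambda>x. nmlz n (H1 (0, x))) = Brouwer_degree2 n (\<lambda>x. nmlz n (H1 (1, x)))"
    proof (rule degree_nmlz_homotopic)
      show "continuous_on ({0..1} \<times> sph n) (\<lambda>y. H1 y i)" for i
      proof -
        have snd: "continuous_on ({0..1} \<times> sph n) (\<lambda>y. k (snd y))" if "continuous_on (sph n) k" for k :: "_ \<Rightarrow> real"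
          by (rule continuous_on_compose2[OF that continuous_on_snd[OF continuous_on_id]]) auto
        have "continuous_on ({0..1} \<times> sph n) (\<lambda>y. g (snd y) i)" "continuous_on ({0..1} \<times> sph n) (\<lambda>y. f (snd y) i)"
          by (rule snd[OF gc], rule snd[OF fc])
        then show ?thesis unfolding H1_def case_prod_unfold
          by (intro continuous_on_diff continuous_on_add continuous_on_mult continuous_on_fst continuous_on_id) auto
      qed
      show "\<exists>i\<le>n. H1 (t, x) i \<noteq> 0" if tx: "t \<in> {0..1}" "x \<in> sph n" for t :: real and x
      proof -
        obtain i where i: "i \<le> n" "\<bar>f x i\<bar> \<ge> 2 * c" using big[OF tx(2)] by blast
        have "\<bar>t * (g x i - f x i)\<bar> \<le> 1 * c"
          using close[OF tx(2) i(1)] tx unfolding abs_mult by (intro mult_mono) auto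
        then have "H1 (t, x) i \<noteq> 0" using i c unfolding H1_def by auto
        then show ?thesis using i by blast
      qed
      show "H1 (t, x) i = 0" if "t \<in> {0..1}" "x \<in> sph n" "i > n" for t x i
        using fs[OF that(2)] that(3) by (simp add: H1_def gz sph_def)
    qed
    moreover have "Brouwer_degree2 n (\<lambda>x. nmlz n (H1 (0, x))) = Brouwer_degree2 n f"
      using fs by (intro Brouwer_degree2_eq) (simp add: H1_def nmlz_sph)
    ultimately show ?thesis by (simp add: H1_def)
  qed
  also have "\<dots> = Brouwer_degree2 n h"
  proof -
    have "Brouwer_degree2 n (\<lambda>x. nmlz n (H (0, x))) = Brouwer_degree2 n (\<lambda>x. nmlz n (H (1, x)))"
      using Hnz Hz by (intro degree_nmlz_homotopic Hc) blast+
    moreover have "H (0, x) = g x" for x by (simp add: H_def)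
    ultimately show ?thesis by (simp add: h_def)
  qed
  finally have deg: "Brouwer_degree2 n f = Brouwer_degree2 n h" .
  have hs: "h x \<in> sph n" if x: "x \<in> sph n" for x
  proof -
    obtain i where "i \<le> n" "H (1, x) i \<noteq> 0" using Hnz[OF x] by blast
    moreover have "\<forall>i>n. H (1, x) i = 0" using Hz by simp
    ultimately show ?thesis unfolding h_def by (rule nmlz_in_sph[rotated])
  qed
  have hc: "continuous_on (sph n) (\<lambda>x. h x i)" for i
    unfolding h_def
  proof (rule continuous_on_nmlz)
    show "continuous_on (sph n) (\<lambda>x. H (1, x) i)" for i
      unfolding H_def using gc \<psi>c by (simp add: continuous_on_diff continuous_on_mult continuous_on_const)
  qed (use Hnz in auto)
  have hodd: "h (\<lambda>i. - x i) = (\<lambda>i. - h x i)" if "x \<in> sph n" for x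
  proof -
    have "H (1, \<lambda>i. - x i) = (\<lambda>i. - H (1, x) i)"
      using that by (simp add: H_def godd \<psi>even fun_eq_iff)
    then show ?thesis by (simp add: h_def nmlz_uminus)
  qed
  have heq: "h x \<in> sph m" if "x \<in> sph m" for x
  proof -
    have xn: "x \<in> sph n" "x n = 0" using that sph_mono[of x m n] by (auto simp: n_def sph_def)
    have "\<psi> x = 1" using dpos[OF that] xn by (simp add: \<psi>_def)
    then have "H (1, x) n = 0" using p(1) by (simp add: H_def)
    then have "h x n = 0" by (simp add: h_def nmlz_def)
    then show ?thesis using hs[OF xn(1)] eq0 by blast
  qed
  \<comment> \<open>For an odd map that preserves the equator, its degree and the degree of its
    restriction have the same parity.\<close>
  have "even (Brouwer_degree2 n h - Brouwer_degree2 (n - Suc 0) h)"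
    using hc hs hodd heq
    by (intro Borsuk_odd_mapping_degree_step) (auto simp: continuous_map_sph_iff n_def)
  moreover have "odd (Brouwer_degree2 m h)"
  proof (rule Suc.IH)
    show "continuous_map (nsphere m) (nsphere m) h"
      using heq continuous_on_subset[OF hc, of "sph m"] sph_mono[of _ m n]
      by (auto simp: continuous_map_sph_iff n_def)
    show "h (\<lambda>i. - x i) = (\<lambda>i. - h x i)" if "x \<in> sph m" for x
      using hodd sph_mono[OF that, of n] by (simp add: n_def)
  qed
  ultimately show ?case using deg by (simp add: n_def)
qed

text \<open>Projected to the n-sphere, such a map has vanishing n-th coordinate, since
  \<open>m \<le> n\<close>. It misses a pole and so has degree 0, whereas an odd map has odd
  degree.\<close>

theorem Borsuk_Ulam_nsphere:
  assumes "m \<le> n"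
    and cont: "continuous_map (nsphere n) (subtopology (Euclidean_space m) (- {\<lambda>i. 0})) f"
    and odd: "\<And>x. x \<in> sph n \<Longrightarrow> f (\<lambda>i. - x i) = (\<lambda>i. - f x i)"
  shows False
proof -
  have fc: "continuous_on (sph n) (\<lambda>x. f x i)" for i
  proof -
    have "continuous_on (sph n) f"
      using cont by (simp add: nsphere_eq_sph Euclidean_space_eq_top_of_set subtopology_subtopology)
    then show ?thesis by (rule continuous_on_product_then_coordinatewise)
  qed
  have f: "f x \<noteq> (\<lambda>i. 0)" "\<And>i. i \<ge> m \<Longrightarrow> f x i = 0" if "x \<in> sph n" for x
  proof -
    have "f x \<in> topspace (subtopology (Euclidean_space m) (- {\<lambda>i. 0}))"
      using continuous_map_image_subset_topspace[OF cont] that unfolding topspace_nsphere_sph by blast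
    then show "f x \<noteq> (\<lambda>i. 0)" "\<And>i. i \<ge> m \<Longrightarrow> f x i = 0" by (auto simp: topspace_Euclidean_space)
  qed
  have nz: "\<exists>i\<le>n. f x i \<noteq> 0" if x: "x \<in> sph n" for x
  proof -
    obtain i where i: "f x i \<noteq> 0" using f(1)[OF x] by (auto simp: fun_eq_iff)
    then have "i < m" using f(2)[OF x] by (meson not_le)
    then show ?thesis using i \<open>m \<le> n\<close> by (intro exI[of _ i]) simp
  qed
  define h where "h = (\<lambda>x. nmlz n (f x))"
  have hs: "h x \<in> sph n" if x: "x \<in> sph n" for x
  proof -
    obtain i where "i \<le> n" "f x i \<noteq> 0" using nz[OF x] by blast
    moreover have "\<forall>i>n. f x i = 0" using f(2)[OF x] \<open>m \<le> n\<close> by simp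
    ultimately show ?thesis unfolding h_def by (rule nmlz_in_sph[rotated])
  qed
  have hcm: "continuous_map (nsphere n) (nsphere n) h"
    using continuous_on_nmlz[OF fc nz] hs by (auto simp: continuous_map_sph_iff h_def)
  have "odd (Brouwer_degree2 n h)"
    using hcm by (rule odd_degree_of_odd_map) (simp add: h_def odd nmlz_uminus)
  moreover have "Brouwer_degree2 n h = 0"
  proof (rule Brouwer_degree2_nonsurjective[OF hcm])
    define e :: "nat \<Rightarrow> real" where "e = (\<lambda>i. if i = n then 1 else 0)"
    have "e \<in> sph n" by (simp add: sph_def e_def if_distrib[of "\<lambda>x. x\<^sup>2"] cong: if_cong)
    moreover have "h x n = 0" if "x \<in> sph n" for x
      using f(2)[OF that \<open>m \<le> n\<close>] by (simp add: h_def nmlz_def)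
    then have "y n = 0" if "y \<in> h ` sph n" for y using that by auto
    moreover have "e n = 1" by (simp add: e_def)
    ultimately have "e \<notin> h ` sph n" by force
    with \<open>e \<in> sph n\<close> show "h ` topspace (nsphere n) \<noteq> topspace (nsphere n)" by auto
  qed
  ultimately show False by simp
qed

section \<open>Smooth bump functions\<close>

lemma Ck_Suc_imp_Ck: "Ck (Suc k) f \<Longrightarrow> Ck k f"
proof (induction k arbitrary: f)
  case 0
  then show ?case
    by (auto simp: continuous_on_eq_continuous_at differentiable_imp_continuous_within)
qed auto

lemma frechet_derivative_add:
  assumes "f differentiable (at x)" "g differentiable (at x)"
  shows "frechet_derivative (\<lambda>x. f x + g x) (at x) = (\<lambda>h. frechet_derivative f (at x) h + frechet_derivative g (at x) h)"
  using assms by (intro frechet_derivative_at[symmetric] has_derivative_add) (auto simp: frechet_derivative_works)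

lemma frechet_derivative_mult_real:
  fixes f g :: "'a::real_normed_vector \<Rightarrow> real"
  assumes "f differentiable (at x)" "g differentiable (at x)"
  shows "frechet_derivative (\<lambda>x. f x * g x) (at x)
    = (\<lambda>h. f x * frechet_derivative g (at x) h + frechet_derivative f (at x) h * g x)"
  using assms by (intro frechet_derivative_at[symmetric] has_derivative_mult) (auto simp: frechet_derivative_works)

lemma Ck_add: "Ck k f \<Longrightarrow> Ck k g \<Longrightarrow> Ck k (\<lambda>x. f x + g x)"
proof (induction k arbitrary: f g)
  case (Suc k)
  then have diff: "f differentiable (at x)" "g differentiable (at x)" for x by auto
  then have "(\<lambda>x. f x + g x) differentiable (at x)" for x
    by (intro differentiable_add)
  then show ?case using Suc by (simp add: frechet_derivative_add[OF diff])
qed (simp add: continuous_on_add)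

lemma Ck_mult: "Ck k f \<Longrightarrow> Ck k g \<Longrightarrow> Ck k (\<lambda>x. f x * g x)"
proof (induction k arbitrary: f g)
  case (Suc k)
  have "Ck k f" "Ck k g" using Suc.prems Ck_Suc_imp_Ck by blast+
  moreover have diff: "f differentiable (at x)" "g differentiable (at x)" for x
    using Suc.prems by auto
  ultimately have "Ck k (\<lambda>x. f x * frechet_derivative g (at x) b + frechet_derivative f (at x) b * g x)"
    if "b \<in> Basis" for b
    using that Suc.prems by (intro Ck_add Suc.IH) auto
  moreover have "(\<lambda>x. f x * g x) differentiable (at x)" for x
    by (intro differentiable_mult diff)
  ultimately show ?case by (simp add: frechet_derivative_mult_real[OF diff])
qed (simp add: continuous_on_mult)

lemma Ck_const: "Ck k (\<lambda>x. c)"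
  by (induction k arbitrary: c) (simp_all add: frechet_derivative_const)

lemma Ck_uminus: "Ck k f \<Longrightarrow> Ck k (\<lambda>x. - f x)"
  using Ck_mult[OF Ck_const[of k "-1"], of f] by simp

lemma Ck_diff: "Ck k f \<Longrightarrow> Ck k g \<Longrightarrow> Ck k (\<lambda>x. f x - g x)"
  using Ck_add[OF _ Ck_uminus, of k f g] by simp

lemma Ck_prod: "finite I \<Longrightarrow> (\<And>i. i \<in> I \<Longrightarrow> Ck k (f i)) \<Longrightarrow> Ck k (\<lambda>x. \<Prod>i\<in>I. f i x)"
  by (induction I rule: finite_induct) (simp_all add: Ck_const Ck_mult)

lemma smooth_differentiable: "\<forall>k. Ck k f \<Longrightarrow> f differentiable (at x)"
  by (metis Ck.simps(2))

lemma smooth_continuous: "\<forall>k. Ck k f \<Longrightarrow> continuous_on UNIV f"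
  by (metis Ck.simps(1))

lemma smooth_partial:
  assumes "\<forall>k. Ck k f" "b \<in> Basis" shows "\<forall>k. Ck k (\<lambda>x. frechet_derivative f (at x) b)"
  using assms by (metis Ck.simps(2))

lemma smooth_has_derivative: "\<forall>k. Ck k f \<Longrightarrow> (f has_derivative frechet_derivative f (at x)) (at x)"
  by (simp add: smooth_differentiable flip: frechet_derivative_works)

lemma smooth_derivative_eq_sum:
  assumes "\<forall>k. Ck k (f :: 'a::euclidean_space \<Rightarrow> real)"
  shows "frechet_derivative f (at x) h = (\<Sum>b\<in>Basis. (h \<bullet> b) * frechet_derivative f (at x) b)"
proof -
  interpret linear "frechet_derivative f (at x)"
    using smooth_has_derivative[OF assms, of x] by (simp add: has_derivative_linear)
  have "frechet_derivative f (at x) (\<Sum>b\<in>Basis. (h \<bullet> b) *\<^sub>R b) = (\<Sum>b\<in>Basis. (h \<bullet> b) * frechet_derivative f (at x) b)"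
    by (simp add: sum scaleR)
  then show ?thesis by (simp add: euclidean_representation)
qed

lemma smooth_continuous_derivative:
  assumes "\<forall>k. Ck k (f :: 'a::euclidean_space \<Rightarrow> real)"
  shows "continuous_on UNIV (\<lambda>x. frechet_derivative f (at x) h)"
proof -
  have "continuous_on UNIV (\<lambda>x. \<Sum>b\<in>Basis. (h \<bullet> b) * frechet_derivative f (at x) b)"
    using smooth_continuous[OF smooth_partial[OF assms]] by (intro continuous_intros) auto
  then show ?thesis using smooth_derivative_eq_sum[OF assms] by (metis (no_types, lifting) ext)
qed

text \<open>All derivatives of \<open>exp (- 1 / t)\<close>, extended by \<open>0\<close> to \<open>t \<le> 0\<close>, are linear
  combinations of these functions.\<close>

definition flat :: "nat \<Rightarrow> real \<Rightarrow> real" where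
  "flat j t = (if t > 0 then exp (- (1 / t)) / t ^ j else 0)"

lemma flat_has_derivative: "(flat j has_real_derivative (flat (j + 2) t - real j * flat (j + 1) t)) (at t)"
proof -
  consider "t > 0" | "t < 0" | "t = 0" by linarith
  then show ?thesis
  proof cases
    case 1
    have "((\<lambda>t. exp (- (1 / t)) / t ^ j) has_real_derivative
        ((exp (- (1 / t)) * (1 / t\<^sup>2)) * t ^ j - exp (- (1 / t)) * (real j * t ^ (j - 1))) / (t ^ j * t ^ j)) (at t)"
      using 1 by (auto intro!: derivative_eq_intros simp: power2_eq_square)
    moreover have "((exp (- (1 / t)) * (1 / t\<^sup>2)) * t ^ j - exp (- (1 / t)) * (real j * t ^ (j - 1))) / (t ^ j * t ^ j)
        = flat (j + 2) t - real j * flat (j + 1) t"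
      using 1 by (cases j) (auto simp: flat_def field_simps power2_eq_square)
    ultimately have "((\<lambda>t. exp (- (1 / t)) / t ^ j) has_real_derivative
         flat (j + 2) t - real j * flat (j + 1) t) (at t)" by simp
    then show ?thesis
      by (rule has_field_derivative_transform_within_open[of _ _ _ "{0<..}"]) (use 1 in \<open>auto simp: flat_def\<close>)
  next
    case 2
    have "((\<lambda>t. 0) has_real_derivative 0) (at t)" by simp
    then have "(flat j has_real_derivative 0) (at t)"
      by (rule has_field_derivative_transform_within_open[of _ _ _ "{..<0}"]) (use 2 in \<open>auto simp: flat_def\<close>)
    then show ?thesis using 2 by (simp add: flat_def)
  next
    case 3
    have "((\<lambda>h. flat j h / h) \<longlongrightarrow> 0) (at 0)"
    proof (rule filterlim_split_at)
      have "((\<lambda>h::real. exp (- (1 / h)) / h ^ j / h) \<longlongrightarrow> 0) (at_right 0)"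
        by real_asymp
      then show "((\<lambda>h. flat j h / h) \<longlongrightarrow> 0) (at_right 0)"
        by (rule Lim_transform_eventually) (auto simp: flat_def eventually_at_filter)
      show "((\<lambda>h. flat j h / h) \<longlongrightarrow> 0) (at_left 0)"
        by (rule Lim_transform_eventually[OF tendsto_const]) (auto simp: flat_def eventually_at_filter)
    qed
    then show ?thesis using 3 by (simp add: has_field_derivative_iff flat_def)
  qed
qed

text \<open>The induction must range over all \<open>j\<close>, since one derivative leads from
  \<open>flat j\<close> to \<open>flat (j + 1)\<close> and \<open>flat (j + 2)\<close>. Affine
  functions of a single coordinate suffice, because the bumps are products over coordinates.\<close>

lemma Ck_flat_affine: "Ck k (\<lambda>x::'a::euclidean_space. flat j (c * (x \<bullet> b) + d))"
proof (induction k arbitrary: j)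
  case 0
  have "continuous_on UNIV (flat j)"
    using flat_has_derivative DERIV_isCont by (force simp: continuous_on_eq_continuous_at)
  then show ?case
    by (auto intro!: continuous_on_compose2[of UNIV "flat j"] continuous_intros)
next
  case (Suc k)
  have der: "((\<lambda>x::'a. flat j (c * (x \<bullet> b) + d)) has_derivative
      (\<lambda>h. (flat (j + 2) (c * (x \<bullet> b) + d) - real j * flat (j + 1) (c * (x \<bullet> b) + d)) * (c * (h \<bullet> b)))) (at x)" for x
    by (rule has_derivative_compose[OF _ flat_has_derivative[unfolded has_field_derivative_def], of _ _ x UNIV])
      (auto intro!: derivative_eq_intros)
  have "frechet_derivative (\<lambda>x::'a. flat j (c * (x \<bullet> b) + d)) (at x) =
      (\<lambda>h. (flat (j + 2) (c * (x \<bullet> b) + d) - real j * flat (j + 1) (c * (x \<bullet> b) + d)) * (c * (h \<bullet> b)))" for x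
    using frechet_derivative_at[OF der] by simp
  then show ?case using der
    by (auto simp: differentiable_def intro!: Ck_mult Ck_diff Ck_const Suc)
qed

lemma flat_0_nonneg: "flat 0 t \<ge> 0" and flat_0_le_1: "flat 0 t \<le> 1" and flat_0_pos: "flat 0 t > 0 \<longleftrightarrow> t > 0"
  by (auto simp: flat_def)

text \<open>The parameter \<open>n\<close> is a steepness. For \<open>n > 0\<close> each factor at a
  point of the open box is \<open>exp (- (1 / (n * t)))\<close>, where \<open>t\<close> is the
  distance to a face, so the bumps tend to the indicator of the box as \<open>n\<close>
  grows.\<close>

definition box_bump :: "'a::euclidean_space \<Rightarrow> 'a \<Rightarrow> nat \<Rightarrow> 'a \<Rightarrow> real" where
  "box_bump a c n x = (\<Prod>b\<in>Basis. flat 0 (real n * (x \<bullet> b) + - real n * (a \<bullet> b)) *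
                                     flat 0 (- real n * (x \<bullet> b) + real n * (c \<bullet> b)))"

lemma Ck_box_bump: "Ck k (box_bump a c n)"
  unfolding box_bump_def[abs_def] by (intro Ck_prod Ck_mult Ck_flat_affine finite_Basis)

lemma box_bump_nonneg: "box_bump a c n x \<ge> 0" and box_bump_le_1: "box_bump a c n x \<le> 1"
  unfolding box_bump_def
  by (intro prod_nonneg prod_le_1 conjI mult_nonneg_nonneg mult_le_one flat_0_nonneg flat_0_le_1)+

lemma box_bump_pos: "n > 0 \<Longrightarrow> box_bump a c n x > 0 \<longleftrightarrow> x \<in> box a c"
proof -
  assume n: "n > 0"
  have "box_bump a c n x > 0" if "x \<in> box a c"
    unfolding box_bump_def using that n
    by (intro prod_pos ballI) (auto simp: flat_0_pos mem_box zero_less_mult_iff simp flip: right_diff_distrib)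
  moreover have "box_bump a c n x = 0" if x: "x \<notin> box a c"
  proof -
    obtain b where b: "b \<in> Basis" "\<not> (a \<bullet> b < x \<bullet> b) \<or> \<not> (x \<bullet> b < c \<bullet> b)" using x by (auto simp: mem_box)
    then have "flat 0 (real n * (x \<bullet> b) + - real n * (a \<bullet> b)) = 0 \<or> flat 0 (- real n * (x \<bullet> b) + real n * (c \<bullet> b)) = 0"
      using n by (auto simp: flat_def)
    then show ?thesis unfolding box_bump_def using b(1) by (intro prod_zero) auto
  qed
  ultimately show ?thesis by force
qed

lemma box_bump_tendsto_1: "x \<in> box a c \<Longrightarrow> (\<lambda>n. box_bump a c n x) \<longlonglongrightarrow> 1"
proof -
  assume x: "x \<in> box a c"
  have fl: "(\<lambda>n. flat 0 (real n * s)) \<longlonglongrightarrow> 1" if "s > 0" for s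
  proof (rule Lim_transform_eventually)
    show "(\<lambda>n. exp (- (1 / (real n * s)))) \<longlonglongrightarrow> 1" using that by real_asymp
    show "\<forall>\<^sub>F n in sequentially. exp (- (1 / (real n * s))) = flat 0 (real n * s)"
      using eventually_gt_at_top[of 0] by eventually_elim (use that in \<open>auto simp: flat_def\<close>)
  qed
  have "(\<lambda>n. box_bump a c n x) \<longlonglongrightarrow> (\<Prod>b\<in>(Basis::'a set). 1 * 1)"
    unfolding box_bump_def
  proof (intro tendsto_intros)
    fix b :: 'a assume "b \<in> Basis"
    then have "x \<bullet> b - a \<bullet> b > 0" "c \<bullet> b - x \<bullet> b > 0" using x by (auto simp: mem_box)
    from this[THEN fl]
    show "(\<lambda>n. flat 0 (real n * (x \<bullet> b) + - real n * (a \<bullet> b))) \<longlonglongrightarrow> 1"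
      "(\<lambda>n. flat 0 (- real n * (x \<bullet> b) + real n * (c \<bullet> b))) \<longlonglongrightarrow> 1"
      by (simp_all add: algebra_simps)
  qed
  then show ?thesis by simp
qed

lemma box_bump_test_function:
  assumes "cbox a c \<subseteq> \<Omega>" "n > 0" shows "box_bump a c n \<in> test_functions \<Omega>"
proof -
  have "{x. box_bump a c n x \<noteq> 0} \<subseteq> cbox a c"
    using box_bump_pos[OF assms(2), of a c] box_subset_cbox box_bump_nonneg[of a c n]
    by (smt (verit, best) mem_Collect_eq subset_iff)
  then have sub: "closure {x. box_bump a c n x \<noteq> 0} \<subseteq> cbox a c"
    by (rule closure_minimal[OF _ closed_cbox])
  then have "compact (closure {x. box_bump a c n x \<noteq> 0})"
    using bounded_subset[OF bounded_cbox] by (simp add: compact_eq_bounded_closed)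
  then show ?thesis using sub assms(1) by (auto simp: test_functions_def Ck_box_bump)
qed

section \<open>Weak derivatives\<close>

lemma Lp_locD:
  assumes "u \<in> Lp_loc \<Omega> 1" "compact K" "K \<subseteq> \<Omega>"
  shows "integrable (lebesgue_on K) u"
proof -
  have u: "u \<in> borel_measurable (lebesgue_on \<Omega>)" and i: "integrable (lebesgue_on K) (\<lambda>x. \<bar>u x\<bar> powr 1)"
    using assms by (auto simp: Lp_loc_def)
  have "u \<in> borel_measurable (lebesgue_on K)"
    using measurable_restrict_mono[OF u assms(3)] .
  then show ?thesis
    using i by (intro Bochner_Integration.integrable_bound[OF i]) auto
qed

lemma borel_measurable_lebesgue_on_continuous:
  fixes g :: "'a::euclidean_space \<Rightarrow> real"
  assumes "continuous_on UNIV g" shows "g \<in> borel_measurable (lebesgue_on S)"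
proof -
  have "g \<in> borel_measurable borel" using assms by (rule borel_measurable_continuous_onI)
  then have "g \<in> borel_measurable lebesgue" by (simp add: measurable_completion)
  then show ?thesis by (rule measurable_restrict_space1)
qed

lemma Lp_loc_mult_integrable:
  fixes g :: "'a::euclidean_space \<Rightarrow> real"
  assumes u: "u \<in> Lp_loc \<Omega> 1" and \<Omega>: "open \<Omega>" and g: "continuous_on UNIV g"
    and K: "compact K" "K \<subseteq> \<Omega>" "{x. g x \<noteq> 0} \<subseteq> K"
  shows "integrable (lebesgue_on \<Omega>) (\<lambda>x. u x * g x)"
proof -
  have iu: "integrable (lebesgue_on K) u" by (rule Lp_locD[OF u K(1,2)])
  have "compact (g ` K)" using K(1) g by (meson compact_continuous_image continuous_on_subset subset_UNIV)
  then obtain C where C: "\<And>x. x \<in> K \<Longrightarrow> norm (g x) \<le> C"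
    by (meson bounded_iff compact_imp_bounded imageI)
  have [measurable]: "g \<in> borel_measurable (lebesgue_on K)" by (rule borel_measurable_lebesgue_on_continuous[OF g])
  have [measurable]: "u \<in> borel_measurable (lebesgue_on K)" using iu by simp
  have "integrable (lebesgue_on K) (\<lambda>x. u x * g x)"
  proof (rule Bochner_Integration.integrable_bound)
    show "integrable (lebesgue_on K) (\<lambda>x. C * u x)" using iu by simp
    show "AE x in lebesgue_on K. norm (u x * g x) \<le> norm (C * u x)"
    proof (rule AE_I2)
      fix x assume "x \<in> space (lebesgue_on K)"
      then have "\<bar>g x\<bar> \<le> \<bar>C\<bar>" using C[of x] by (simp add: space_restrict_space) 
      then show "norm (u x * g x) \<le> norm (C * u x)"
        by (simp add: abs_mult mult.commute[of "\<bar>u x\<bar>"] mult_right_mono)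
    qed
  qed simp
  then have "integrable lebesgue (\<lambda>x. indicator K x *\<^sub>R (u x * g x))"
    using K by (subst (asm) integrable_restrict_space) (auto simp: lmeasurable_compact fmeasurableD)
  also have "(\<lambda>x. indicator K x *\<^sub>R (u x * g x)) = (\<lambda>x. indicator \<Omega> x *\<^sub>R (u x * g x))"
    using K by (auto simp: indicator_def fun_eq_iff)
  finally show ?thesis
    using \<Omega> by (subst integrable_restrict_space) (auto simp: borel_open)
qed

lemma frechet_derivative_outside_support:
  fixes \<phi> :: "'a::euclidean_space \<Rightarrow> real"
  assumes x: "x \<notin> closure {x. \<phi> x \<noteq> 0}"
  shows "frechet_derivative \<phi> (at x) b = 0"
proof -
  have "((\<lambda>x. 0) has_derivative (\<lambda>h. 0)) (at x)" by simp
  then have "(\<phi> has_derivative (\<lambda>h. 0)) (at x)"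
  proof (rule has_derivative_transform_within_open)
    show "open (- closure {x. \<phi> x \<noteq> 0})" by (rule open_Compl[OF closed_closure])
    show "x \<in> - closure {x. \<phi> x \<noteq> 0}" using x by simp
    show "0 = \<phi> y" if "y \<in> - closure {x. \<phi> x \<noteq> 0}" for y
      using that closure_subset[of "{x. \<phi> x \<noteq> 0}"] by auto
  qed
  then have "frechet_derivative \<phi> (at x) = (\<lambda>h. 0)" by (rule frechet_derivative_at[symmetric])
  then show ?thesis by simp
qed

lemma test_function_support:
  assumes "\<phi> \<in> test_functions \<Omega>"
  obtains K where "compact K" "K \<subseteq> \<Omega>" "{x. \<phi> x \<noteq> 0} \<subseteq> K"
    "\<And>b. {x. frechet_derivative \<phi> (at x) b \<noteq> 0} \<subseteq> K"
proof
  let ?K = "closure {x. \<phi> x \<noteq> 0}"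
  show "compact ?K" "?K \<subseteq> \<Omega>" using assms by (auto simp: test_functions_def)
  show "{x. \<phi> x \<noteq> 0} \<subseteq> ?K" by (rule closure_subset)
  show "{x. frechet_derivative \<phi> (at x) b \<noteq> 0} \<subseteq> ?K" for b
  proof (rule subsetI, rule ccontr)
    fix x assume "x \<in> {x. frechet_derivative \<phi> (at x) b \<noteq> 0}" "x \<notin> ?K"
    then show False using frechet_derivative_outside_support[of x \<phi> b] by simp
  qed
qed

lemma test_function_eq_0_outside:
  assumes "\<phi> \<in> test_functions \<Omega>" "x \<notin> \<Omega>"
  shows "\<phi> x = 0" "frechet_derivative \<phi> (at x) b = 0"
proof -
  have "x \<notin> closure {x. \<phi> x \<noteq> 0}" using assms by (auto simp: test_functions_def)
  then show "frechet_derivative \<phi> (at x) b = 0" by (rule frechet_derivative_outside_support)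
  have "x \<notin> {x. \<phi> x \<noteq> 0}"
    using \<open>x \<notin> closure {x. \<phi> x \<noteq> 0}\<close> closure_subset[of "{x. \<phi> x \<noteq> 0}"] by auto
  then show "\<phi> x = 0" by simp
qed

lemma test_functionD:
  assumes "\<phi> \<in> test_functions \<Omega>"
  shows "\<forall>k. Ck k \<phi>" "continuous_on UNIV \<phi>" "continuous_on UNIV (\<lambda>x. frechet_derivative \<phi> (at x) b)"
    "(\<phi> has_derivative frechet_derivative \<phi> (at x)) (at x)"
  using assms by (auto simp: test_functions_def intro: smooth_continuous smooth_continuous_derivative smooth_has_derivative)

lemma Lp_loc_test_integrable:
  assumes u: "u \<in> Lp_loc \<Omega> 1" and \<Omega>: "open \<Omega>" and \<phi>: "\<phi> \<in> test_functions \<Omega>"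
  shows "integrable (lebesgue_on \<Omega>) (\<lambda>x. u x * \<phi> x)"
    "integrable (lebesgue_on \<Omega>) (\<lambda>x. u x * frechet_derivative \<phi> (at x) b)"
proof -
  obtain K where K: "compact K" "K \<subseteq> \<Omega>" "{x. \<phi> x \<noteq> 0} \<subseteq> K"
    "\<And>b. {x. frechet_derivative \<phi> (at x) b \<noteq> 0} \<subseteq> K"
    using test_function_support[OF \<phi>] by metis
  show "integrable (lebesgue_on \<Omega>) (\<lambda>x. u x * \<phi> x)"
    by (rule Lp_loc_mult_integrable[OF u \<Omega> test_functionD(2)[OF \<phi>] K(1,2,3)])
  show "integrable (lebesgue_on \<Omega>) (\<lambda>x. u x * frechet_derivative \<phi> (at x) b)"
    by (rule Lp_loc_mult_integrable[OF u \<Omega> test_functionD(3)[OF \<phi>] K(1,2,4)])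
qed

text \<open>Bumps over the box are admissible test functions, bounded by 1 and tending to its
  indicator, so dominated convergence applies. The closed box, a compact subset of \<Omega>,
  supplies the integrable majorant.\<close>

lemma set_integral_box_eq_0:
  fixes w :: "'a::euclidean_space \<Rightarrow> real"
  assumes w: "w \<in> Lp_loc \<Omega> 1" and \<Omega>: "open \<Omega>"
    and zero: "\<And>\<phi>. \<phi> \<in> test_functions \<Omega> \<Longrightarrow> (\<integral>x. w x * \<phi> x \<partial>lebesgue_on \<Omega>) = 0"
    and sub: "cbox a c \<subseteq> \<Omega>"
  shows "(LINT x:box a c|lebesgue. w x) = 0"
proof -
  have \<Omega>s: "\<Omega> \<inter> space lebesgue \<in> sets lebesgue" using \<Omega> by (simp add: borel_open)
  have "integrable (lebesgue_on (cbox a c)) w" by (rule Lp_locD[OF w compact_cbox sub])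
  then have iw: "integrable lebesgue (\<lambda>x. indicator (cbox a c) x *\<^sub>R w x)"
    by (subst (asm) integrable_restrict_space) auto
  have "(\<lambda>n. \<integral>x. indicator (cbox a c) x *\<^sub>R w x * box_bump a c (Suc n) x \<partial>lebesgue) \<longlonglongrightarrow>
        (\<integral>x. indicator (box a c) x *\<^sub>R w x \<partial>lebesgue)"
  proof (rule integral_dominated_convergence[where w="\<lambda>x. norm (indicator (cbox a c) x *\<^sub>R w x)"])
    have "(\<lambda>x. indicator (box a c) x *\<^sub>R (indicator (cbox a c) x *\<^sub>R w x)) \<in> borel_measurable lebesgue"
      by (intro borel_measurable_scaleR borel_measurable_indicator borel_measurable_integrable[OF iw]) auto
    also have "(\<lambda>x. indicator (box a c) x *\<^sub>R (indicator (cbox a c) x *\<^sub>R w x)) = (\<lambda>x. indicator (box a c) x *\<^sub>R w x)"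
      using box_subset_cbox by (fastforce simp: indicator_def fun_eq_iff)
    finally show "(\<lambda>x. indicator (box a c) x *\<^sub>R w x) \<in> borel_measurable lebesgue" .
    have "box_bump a c n \<in> borel_measurable lebesgue" for n
      using smooth_continuous[OF allI[OF Ck_box_bump]]
      by (auto intro!: measurable_completion borel_measurable_continuous_onI)
    then show "(\<lambda>x. indicator (cbox a c) x *\<^sub>R w x * box_bump a c (Suc n) x) \<in> borel_measurable lebesgue" for n
      by (intro borel_measurable_times borel_measurable_integrable[OF iw])
    show "integrable lebesgue (\<lambda>x. norm (indicator (cbox a c) x *\<^sub>R w x))" using iw by (rule integrable_norm)
    show "AE x in lebesgue. norm (indicator (cbox a c) x *\<^sub>R w x * box_bump a c (Suc n) x)
         \<le> norm (indicator (cbox a c) x *\<^sub>R w x)" for n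
      using box_bump_nonneg[of a c "Suc n"] box_bump_le_1[of a c "Suc n"]
      by (intro AE_I2) (simp add: abs_mult mult_left_le)
    show "AE x in lebesgue. (\<lambda>n. indicator (cbox a c) x *\<^sub>R w x * box_bump a c (Suc n) x) \<longlonglongrightarrow> indicator (box a c) x *\<^sub>R w x"
    proof (rule AE_I2)
      fix x
      show "(\<lambda>n. indicator (cbox a c) x *\<^sub>R w x * box_bump a c (Suc n) x) \<longlonglongrightarrow> indicator (box a c) x *\<^sub>R w x"
      proof (cases "x \<in> box a c")
        case True
        then have "(\<lambda>n. indicator (cbox a c) x *\<^sub>R w x * box_bump a c (Suc n) x) \<longlonglongrightarrow> indicator (cbox a c) x *\<^sub>R w x * 1"
          by (intro tendsto_mult tendsto_const LIMSEQ_Suc box_bump_tendsto_1)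
        then show ?thesis using True box_subset_cbox[of a c] by (auto simp: indicator_def)
      next
        case False
        then have "box_bump a c (Suc n) x = 0" for n
          using box_bump_pos[of "Suc n" a c x] box_bump_nonneg[of a c "Suc n" x] by simp
        then show ?thesis using False by simp
      qed
    qed
  qed
  moreover have "(\<integral>x. indicator (cbox a c) x *\<^sub>R w x * box_bump a c (Suc n) x \<partial>lebesgue) = 0" for n
  proof -
    have t: "box_bump a c (Suc n) \<in> test_functions \<Omega>" by (rule box_bump_test_function[OF sub]) simp
    have "(\<integral>x. indicator \<Omega> x *\<^sub>R (w x * box_bump a c (Suc n) x) \<partial>lebesgue) = 0"
      using zero[OF t] by (subst (asm) integral_restrict_space[OF \<Omega>s])
    also have "(\<lambda>x. indicator \<Omega> x *\<^sub>R (w x * box_bump a c (Suc n) x)) =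
        (\<lambda>x. indicator (cbox a c) x *\<^sub>R w x * box_bump a c (Suc n) x)"
    proof
      fix x
      have "box_bump a c (Suc n) x = 0" if "x \<notin> cbox a c"
        using box_bump_pos[of "Suc n" a c x] box_bump_nonneg[of a c "Suc n" x] that box_subset_cbox[of a c] by force
      then show "indicator \<Omega> x *\<^sub>R (w x * box_bump a c (Suc n) x) = indicator (cbox a c) x *\<^sub>R w x * box_bump a c (Suc n) x"
        using sub by (cases "x \<in> cbox a c") (auto simp: indicator_def)
    qed
    finally show ?thesis .
  qed
  ultimately show ?thesis
    by (simp add: set_lebesgue_integral_def LIMSEQ_const_iff)
qed

lemma sigma_finite_lebesgue: "sigma_finite_measure (lebesgue :: 'a::euclidean_space measure)"
proof
  have "emeasure lebesgue (ball 0 (real n) :: 'a set) \<noteq> \<infinity>" for n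
    using emeasure_lborel_ball_finite[of "0::'a" "real n"] by simp
  moreover have "\<exists>n. x \<in> ball 0 (real n)" for x :: 'a
    using reals_Archimedean2[of "norm x"] by simp
  ultimately show "\<exists>A. countable A \<and> A \<subseteq> sets (lebesgue :: 'a measure) \<and> \<Union>A = space (lebesgue :: 'a measure) \<and> (\<forall>a\<in>A. emeasure lebesgue a \<noteq> \<infinity>)"
    by (intro exI[of _ "range (\<lambda>n. ball 0 (real n))"]) auto
qed

text \<open>Open boxes form a generator of the Borel sets that is closed under intersection, so
  vanishing integrals spread from boxes to Borel sets and, up to null sets, to Lebesgue sets. A
  function whose integrals over all measurable sets vanish is 0 almost everywhere.\<close>

lemma AE_zero_if_box_integrals_zero:
  fixes w :: "'a::euclidean_space \<Rightarrow> real"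
  assumes int: "set_integrable lebesgue (box a c) w"
    and zero: "\<And>d e. box d e \<subseteq> box a c \<Longrightarrow> (LINT x:box d e|lebesgue. w x) = 0"
  shows "AE x in lebesgue. x \<in> box a c \<longrightarrow> w x = 0"
proof -
  have si: "set_integrable lebesgue (A \<inter> box a c) w" if "A \<in> sets lebesgue" for A
    using that by (intro set_integrable_subset[OF int]) auto
  have borel: "(LINT x:A \<inter> box a c|lebesgue. w x) = 0" if A: "A \<in> sets borel" for A
  proof -
    have st: "Int_stable (range (\<lambda>(a, b). box a b :: 'a set))"
      by (auto simp: Int_stable_def box_Int_box)
    note st
    moreover have "range (\<lambda>(a, b). box a b :: 'a set) \<subseteq> Pow UNIV" by simp
    moreover have "A \<in> sigma_sets UNIV (range (\<lambda>(a, b). box a b :: 'a set))"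
      using A by (simp add: borel_eq_box)
    ultimately show ?thesis
    proof (induction rule: sigma_sets_induct_disjoint)
      case (basic A)
      then obtain d e where "A \<inter> box a c = box d e" by (auto simp: box_Int_box)
      then show ?case using zero[of d e] by auto
    next
      case empty
      then show ?case by (simp add: set_lebesgue_integral_def)
    next
      case (compl A)
      then have A: "A \<in> sets borel" by (simp add: borel_eq_box)
      have "(LINT x:(A \<inter> box a c) \<union> ((UNIV - A) \<inter> box a c)|lebesgue. w x)
        = (LINT x:A \<inter> box a c|lebesgue. w x) + (LINT x:(UNIV - A) \<inter> box a c|lebesgue. w x)"
        using A by (intro set_integral_Un si) auto
      moreover have "(A \<inter> box a c) \<union> ((UNIV - A) \<inter> box a c) = box a c" by blast
      ultimately show ?case using compl zero[of a c] by simp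
    next
      case (union A)
      then have A: "A i \<in> sets borel" for i by (auto simp: borel_eq_box)
      have "(LINT x:(\<Union>i. A i \<inter> box a c)|lebesgue. w x) = suminf (\<lambda>i. LINT x:A i \<inter> box a c|lebesgue. w x)"
      proof (rule lebesgue_integral_countable_add)
        show "A i \<inter> box a c \<in> sets lebesgue" for i using A by auto
        show "A i \<inter> box a c \<inter> (A j \<inter> box a c) = {}" if "i \<noteq> j" for i j
          using union(1) that by (auto simp: disjoint_family_on_def)
        show "set_integrable lebesgue (\<Union>i. A i \<inter> box a c) w"
          using A by (intro set_integrable_subset[OF int]) auto
      qed
      then show ?case using union by simp
    qed
  qed
  have "(LINT x:A \<inter> box a c|lebesgue. w x) = 0" if "A \<in> sets lebesgue" for A
  proof -
    obtain S N N' where S: "A = S \<union> N" "N \<subseteq> N'" "N' \<in> null_sets lborel" "S \<in> sets lborel"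
      using sets_completionE[OF \<open>A \<in> sets lebesgue\<close>] by blast
    have "(LINT x:A \<inter> box a c|lebesgue. w x) = (LINT x:S \<inter> box a c|lebesgue. w x)"
      unfolding set_lebesgue_integral_def
    proof (rule integral_cong_AE)
      show "(\<lambda>x. indicator (A \<inter> box a c) x *\<^sub>R w x) \<in> borel_measurable lebesgue"
        using si[OF that] by (simp add: set_integrable_def borel_measurable_integrable)
      show "(\<lambda>x. indicator (S \<inter> box a c) x *\<^sub>R w x) \<in> borel_measurable lebesgue"
        using si[of S] S by (simp add: set_integrable_def borel_measurable_integrable)
      have "AE x in lebesgue. x \<notin> N'" using S(3) by (intro AE_not_in) (simp add: null_sets_completionI)
      then show "AE x in lebesgue. indicator (A \<inter> box a c) x *\<^sub>R w x = indicator (S \<inter> box a c) x *\<^sub>R w x"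
        by eventually_elim (use S in \<open>auto simp: indicator_def\<close>)
    qed
    then show ?thesis using borel[of S] S(4) by simp
  qed
  then have "(LINT x:A|lebesgue. indicator (box a c) x *\<^sub>R w x) = 0" if "A \<in> sets lebesgue" for A
    using that by (simp add: set_lebesgue_integral_def indicator_inter_arith mult.assoc)
  then have "AE x in lebesgue. indicator (box a c) x *\<^sub>R w x = 0"
    using int unfolding set_integrable_def
    by (intro sigma_finite_measure.density_zero[OF sigma_finite_lebesgue])
  then show ?thesis by eventually_elim (auto simp: indicator_def)
qed

text \<open>\<Omega> is a countable union of closed boxes with rational corners. In the interior of
  each one the function vanishes almost everywhere, and the faces are null sets.\<close>

theorem fundamental_lemma_calculus_of_variations:
  fixes w :: "'a::euclidean_space \<Rightarrow> real"
  assumes w: "w \<in> Lp_loc \<Omega> 1" and \<Omega>: "open \<Omega>"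
    and zero: "\<And>\<phi>. \<phi> \<in> test_functions \<Omega> \<Longrightarrow> (\<integral>x. w x * \<phi> x \<partial>lebesgue_on \<Omega>) = 0"
  shows "AE x in lebesgue_on \<Omega>. w x = 0"
proof -
  define a' :: "('a \<Rightarrow> real \<times> real) \<Rightarrow> 'a" where "a' = (\<lambda>f. \<Sum>i\<in>Basis. fst (f i) *\<^sub>R i)"
  define b' :: "('a \<Rightarrow> real \<times> real) \<Rightarrow> 'a" where "b' = (\<lambda>f. \<Sum>i\<in>Basis. snd (f i) *\<^sub>R i)"
  define I where "I = {f \<in> (Basis::'a set) \<rightarrow>\<^sub>E \<rat> \<times> \<rat>. cbox (a' f) (b' f) \<subseteq> \<Omega>}"
  have un: "\<Omega> = (\<Union>f\<in>I. cbox (a' f) (b' f))"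
    using open_UNION_cbox[OF \<Omega>] by (simp add: a'_def b'_def I_def)
  have "countable I"
  proof (rule countable_subset)
    show "I \<subseteq> (Basis::'a set) \<rightarrow>\<^sub>E \<rat> \<times> \<rat>" by (auto simp: I_def)
    show "countable ((Basis::'a set) \<rightarrow>\<^sub>E (\<rat> \<times> \<rat> :: (real \<times> real) set))"
      by (intro countable_PiE) (auto simp: countable_rat)
  qed
  moreover have "AE x in lebesgue. x \<in> cbox (a' f) (b' f) \<longrightarrow> w x = 0" if f: "f \<in> I" for f
  proof -
    have sub: "cbox (a' f) (b' f) \<subseteq> \<Omega>" using f by (simp add: I_def)
    have "AE x in lebesgue. x \<in> box (a' f) (b' f) \<longrightarrow> w x = 0"
    proof (rule AE_zero_if_box_integrals_zero)
      have "integrable (lebesgue_on (cbox (a' f) (b' f))) w" by (rule Lp_locD[OF w compact_cbox sub])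
      then have "set_integrable lebesgue (cbox (a' f) (b' f)) w"
        unfolding set_integrable_def by (subst (asm) integrable_restrict_space) auto
      then show "set_integrable lebesgue (box (a' f) (b' f)) w"
        by (rule set_integrable_subset) (auto simp: box_subset_cbox)
      show "(LINT x:box d e|lebesgue. w x) = 0" if de: "box d e \<subseteq> box (a' f) (b' f)" for d e
      proof (cases "box d e = {}")
        case False
        then have "cbox d e \<subseteq> cbox (a' f) (b' f)"
          using closure_minimal[OF subset_trans[OF de box_subset_cbox] closed_cbox] closure_box[OF False] by simp
        then show ?thesis using sub by (intro set_integral_box_eq_0[OF w \<Omega> zero]) auto
      qed (simp add: set_lebesgue_integral_def)
    qed
    moreover have "AE x in lebesgue. x \<notin> cbox (a' f) (b' f) - box (a' f) (b' f)"
      using negligible_frontier_interval[of "a' f" "b' f"]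
      by (intro AE_not_in) (simp only: negligible_iff_null_sets)
    ultimately show ?thesis by eventually_elim auto
  qed
  ultimately have "AE x in lebesgue. \<forall>f\<in>I. x \<in> cbox (a' f) (b' f) \<longrightarrow> w x = 0"
    by (subst AE_ball_countable) auto
  then have "AE x in lebesgue. x \<in> \<Omega> \<longrightarrow> w x = 0"
  proof eventually_elim
    case (elim x)
    then show ?case by (subst un) blast
  qed
  then show ?thesis using \<Omega> by (subst AE_restrict_space_iff) (auto simp: borel_open)
qed

section \<open>Inequalities for integrals\<close>

lemma powr_add_le_two_powr:
  assumes "0 \<le> (a::real)" "0 \<le> b" "0 \<le> p" shows "(a + b) powr p \<le> 2 powr p * (a powr p + b powr p)"
proof -
  have "(a + b) powr p \<le> (2 * max a b) powr p" using assms by (intro powr_mono2) auto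
  also have "\<dots> = 2 powr p * max a b powr p" using assms by (simp add: powr_mult)
  also have "\<dots> \<le> 2 powr p * (a powr p + b powr p)" by (intro mult_left_mono) (auto simp: max_def)
  finally show ?thesis .
qed

text \<open>The cases \<open>a = 0\<close> and \<open>b = 0\<close> lie on the boundary of the
  positive reals; there convexity reduces to \<open>s powr p \<le> s\<close> for \<open>s\<close>
  between 0 and 1.\<close>

lemma powr_convex_combination:
  assumes "1 \<le> (p::real)" "0 \<le> a" "0 \<le> b" "0 < t" "t < 1"
  shows "((1 - t) * a + t * b) powr p \<le> (1 - t) * a powr p + t * b powr p"
proof -
  have le: "s powr p \<le> s" if "0 < s" "s < 1" for s :: real
    using powr_mono'[of 1 p s] that assms by simp
  consider "a = 0" | "b = 0" | "a > 0" "b > 0" using assms by fastforce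
  then show ?thesis
  proof cases
    case 1
    then show ?thesis using le[of t] assms by (simp add: powr_mult mult_right_mono)
  next
    case 2
    then show ?thesis using le[of "1 - t"] assms by (simp add: powr_mult mult_right_mono)
  next
    case 3
    then show ?thesis using convex_onD[OF powr_convex[OF assms(1)], of t a b] assms by simp
  qed
qed

text \<open>Convexity is applied to \<open>a / (1 - t)\<close> and \<open>b / t\<close>. The weight
  \<open>t\<close> stays free so that optimizing it yields Minkowski's inequality with constant
  1.\<close>

lemma powr_add_le_weighted:
  assumes "1 \<le> (p::real)" "0 \<le> a" "0 \<le> b" "0 < t" "t < 1"
  shows "(a + b) powr p \<le> (1 - t) powr (1 - p) * a powr p + t powr (1 - p) * b powr p"
proof -
  have "(a + b) powr p = ((1 - t) * (a / (1 - t)) + t * (b / t)) powr p" using assms by simp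
  also have "\<dots> \<le> (1 - t) * (a / (1 - t)) powr p + t * (b / t) powr p"
    using assms by (intro powr_convex_combination) auto
  also have "\<dots> = (1 - t) powr (1 - p) * a powr p + t powr (1 - p) * b powr p"
    using assms by (simp add: powr_divide powr_diff)
  finally show ?thesis .
qed

lemma powr_above_tangent:
  assumes "1 \<le> (p::real)" "0 \<le> a" "0 < c"
  shows "c powr p + p * c powr (p - 1) * (a - c) \<le> a powr p"
proof (cases "a = 0")
  case True
  have "c powr (p - 1) * c = c powr p" using assms by (simp add: powr_diff)
  then have "p * c powr (p - 1) * (a - c) = - (p * c powr p)" using True by (simp add: mult.assoc)
  moreover have "c powr p \<le> p * c powr p" using mult_right_mono[of 1 p "c powr p"] assms by simp
  ultimately have "c powr p + p * c powr (p - 1) * (a - c) \<le> 0" by linarith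
  then show ?thesis using True assms by simp
next
  case False
  have "((\<lambda>x. x powr p) has_real_derivative p * c powr (p - 1)) (at c within {0<..})"
    using assms by (auto intro!: derivative_eq_intros)
  then have "p * c powr (p - 1) * (a - c) \<le> a powr p - c powr p"
    using assms False
    by (intro convex_on_imp_above_tangent[OF powr_convex[OF assms(1)]]) (auto simp: interior_open)
  then show ?thesis by simp
qed

text \<open>Jensen's inequality: the tangent of the p-th power at the mean \<open>c\<close> of
  \<open>\<bar>f\<bar>\<close> lies below the graph, and its linear part integrates to 0.\<close>

lemma (in finite_measure) powr_integral_le:
  assumes p: "1 \<le> p" and f: "integrable M f" and fp: "integrable M (\<lambda>x. \<bar>f x\<bar> powr p)"
  shows "\<bar>integral\<^sup>L M f\<bar> powr p \<le> measure M (space M) powr (p - 1) * (\<integral>x. \<bar>f x\<bar> powr p \<partial>M)"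
proof -
  define V where "V = measure M (space M)"
  define c where "c = (\<integral>x. \<bar>f x\<bar> \<partial>M) / V"
  have ab: "\<bar>integral\<^sup>L M f\<bar> \<le> (\<integral>x. \<bar>f x\<bar> \<partial>M)" by (rule integral_abs_bound)
  have nn: "0 \<le> (\<integral>x. \<bar>f x\<bar> powr p \<partial>M)" by simp
  have V: "V \<ge> 0" by (simp add: V_def)
  show ?thesis
  proof (cases "(\<integral>x. \<bar>f x\<bar> \<partial>M) = 0")
    case True
    then show ?thesis using ab by simp
  next
    case False
    have "V \<noteq> 0"
    proof
      assume "V = 0"
      then have "space M \<in> null_sets M" by (auto simp: V_def measure_eq_0_null_sets emeasure_eq_measure intro!: null_setsI)
      then have "AE x in M. \<bar>f x\<bar> = 0" by (rule AE_I') auto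
      then show False using False by (simp add: integral_eq_zero_AE)
    qed
    then have V0: "V > 0" using V by simp
    moreover have "(\<integral>x. \<bar>f x\<bar> \<partial>M) > 0" using False by (simp add: order_less_le)
    ultimately have c: "c > 0" by (simp add: c_def)
    have "(\<integral>x. c powr p + p * c powr (p - 1) * (\<bar>f x\<bar> - c) \<partial>M) \<le> (\<integral>x. \<bar>f x\<bar> powr p \<partial>M)"
      using f fp powr_above_tangent[OF p _ c] by (intro integral_mono) auto
    moreover have "(\<integral>x. c powr p + p * c powr (p - 1) * (\<bar>f x\<bar> - c) \<partial>M) = V * c powr p"
      using f V0 by (simp add: V_def c_def algebra_simps)
    ultimately have "V * c powr p \<le> (\<integral>x. \<bar>f x\<bar> powr p \<partial>M)" by simp
    then have "V powr (p - 1) * (V * c powr p) \<le> V powr (p - 1) * (\<integral>x. \<bar>f x\<bar> powr p \<partial>M)"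
      by (intro mult_left_mono) auto
    moreover have "V powr (p - 1) * (V * c powr p) = (V * c) powr p"
      using V0 c by (simp add: powr_mult powr_diff)
    moreover have "V * c = (\<integral>x. \<bar>f x\<bar> \<partial>M)" using V0 by (simp add: c_def)
    moreover have "\<bar>integral\<^sup>L M f\<bar> powr p \<le> (\<integral>x. \<bar>f x\<bar> \<partial>M) powr p"
      using ab p by (intro powr_mono2) auto
    ultimately show ?thesis by (simp add: V_def)
  qed
qed

text \<open>If the p-th power is not integrable, then the space has positive measure and the
  right-hand side is infinite; otherwise this is the inequality between reals.\<close>

lemma (in finite_measure) powr_integral_le_nn_integral:
  assumes p: "1 \<le> p" and f: "integrable M f"
  shows "ennreal (\<bar>integral\<^sup>L M f\<bar> powr p)
     \<le> ennreal (measure M (space M) powr (p - 1)) * (\<integral>\<^sup>+x. ennreal (\<bar>f x\<bar> powr p) \<partial>M)"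
proof (cases "integrable M (\<lambda>x. \<bar>f x\<bar> powr p)")
  case True
  then have "(\<integral>\<^sup>+x. ennreal (\<bar>f x\<bar> powr p) \<partial>M) = ennreal (\<integral>x. \<bar>f x\<bar> powr p \<partial>M)"
    by (intro nn_integral_eq_integral) auto
  then show ?thesis
    using ennreal_leI[OF powr_integral_le[OF p f True]] by (simp add: ennreal_mult)
next
  case False
  have [measurable]: "f \<in> borel_measurable M" using f by simp
  have inf: "(\<integral>\<^sup>+x. ennreal (\<bar>f x\<bar> powr p) \<partial>M) = \<infinity>"
    using False by (auto simp: integrable_iff_bounded less_top[symmetric])
  have "measure M (space M) \<noteq> 0"
  proof
    assume "measure M (space M) = 0"
    then have "space M \<in> null_sets M" by (auto simp: emeasure_eq_measure intro!: null_setsI)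
    then have "AE x in M. ennreal (\<bar>f x\<bar> powr p) = 0" by (rule AE_I') auto
    then have "(\<integral>\<^sup>+x. ennreal (\<bar>f x\<bar> powr p) \<partial>M) = 0" by (subst nn_integral_0_iff_AE) auto
    then show False using inf by simp
  qed
  then show ?thesis by (simp add: inf ennreal_mult_top zero_less_measure_iff)
qed

lemma integrable_powr_norm_add:
  fixes f g :: "'a \<Rightarrow> 'b::euclidean_space"
  assumes [measurable]: "f \<in> borel_measurable M" "g \<in> borel_measurable M" and p: "0 \<le> p"
    and f: "integrable M (\<lambda>x. norm (f x) powr p)" and g: "integrable M (\<lambda>x. norm (g x) powr p)"
  shows "integrable M (\<lambda>x. norm (f x + g x) powr p)"
proof (rule Bochner_Integration.integrable_bound)
  show "integrable M (\<lambda>x. 2 powr p * (norm (f x) powr p + norm (g x) powr p))" using f g by simp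
  show "AE x in M. norm (norm (f x + g x) powr p) \<le> norm (2 powr p * (norm (f x) powr p + norm (g x) powr p))"
  proof (rule AE_I2)
    fix x
    have "norm (f x + g x) powr p \<le> (norm (f x) + norm (g x)) powr p"
      using p by (intro powr_mono2 norm_triangle_ineq) auto
    also have "\<dots> \<le> 2 powr p * (norm (f x) powr p + norm (g x) powr p)"
      using p by (intro powr_add_le_two_powr) auto
    finally show "norm (norm (f x + g x) powr p) \<le> norm (2 powr p * (norm (f x) powr p + norm (g x) powr p))"
      by simp
  qed
qed simp

lemma Minkowski_powr_norm:
  fixes f g :: "'a \<Rightarrow> 'b::euclidean_space"
  assumes fm[measurable]: "f \<in> borel_measurable M" and gm[measurable]: "g \<in> borel_measurable M" and p: "1 \<le> p"
    and f: "integrable M (\<lambda>x. norm (f x) powr p)" and g: "integrable M (\<lambda>x. norm (g x) powr p)"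
  shows "(\<integral>x. norm (f x + g x) powr p \<partial>M) powr (1 / p)
    \<le> (\<integral>x. norm (f x) powr p \<partial>M) powr (1 / p) + (\<integral>x. norm (g x) powr p \<partial>M) powr (1 / p)"
proof -
  define F where "F = (\<integral>x. norm (f x) powr p \<partial>M) powr (1 / p)"
  define G where "G = (\<integral>x. norm (g x) powr p \<partial>M) powr (1 / p)"
  have FG0: "F \<ge> 0" "G \<ge> 0" by (simp_all add: F_def G_def)
  have Fp: "(\<integral>x. norm (f x) powr p \<partial>M) = F powr p" and Gp: "(\<integral>x. norm (g x) powr p \<partial>M) = G powr p"
    using p by (simp_all add: F_def G_def powr_powr)
  have zero: "AE x in M. h x = 0"
    if "(\<integral>x. norm (h x) powr p \<partial>M) powr (1 / p) = 0" "integrable M (\<lambda>x. norm (h x) powr p)" for h :: "'a \<Rightarrow> 'b"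
  proof -
    have "(\<integral>x. norm (h x) powr p \<partial>M) = 0" using that by simp
    then have "AE x in M. norm (h x) powr p = 0"
      using that(2) by (subst (asm) integral_nonneg_eq_0_iff_AE) auto
    then show ?thesis by eventually_elim simp
  qed
  consider "F = 0" | "G = 0" | "F > 0" "G > 0" using FG0 by linarith
  then show ?thesis
  proof cases
    case 1
    then have "AE x in M. f x = 0" using zero[of f] f by (simp add: F_def)
    then have "(\<integral>x. norm (f x + g x) powr p \<partial>M) = (\<integral>x. norm (g x) powr p \<partial>M)"
      by (intro integral_cong_AE) auto
    then show ?thesis by simp
  next
    case 2
    then have "AE x in M. g x = 0" using zero[of g] g by (simp add: G_def)
    then have "(\<integral>x. norm (f x + g x) powr p \<partial>M) = (\<integral>x. norm (f x) powr p \<partial>M)"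
      by (intro integral_cong_AE) auto
    then show ?thesis by simp
  next
    case 3
    \<comment> \<open>This weight minimizes the integrated right-hand side of
      \<open>powr_add_le_weighted\<close> and turns it into \<open>(F + G) powr p\<close>.\<close>
    define t where "t = G / (F + G)"
    have t: "0 < t" "t < 1" "1 - t = F / (F + G)" using 3 by (auto simp: t_def field_simps)
    have "(\<integral>x. norm (f x + g x) powr p \<partial>M)
      \<le> (\<integral>x. (1 - t) powr (1 - p) * norm (f x) powr p + t powr (1 - p) * norm (g x) powr p \<partial>M)"
    proof (rule integral_mono)
      show "integrable M (\<lambda>x. norm (f x + g x) powr p)"
        using f g p by (intro integrable_powr_norm_add) auto
      fix x
      have "norm (f x + g x) powr p \<le> (norm (f x) + norm (g x)) powr p"
        using p by (intro powr_mono2 norm_triangle_ineq) auto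
      also have "\<dots> \<le> (1 - t) powr (1 - p) * norm (f x) powr p + t powr (1 - p) * norm (g x) powr p"
        using p t by (intro powr_add_le_weighted) auto
      finally show "norm (f x + g x) powr p \<le> (1 - t) powr (1 - p) * norm (f x) powr p + t powr (1 - p) * norm (g x) powr p" .
    qed (use f g in auto)
    also have "\<dots> = (F / (F + G)) powr (1 - p) * F powr p + (G / (F + G)) powr (1 - p) * G powr p"
      using f g by (simp add: Fp Gp t(3)) (simp add: t_def)
    also have "\<dots> = (F + G) powr p"
    proof -
      have "(H / (F + G)) powr (1 - p) * H powr p = H * (F + G) powr (p - 1)" if "H > 0" for H
        using 3 that by (simp add: powr_divide powr_diff)
      then have "(F / (F + G)) powr (1 - p) * F powr p + (G / (F + G)) powr (1 - p) * G powr p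
          = (F + G) * (F + G) powr (p - 1)" using 3 by (simp add: distrib_right)
      then show ?thesis using 3 by (simp add: powr_diff)
    qed
    finally have "(\<integral>x. norm (f x + g x) powr p \<partial>M) powr (1 / p) \<le> ((F + G) powr p) powr (1 / p)"
      using p by (intro powr_mono2) auto
    also have "\<dots> = F + G" using 3 p by (simp add: powr_powr)
    finally show ?thesis by (simp add: F_def G_def)
  qed
qed

section \<open>Translation invariance and increments of smooth functions\<close>

lemma nn_integral_lborel_translate:
  fixes f :: "'a::euclidean_space \<Rightarrow> ennreal"
  assumes [measurable]: "f \<in> borel_measurable borel"
  shows "(\<integral>\<^sup>+x. f (x + c) \<partial>lborel) = (\<integral>\<^sup>+x. f x \<partial>lborel)"
proof -
  have "(\<integral>\<^sup>+x. f x \<partial>lborel) = (\<integral>\<^sup>+x. f x \<partial>distr lborel borel ((+) c))" by (simp add: lborel_distr_plus)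
  also have "\<dots> = (\<integral>\<^sup>+x. f (c + x) \<partial>lborel)" by (subst nn_integral_distr) auto
  finally show ?thesis by (simp add: add.commute)
qed

lemma integral_lborel_translate:
  fixes f :: "'a::euclidean_space \<Rightarrow> real"
  assumes [measurable]: "f \<in> borel_measurable borel"
  shows "(\<integral>x. f (x + c) \<partial>lborel) = (\<integral>x. f x \<partial>lborel)"
proof -
  have "(\<integral>x. f x \<partial>lborel) = (\<integral>x. f x \<partial>distr lborel borel ((+) c))" by (simp add: lborel_distr_plus)
  also have "\<dots> = (\<integral>x. f (c + x) \<partial>lborel)" by (subst integral_distr) auto
  finally show ?thesis by (simp add: add.commute)
qed

text \<open>The weight \<open>W\<close> at \<open>x + t h\<close> dominates \<open>w\<close> at \<open>x\<close>: the line integrals along the direction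
  \<open>h\<close> are absorbed by translation invariance.\<close>

lemma nn_integral_segments_le:
  fixes g w W :: "'a::euclidean_space \<Rightarrow> ennreal"
  assumes [measurable]: "g \<in> borel_measurable borel" "w \<in> borel_measurable borel" "W \<in> borel_measurable borel"
    and le: "\<And>x t. 0 \<le> t \<Longrightarrow> t \<le> 1 \<Longrightarrow> w x * g (x + t *\<^sub>R h) \<le> W (x + t *\<^sub>R h) * g (x + t *\<^sub>R h)"
  shows "(\<integral>\<^sup>+x. w x * (\<integral>\<^sup>+t. g (x + t *\<^sub>R h) * indicator {0..1} t \<partial>lborel) \<partial>lborel) \<le> (\<integral>\<^sup>+x. W x * g x \<partial>lborel)"
proof -
  have "(\<integral>\<^sup>+x. w x * (\<integral>\<^sup>+t. g (x + t *\<^sub>R h) * indicator {0..1} t \<partial>lborel) \<partial>lborel)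
      = (\<integral>\<^sup>+x. \<integral>\<^sup>+t. w x * (g (x + t *\<^sub>R h) * indicator {0..1::real} t) \<partial>lborel \<partial>lborel)"
    by (simp add: nn_integral_cmult)
  also have "\<dots> = (\<integral>\<^sup>+t. \<integral>\<^sup>+x. w x * (g (x + t *\<^sub>R h) * indicator {0..1::real} t) \<partial>lborel \<partial>lborel)"
    by (rule lborel_pair.Fubini'[symmetric]) measurable
  also have "\<dots> \<le> (\<integral>\<^sup>+t. (\<integral>\<^sup>+x. W (x + t *\<^sub>R h) * g (x + t *\<^sub>R h) \<partial>lborel) * indicator {0..1::real} t \<partial>lborel)"
  proof (rule nn_integral_mono)
    fix t :: real
    have "(\<integral>\<^sup>+x. w x * (g (x + t *\<^sub>R h) * indicator {0..1::real} t) \<partial>lborel)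
       \<le> (\<integral>\<^sup>+x. W (x + t *\<^sub>R h) * g (x + t *\<^sub>R h) * indicator {0..1::real} t \<partial>lborel)"
      using le by (intro nn_integral_mono) (auto simp: indicator_def)
    also have "\<dots> = (\<integral>\<^sup>+x. W (x + t *\<^sub>R h) * g (x + t *\<^sub>R h) \<partial>lborel) * indicator {0..1::real} t"
      by (rule nn_integral_multc) measurable
    finally show "(\<integral>\<^sup>+x. w x * (g (x + t *\<^sub>R h) * indicator {0..1::real} t) \<partial>lborel)
       \<le> (\<integral>\<^sup>+x. W (x + t *\<^sub>R h) * g (x + t *\<^sub>R h) \<partial>lborel) * indicator {0..1::real} t" .
  qed
  also have "\<dots> = (\<integral>\<^sup>+t. (\<integral>\<^sup>+x. W x * g x \<partial>lborel) * indicator {0..1::real} t \<partial>lborel)"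
    using nn_integral_lborel_translate[of "\<lambda>x. W x * g x"] by simp
  also have "\<dots> = (\<integral>\<^sup>+x. W x * g x \<partial>lborel)"
    by (simp add: nn_integral_cmult)
  finally show ?thesis .
qed

lemma smooth_has_real_derivative_line:
  fixes \<phi> :: "'a::euclidean_space \<Rightarrow> real"
  assumes "\<forall>k. Ck k \<phi>"
  shows "((\<lambda>t. \<phi> (x + t *\<^sub>R h)) has_real_derivative frechet_derivative \<phi> (at (x + t *\<^sub>R h)) h) (at t)"
proof -
  have "((\<lambda>t. x + t *\<^sub>R h) has_derivative (\<lambda>s. s *\<^sub>R h)) (at t)"
    by (auto intro!: derivative_eq_intros)
  from has_derivative_compose[OF this smooth_has_derivative[OF assms]]
  have "((\<lambda>t. \<phi> (x + t *\<^sub>R h)) has_derivative (\<lambda>s. frechet_derivative \<phi> (at (x + t *\<^sub>R h)) (s *\<^sub>R h))) (at t)" .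
  moreover have "frechet_derivative \<phi> (at (x + t *\<^sub>R h)) (s *\<^sub>R h) = s * frechet_derivative \<phi> (at (x + t *\<^sub>R h)) h" for s
    using linear_scale[OF has_derivative_linear[OF smooth_has_derivative[OF assms, of "x + t *\<^sub>R h"]], of s h] by simp
  moreover have "(\<lambda>s. s * frechet_derivative \<phi> (at (x + t *\<^sub>R h)) h) = (*) (frechet_derivative \<phi> (at (x + t *\<^sub>R h)) h)"
    by (simp add: fun_eq_iff mult.commute)
  ultimately show ?thesis by (simp add: has_field_derivative_def)
qed

text \<open>The fundamental theorem of calculus along the segment, then Jensen on the unit interval,
  whose measure is 1, so that no constant appears.\<close>

lemma smooth_increment_powr_le:
  fixes \<phi> :: "'a::euclidean_space \<Rightarrow> real"
  assumes \<phi>: "\<forall>k. Ck k \<phi>" and p: "1 \<le> p"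
  shows "ennreal (\<bar>\<phi> (x + h) - \<phi> x\<bar> powr p)
    \<le> (\<integral>\<^sup>+t. ennreal (\<bar>frechet_derivative \<phi> (at (x + t *\<^sub>R h)) h\<bar> powr p) * indicator {0..1} t \<partial>lborel)"
proof -
  define g where "g = (\<lambda>t. frechet_derivative \<phi> (at (x + t *\<^sub>R h)) h)"
  have gc: "continuous_on UNIV g" unfolding g_def
    by (rule continuous_on_compose2[OF smooth_continuous_derivative[OF \<phi>]]) (auto intro!: continuous_intros)
  then have gi: "isCont g t" for t by (simp add: continuous_on_eq_continuous_at)
  have eq: "(\<integral>t. g t * indicator {0..1} t \<partial>lborel) = \<phi> (x + h) - \<phi> x"
    using integral_FTC_Icc_real[of 0 1 "\<lambda>t. \<phi> (x + t *\<^sub>R h)" g] smooth_has_real_derivative_line[OF \<phi>] gi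
    by (simp add: g_def)
  let ?M = "restrict_space lborel {0..1::real}"
  interpret M: finite_measure ?M
    by (rule finite_measureI) (simp add: emeasure_restrict_space space_restrict_space)
  have sp: "measure ?M (space ?M) = 1" by (simp add: measure_restrict_space space_restrict_space)
  have int: "integrable ?M g"
    using borel_integrable_atLeastAtMost[of 0 1 g] gi by (subst integrable_restrict_space) (auto simp: mult.commute)
  have "integral\<^sup>L ?M g = \<phi> (x + h) - \<phi> x"
    using eq by (subst integral_restrict_space) (auto simp: mult.commute)
  then have "ennreal (\<bar>\<phi> (x + h) - \<phi> x\<bar> powr p) \<le> (\<integral>\<^sup>+t. ennreal (\<bar>g t\<bar> powr p) \<partial>?M)"
    using M.powr_integral_le_nn_integral[OF p int] sp by simp
  also have "\<dots> = (\<integral>\<^sup>+t. ennreal (\<bar>g t\<bar> powr p) * indicator {0..1} t \<partial>lborel)"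
    by (subst nn_integral_restrict_space) auto
  finally show ?thesis by (simp add: g_def)
qed

text \<open>The derivative is the limit of difference quotients, and each of these has integral 0 by
  translation invariance. All directions are treated at once, without iterated integrals.\<close>

lemma integral_directional_derivative_eq_0:
  fixes F :: "'a::euclidean_space \<Rightarrow> real"
  assumes F: "F \<in> test_functions UNIV"
  shows "(\<integral>x. frechet_derivative F (at x) b \<partial>lborel) = 0"
proof -
  note sm = test_functionD(1)[OF F]
  obtain K where K: "compact K" "{x. F x \<noteq> 0} \<subseteq> K" "\<And>b. {x. frechet_derivative F (at x) b \<noteq> 0} \<subseteq> K"
    using test_function_support[OF F] by metis
  obtain R where R: "R > 0" "\<And>x. x \<in> K \<Longrightarrow> norm x \<le> R" using compact_imp_bounded[OF K(1)] unfolding bounded_pos by blast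
  have dc: "continuous_on UNIV (\<lambda>x. frechet_derivative F (at x) b)" by (rule test_functionD(3)[OF F])
  have "compact ((\<lambda>x. frechet_derivative F (at x) b) ` K)"
    using continuous_on_subset[OF dc subset_UNIV] K(1) by (rule compact_continuous_image)
  then have "bounded ((\<lambda>x. frechet_derivative F (at x) b) ` K)" by (rule compact_imp_bounded)
  then obtain C where C: "C > 0" "\<And>x. x \<in> K \<Longrightarrow> \<bar>frechet_derivative F (at x) b\<bar> \<le> C"
    by (auto simp: bounded_pos)
  then have Cb: "\<bar>frechet_derivative F (at x) b\<bar> \<le> C" for x
  proof (cases "x \<in> K")
    case False
    then have "frechet_derivative F (at x) b = 0" using K(3)[of b] by blast
    then show ?thesis using C(1) by simp
  qed (rule C(2))
  define q where "q = (\<lambda>n x. real (Suc n) * (F (x + (1 / real (Suc n)) *\<^sub>R b) - F x))"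
  have Fm[measurable]: "F \<in> borel_measurable borel"
    using test_functionD(2)[OF F] by (rule borel_measurable_continuous_onI)
  have dm[measurable]: "(\<lambda>x. frechet_derivative F (at x) b) \<in> borel_measurable borel"
    using dc by (rule borel_measurable_continuous_onI)
  have bounded: "integrable lborel F"
  proof -
    have "integrable lborel (\<lambda>x. indicator K x *\<^sub>R F x)"
      using K(1) test_functionD(2)[OF F] by (intro borel_integrable_compact) (auto intro: continuous_on_subset)
    also have "(\<lambda>x. indicator K x *\<^sub>R F x) = F" using K(2) by (auto simp: indicator_def fun_eq_iff)
    finally show ?thesis .
  qed
  have "(\<lambda>n. \<integral>x. q n x \<partial>lborel) \<longlonglongrightarrow> (\<integral>x. frechet_derivative F (at x) b \<partial>lborel)"
  \<comment> \<open>By the mean value theorem the quotients are bounded by the bound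
    \<open>C\<close> for the derivative. The step lengths are at most 1, so the quotients vanish
    outside the ball around the support enlarged by \<open>norm b\<close>.\<close>
  proof (rule integral_dominated_convergence[where w="\<lambda>x. C * indicator (cball 0 (R + norm b)) x"])
    show "q n \<in> borel_measurable lborel" for n unfolding q_def by measurable
    show "integrable lborel (\<lambda>x::'a. C * indicator (cball 0 (R + norm b)) x :: real)"
      using emeasure_lborel_cball_finite[of "0::'a" "R + norm b"] by (intro integrable_mult_right integrable_real_indicator) auto
    show "AE x in lborel. (\<lambda>n. q n x) \<longlonglongrightarrow> frechet_derivative F (at x) b"
    proof (rule AE_I2)
      fix x
      have "((\<lambda>t. (F (x + t *\<^sub>R b) - F x) / t) \<longlongrightarrow> frechet_derivative F (at x) b) (at 0)"
        using smooth_has_real_derivative_line[OF sm, of x b 0] by (simp add: has_field_derivative_iff)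
      moreover have "filterlim (\<lambda>n. 1 / real (Suc n)) (at 0) sequentially"
        using LIMSEQ_inverse_real_of_nat by (auto simp: filterlim_at inverse_eq_divide)
      ultimately have "(\<lambda>n. (F (x + (1 / real (Suc n)) *\<^sub>R b) - F x) / (1 / real (Suc n))) \<longlonglongrightarrow> frechet_derivative F (at x) b"
        by (rule filterlim_compose)
      then show "(\<lambda>n. q n x) \<longlonglongrightarrow> frechet_derivative F (at x) b"
        by (simp add: q_def mult.commute)
    qed
    show "AE x in lborel. norm (q n x) \<le> C * indicator (cball 0 (R + norm b)) x" for n
    proof (rule AE_I2)
      fix x
      let ?s = "1 / real (Suc n)"
      show "norm (q n x) \<le> C * indicator (cball 0 (R + norm b)) x"
      proof (cases "x \<in> cball 0 (R + norm b)")
        case True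
        obtain z where "F (x + ?s *\<^sub>R b) - F (x + 0 *\<^sub>R b) = (?s - 0) * frechet_derivative F (at (x + z *\<^sub>R b)) b"
          using MVT2[of 0 ?s "\<lambda>t. F (x + t *\<^sub>R b)" "\<lambda>t. frechet_derivative F (at (x + t *\<^sub>R b)) b"]
            smooth_has_real_derivative_line[OF sm] by auto
        then have "q n x = frechet_derivative F (at (x + z *\<^sub>R b)) b" by (simp add: q_def)
        then show ?thesis using Cb True by simp
      next
        case False
        have "norm (?s *\<^sub>R b) \<le> norm b" using mult_right_mono[of ?s 1 "norm b"] by simp
        moreover have "norm x > R + norm b" using False by simp
        moreover have "norm x - norm (?s *\<^sub>R b) \<le> norm (x + ?s *\<^sub>R b)" by (rule norm_diff_ineq)
        ultimately have "norm x > R" "norm (x + ?s *\<^sub>R b) > R"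
          using norm_ge_zero[of b] by linarith+
        then have "x \<notin> K" "x + ?s *\<^sub>R b \<notin> K" using R(2) by (meson not_le)+
        then have "F x = 0" "F (x + ?s *\<^sub>R b) = 0" using K(2) by blast+
        then show ?thesis using C(1) by (simp add: q_def)
      qed
    qed
  qed measurable
  moreover have "(\<integral>x. q n x \<partial>lborel) = 0" for n
  proof -
    have "integrable lborel (\<lambda>x. F (x + c))" for c
    proof -
      have "integrable (distr lborel borel ((+) c)) F" using bounded by (simp add: lborel_distr_plus)
      then show ?thesis by (subst (asm) integrable_distr_eq) (auto simp: add.commute)
    qed
    then show ?thesis using bounded by (simp add: q_def integral_lborel_translate)
  qed
  ultimately show ?thesis by (simp add: LIMSEQ_const_iff)
qed

section \<open>Uniqueness and linearity of weak derivatives\<close>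

lemma continuous_on_imp_Lp_loc:
  fixes g :: "'a::euclidean_space \<Rightarrow> real"
  assumes \<Omega>: "open \<Omega>" and g: "continuous_on \<Omega> g" and p: "p > 0"
  shows "g \<in> Lp_loc \<Omega> p"
proof -
  have "g \<in> borel_measurable (lebesgue_on \<Omega>)"
    using \<Omega> g by (intro continuous_imp_measurable_on_sets_lebesgue) (auto simp: borel_open)
  moreover have "integrable (lebesgue_on K) (\<lambda>x. \<bar>g x\<bar> powr p)" if K: "compact K" "K \<subseteq> \<Omega>" for K
  proof -
    have "continuous_on K (\<lambda>x. \<bar>g x\<bar> powr p)"
      using continuous_on_subset[OF g K(2)] p by (intro continuous_on_powr' continuous_intros) auto
    then have i: "integrable lborel (\<lambda>x. indicator K x *\<^sub>R (\<bar>g x\<bar> powr p))"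
      by (rule borel_integrable_compact[OF K(1)])
    then have "integrable lebesgue (\<lambda>x. indicator K x *\<^sub>R (\<bar>g x\<bar> powr p))"
      by (simp add: integrable_completion borel_measurable_integrable)
    then show ?thesis
      using K(1) by (subst integrable_restrict_space) (auto simp: lmeasurable_compact fmeasurableD)
  qed
  ultimately show ?thesis by (simp add: Lp_loc_def)
qed

lemma Lp_loc_linear_combination:
  assumes u: "u \<in> Lp_loc \<Omega> p" and v: "v \<in> Lp_loc \<Omega> p" and p: "0 \<le> p"
  shows "(\<lambda>x. u x + c * v x) \<in> Lp_loc \<Omega> p"
proof -
  have um: "u \<in> borel_measurable (lebesgue_on \<Omega>)" and vm: "v \<in> borel_measurable (lebesgue_on \<Omega>)"
    using u v by (auto simp: Lp_loc_def)
  have "integrable (lebesgue_on K) (\<lambda>x. \<bar>u x + c * v x\<bar> powr p)" if K: "compact K" "K \<subseteq> \<Omega>" for K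
  proof -
    have um': "u \<in> borel_measurable (lebesgue_on K)" and vm': "v \<in> borel_measurable (lebesgue_on K)"
      using measurable_restrict_mono[OF um K(2)] measurable_restrict_mono[OF vm K(2)] by auto
    have "integrable (lebesgue_on K) (\<lambda>x. \<bar>c\<bar> powr p * \<bar>v x\<bar> powr p)"
      using v K by (auto simp: Lp_loc_def)
    then have "integrable (lebesgue_on K) (\<lambda>x. norm (c * v x) powr p)"
      by (simp add: abs_mult powr_mult)
    then show ?thesis
      using integrable_powr_norm_add[of u "lebesgue_on K" "\<lambda>x. c * v x" p] um' vm' u K p
      by (auto simp: Lp_loc_def)
  qed
  then show ?thesis using um vm by (simp add: Lp_loc_def)
qed

lemma has_weak_partial_linear_combination:
  assumes \<Omega>: "open \<Omega>" and u: "has_weak_partial \<Omega> b u u'" and v: "has_weak_partial \<Omega> b v v'"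
  shows "has_weak_partial \<Omega> b (\<lambda>x. u x + c * v x) (\<lambda>x. u' x + c * v' x)"
  unfolding has_weak_partial_def
proof (intro conjI ballI)
  have L: "u \<in> Lp_loc \<Omega> 1" "u' \<in> Lp_loc \<Omega> 1" "v \<in> Lp_loc \<Omega> 1" "v' \<in> Lp_loc \<Omega> 1"
    using u v by (auto simp: has_weak_partial_def)
  then show "(\<lambda>x. u x + c * v x) \<in> Lp_loc \<Omega> 1" "(\<lambda>x. u' x + c * v' x) \<in> Lp_loc \<Omega> 1"
    by (auto intro: Lp_loc_linear_combination)
  fix \<phi> assume \<phi>: "\<phi> \<in> test_functions \<Omega>"
  note i = L[THEN Lp_loc_test_integrable(1)[OF _ \<Omega> \<phi>]] L[THEN Lp_loc_test_integrable(2)[OF _ \<Omega> \<phi>, of _ b]]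
  have "(\<integral>x. (u x + c * v x) * frechet_derivative \<phi> (at x) b \<partial>lebesgue_on \<Omega>) =
     (\<integral>x. u x * frechet_derivative \<phi> (at x) b \<partial>lebesgue_on \<Omega>) + c * (\<integral>x. v x * frechet_derivative \<phi> (at x) b \<partial>lebesgue_on \<Omega>)"
    using i by (simp add: distrib_right mult.assoc)
  also have "\<dots> = - ((\<integral>x. u' x * \<phi> x \<partial>lebesgue_on \<Omega>) + c * (\<integral>x. v' x * \<phi> x \<partial>lebesgue_on \<Omega>))"
    using u v \<phi> by (simp add: has_weak_partial_def)
  also have "\<dots> = - (\<integral>x. (u' x + c * v' x) * \<phi> x \<partial>lebesgue_on \<Omega>)"
    using i by (simp add: distrib_right mult.assoc)
  finally show "(\<integral>x. (u x + c * v x) * frechet_derivative \<phi> (at x) b \<partial>lebesgue_on \<Omega>) =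
     - (\<integral>x. (u' x + c * v' x) * \<phi> x \<partial>lebesgue_on \<Omega>)" .
qed

lemma has_weak_partial_unique:
  assumes \<Omega>: "open \<Omega>" and v: "has_weak_partial \<Omega> b u v" and v': "has_weak_partial \<Omega> b u v'"
  shows "AE x in lebesgue_on \<Omega>. v x = v' x"
proof -
  have L: "v \<in> Lp_loc \<Omega> 1" "v' \<in> Lp_loc \<Omega> 1" using v v' by (auto simp: has_weak_partial_def)
  have "AE x in lebesgue_on \<Omega>. v x + (-1) * v' x = 0"
  proof (rule fundamental_lemma_calculus_of_variations[OF _ \<Omega>])
    show "(\<lambda>x. v x + (-1) * v' x) \<in> Lp_loc \<Omega> 1" by (rule Lp_loc_linear_combination[OF L]) simp
    fix \<phi> assume \<phi>: "\<phi> \<in> test_functions \<Omega>"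
    have "(\<integral>x. v x * \<phi> x \<partial>lebesgue_on \<Omega>) = (\<integral>x. v' x * \<phi> x \<partial>lebesgue_on \<Omega>)"
      using v v' \<phi> by (auto simp: has_weak_partial_def)
    then show "(\<integral>x. (v x + (-1) * v' x) * \<phi> x \<partial>lebesgue_on \<Omega>) = 0"
      using L[THEN Lp_loc_test_integrable(1)[OF _ \<Omega> \<phi>]] by (simp add: left_diff_distrib)
  qed
  then show ?thesis by eventually_elim simp
qed

lemma has_weak_partial_weak_partial:
  "has_weak_partial \<Omega> b u v \<Longrightarrow> has_weak_partial \<Omega> b u (weak_partial \<Omega> b u)"
  unfolding weak_partial_def by (rule someI[of "\<lambda>v. has_weak_partial \<Omega> b u v"])

lemma compact_if_closed_subset: "compact K \<Longrightarrow> S \<subseteq> K \<Longrightarrow> closed S \<Longrightarrow> compact S"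
  using compact_Int_closed[of K S] by (simp add: Int_absorb1)

lemma test_functions_mult:
  assumes \<phi>: "\<phi> \<in> test_functions \<Omega>" and \<psi>: "\<psi> \<in> test_functions \<Omega>'"
  shows "(\<lambda>x. \<phi> x * \<psi> x) \<in> test_functions \<Omega>"
proof -
  have "closure {x. \<phi> x * \<psi> x \<noteq> 0} \<subseteq> closure {x. \<phi> x \<noteq> 0}" by (intro closure_mono) auto
  moreover then have "compact (closure {x. \<phi> x * \<psi> x \<noteq> 0})"
    using \<phi> by (intro compact_if_closed_subset[OF _ _ closed_closure]) (auto simp: test_functions_def)
  ultimately show ?thesis using \<phi> \<psi> by (auto simp: test_functions_def Ck_mult)
qed

lemma test_functions_mono: "\<phi> \<in> test_functions \<Omega> \<Longrightarrow> \<Omega> \<subseteq> \<Omega>' \<Longrightarrow> \<phi> \<in> test_functions \<Omega>'"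
  by (auto simp: test_functions_def)

lemma test_functions_add:
  assumes \<phi>: "\<phi> \<in> test_functions \<Omega>" and \<psi>: "\<psi> \<in> test_functions \<Omega>"
  shows "(\<lambda>x. \<phi> x + \<psi> x) \<in> test_functions \<Omega>"
proof -
  have "closure {x. \<phi> x + \<psi> x \<noteq> 0} \<subseteq> closure ({x. \<phi> x \<noteq> 0} \<union> {x. \<psi> x \<noteq> 0})" by (intro closure_mono) auto
  then have s: "closure {x. \<phi> x + \<psi> x \<noteq> 0} \<subseteq> closure {x. \<phi> x \<noteq> 0} \<union> closure {x. \<psi> x \<noteq> 0}"
    by (simp add: closure_Un)
  then have "compact (closure {x. \<phi> x + \<psi> x \<noteq> 0})"
    using \<phi> \<psi> by (intro compact_if_closed_subset[OF _ s closed_closure] compact_Un) (auto simp: test_functions_def)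
  then show ?thesis using s \<phi> \<psi> by (auto simp: test_functions_def Ck_add)
qed

lemma test_functions_cmult:
  assumes \<phi>: "\<phi> \<in> test_functions \<Omega>" shows "(\<lambda>x. c * \<phi> x) \<in> test_functions \<Omega>"
proof -
  have s: "closure {x. c * \<phi> x \<noteq> 0} \<subseteq> closure {x. \<phi> x \<noteq> 0}" by (intro closure_mono) auto
  then have "compact (closure {x. c * \<phi> x \<noteq> 0})"
    using \<phi> by (intro compact_if_closed_subset[OF _ s closed_closure]) (auto simp: test_functions_def)
  then show ?thesis using s \<phi> by (auto simp: test_functions_def Ck_mult Ck_const)
qed

lemma test_functions_linear_combination:
  assumes "\<phi> \<in> test_functions \<Omega>" "\<psi> \<in> test_functions \<Omega>"
  shows "(\<lambda>x. \<phi> x + c * \<psi> x) \<in> test_functions \<Omega>"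
  by (intro test_functions_add test_functions_cmult assms)

lemma integral_lebesgue_on_eq_lborel:
  fixes g :: "'a::euclidean_space \<Rightarrow> real"
  assumes "open \<Omega>" "g \<in> borel_measurable borel" "\<And>x. x \<notin> \<Omega> \<Longrightarrow> g x = 0"
  shows "(\<integral>x. g x \<partial>lebesgue_on \<Omega>) = (\<integral>x. g x \<partial>lborel)"
proof -
  have "(\<integral>x. g x \<partial>lebesgue_on \<Omega>) = (\<integral>x. indicator \<Omega> x *\<^sub>R g x \<partial>lebesgue)"
    using assms(1) by (subst integral_restrict_space) (auto simp: borel_open)
  also have "(\<lambda>x. indicator \<Omega> x *\<^sub>R g x) = g" using assms(3) by (auto simp: indicator_def fun_eq_iff)
  finally show ?thesis using assms(2) by (simp add: integral_completion)
qed

text \<open>Integration by parts: the product of two test functions is a test function, so the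
  integral of its derivative is 0.\<close>

lemma test_function_has_weak_partial:
  assumes \<Omega>: "open \<Omega>" and \<phi>: "\<phi> \<in> test_functions \<Omega>"
  shows "has_weak_partial \<Omega> b \<phi> (\<lambda>x. frechet_derivative \<phi> (at x) b)"
  unfolding has_weak_partial_def
proof (intro conjI ballI)
  note c = test_functionD(2,3)[OF \<phi>]
  show L: "\<phi> \<in> Lp_loc \<Omega> 1" "(\<lambda>x. frechet_derivative \<phi> (at x) b) \<in> Lp_loc \<Omega> 1"
    by (rule continuous_on_imp_Lp_loc[OF \<Omega> continuous_on_subset[OF _ subset_UNIV]], rule c, simp)+
  fix \<psi> assume \<psi>: "\<psi> \<in> test_functions \<Omega>"
  note i = Lp_loc_test_integrable(2)[OF L(1) \<Omega> \<psi>, of b] Lp_loc_test_integrable(1)[OF L(2) \<Omega> \<psi>]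
  have t: "(\<lambda>x. \<phi> x * \<psi> x) \<in> test_functions \<Omega>" using \<phi> \<psi> by (rule test_functions_mult)
  have diff: "\<phi> differentiable (at x)" "\<psi> differentiable (at x)" for x
    using test_functionD(4)[OF \<phi>] test_functionD(4)[OF \<psi>] by (auto simp: differentiable_def)
  have eq: "frechet_derivative (\<lambda>x. \<phi> x * \<psi> x) (at x) b
      = \<phi> x * frechet_derivative \<psi> (at x) b + frechet_derivative \<phi> (at x) b * \<psi> x" for x
    by (simp add: frechet_derivative_mult_real[OF diff])
  have "0 = (\<integral>x. frechet_derivative (\<lambda>x. \<phi> x * \<psi> x) (at x) b \<partial>lborel)"
    using integral_directional_derivative_eq_0[OF test_functions_mono[OF t subset_UNIV]] by simp
  also have "\<dots> = (\<integral>x. frechet_derivative (\<lambda>x. \<phi> x * \<psi> x) (at x) b \<partial>lebesgue_on \<Omega>)"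
  proof (rule integral_lebesgue_on_eq_lborel[OF \<Omega>, symmetric])
    show "(\<lambda>x. frechet_derivative (\<lambda>x. \<phi> x * \<psi> x) (at x) b) \<in> borel_measurable borel"
      using test_functionD(3)[OF t] by (rule borel_measurable_continuous_onI)
  qed (rule test_function_eq_0_outside(2)[OF t])
  also have "\<dots> = (\<integral>x. \<phi> x * frechet_derivative \<psi> (at x) b \<partial>lebesgue_on \<Omega>)
      + (\<integral>x. frechet_derivative \<phi> (at x) b * \<psi> x \<partial>lebesgue_on \<Omega>)"
    using i by (simp add: eq)
  finally show "(\<integral>x. \<phi> x * frechet_derivative \<psi> (at x) b \<partial>lebesgue_on \<Omega>) =
     - (\<integral>x. frechet_derivative \<phi> (at x) b * \<psi> x \<partial>lebesgue_on \<Omega>)" by simp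
qed

lemma borel_measurable_lebesgue_onI:
  "f \<in> borel_measurable borel \<Longrightarrow> f \<in> borel_measurable (lebesgue_on S)"
  by (intro measurable_restrict_space1 measurable_completion) simp

text \<open>With the exponents of the energy space the weighted norms are plain \<open>L\<^sup>p\<close> norms with respect to
  the measure \<open>dx\<^sub>1 dx\<^sub>2 dx' / (x\<^sub>1 x\<^sub>2)\<close>.\<close>

locale corner =
  fixes \<delta> p :: real and X :: "(real ^ 'n::finite) set"
  assumes \<delta>: "\<delta> > 0" and X: "open X" "bounded X" "X \<noteq> {}" and p: "1 < p"
begin

abbreviation Om :: "'n point set" where "Om \<equiv> MM \<delta> X"

definition wt :: "'n point \<Rightarrow> real" where "wt x = 1 / (fst x * fst (snd x))"

definition nu :: "'n point measure" where "nu = density (lebesgue_on Om) (\<lambda>x. ennreal (wt x))"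

lemma open_Om: "open Om" by (simp add: MM_def open_Times X)

lemma Om_sets: "Om \<inter> space lebesgue \<in> sets lebesgue" using open_Om by (simp add: borel_open)

lemma bounded_Om: "bounded Om" unfolding MM_def by (intro bounded_Times X) auto

lemma OmD: "x \<in> Om \<Longrightarrow> 0 < fst x \<and> fst x < \<delta> \<and> 0 < fst (snd x) \<and> fst (snd x) < \<delta> \<and> snd (snd x) \<in> X"
  by (auto simp: MM_def)

lemma wt_pos: "x \<in> Om \<Longrightarrow> wt x > 0" using OmD[of x] by (simp add: wt_def)

lemma space_nu [simp]: "space nu = Om" by (simp add: nu_def space_restrict_space)

lemma sets_nu [measurable_cong, simp]: "sets nu = sets (lebesgue_on Om)" by (simp add: nu_def)

lemma borel_measurable_nu: "borel_measurable nu = borel_measurable (lebesgue_on Om)"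
  by (rule measurable_cong_sets) auto

lemma wt_borel: "wt \<in> borel_measurable borel"
proof -
  have "(\<lambda>x::'n point. fst x) \<in> borel_measurable borel" "(\<lambda>x::'n point. fst (snd x)) \<in> borel_measurable borel"
    by (auto intro!: borel_measurable_continuous_onI continuous_intros)
  then show ?thesis unfolding wt_def[abs_def] by measurable
qed

lemma wt_measurable [measurable]: "wt \<in> borel_measurable (lebesgue_on Om)"
  by (rule borel_measurable_lebesgue_onI[OF wt_borel])

lemma wt_nonneg_AE: "AE x in lebesgue_on Om. 0 \<le> wt x"
  by (rule AE_I2) (simp add: space_restrict_space wt_pos less_imp_le)

lemma AE_nuI: "AE x in lebesgue_on Om. P x \<Longrightarrow> AE x in nu. P x"
  unfolding nu_def by (subst AE_density) auto

lemma integrable_nu_iff: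
  fixes g :: "'n point \<Rightarrow> real"
  assumes "g \<in> borel_measurable (lebesgue_on Om)"
  shows "integrable nu g \<longleftrightarrow> integrable (lebesgue_on Om) (\<lambda>x. wt x * g x)"
  unfolding nu_def using assms wt_nonneg_AE by (subst integrable_density) auto

lemma sigma_eq: "sigma \<delta> X = density (lebesgue_on Om) (\<lambda>x. ennreal (wt x / fst x))"
  unfolding sigma_def by (intro arg_cong[of _ _ "density (lebesgue_on Om)"]) (auto simp: wt_def fun_eq_iff mult_ac)

text \<open>\<open>sigma\<close> has density 1 / (x1^2 x2). The factor x1 that occurs in the energy,
  in \<open>B_fun\<close> and in the norms of \<open>E\<close> cancels one power and leaves
  \<open>nu\<close>.\<close>

lemma sigma_fst:
  fixes g :: "'n point \<Rightarrow> real"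
  assumes [measurable]: "g \<in> borel_measurable (lebesgue_on Om)"
  shows "integrable (sigma \<delta> X) (\<lambda>x. fst x * g x) \<longleftrightarrow> integrable nu g"
    and "(\<integral>x. fst x * g x \<partial>sigma \<delta> X) = (\<integral>x. g x \<partial>nu)"
proof -
  have [measurable]: "fst \<in> borel_measurable (lebesgue_on Om)"
    by (intro borel_measurable_lebesgue_onI borel_measurable_continuous_onI continuous_intros)
  have nn: "AE x in lebesgue_on Om. 0 \<le> wt x / fst x"
    by (rule AE_I2) (use wt_pos OmD in \<open>force simp: space_restrict_space\<close>)
  have eq: "x \<in> space (lebesgue_on Om) \<Longrightarrow> (wt x / fst x) *\<^sub>R (fst x * g x) = wt x *\<^sub>R g x" for x
    using OmD[of x] by (simp add: space_restrict_space)
  have "integrable (sigma \<delta> X) (\<lambda>x. fst x * g x) \<longleftrightarrow> integrable (lebesgue_on Om) (\<lambda>x. (wt x / fst x) *\<^sub>R (fst x * g x))"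
    unfolding sigma_eq using nn by (intro integrable_density) auto
  also have "\<dots> \<longleftrightarrow> integrable (lebesgue_on Om) (\<lambda>x. wt x *\<^sub>R g x)"
    by (intro Bochner_Integration.integrable_cong refl eq)
  finally show "integrable (sigma \<delta> X) (\<lambda>x. fst x * g x) \<longleftrightarrow> integrable nu g"
    by (simp add: integrable_nu_iff)
  have "(\<integral>x. fst x * g x \<partial>sigma \<delta> X) = (\<integral>x. (wt x / fst x) *\<^sub>R (fst x * g x) \<partial>lebesgue_on Om)"
    unfolding sigma_eq using nn by (intro integral_density) auto
  also have "\<dots> = (\<integral>x. wt x *\<^sub>R g x \<partial>lebesgue_on Om)"
    by (intro Bochner_Integration.integral_cong refl eq)
  also have "\<dots> = (\<integral>x. g x \<partial>nu)"
    unfolding nu_def using wt_nonneg_AE by (intro integral_density[symmetric]) auto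
  finally show "(\<integral>x. fst x * g x \<partial>sigma \<delta> X) = (\<integral>x. g x \<partial>nu)" .
qed

text \<open>Values lie in an arbitrary Euclidean space, so that functions and stretched gradients
  share all norm lemmas.\<close>

definition Lp :: "('n point \<Rightarrow> 'b::euclidean_space) \<Rightarrow> bool" where
  "Lp f \<longleftrightarrow> f \<in> borel_measurable (lebesgue_on Om) \<and> integrable nu (\<lambda>x. norm (f x) powr p)"

definition Np :: "('n point \<Rightarrow> 'b::euclidean_space) \<Rightarrow> real" where
  "Np f = (\<integral>x. norm (f x) powr p \<partial>nu) powr (1 / p)"

lemma Np_nonneg [simp]: "0 \<le> Np f" by (simp add: Np_def)

lemma Np_powr: "Np f powr p = (\<integral>x. norm (f x) powr p \<partial>nu)"
  using p by (simp add: Np_def powr_powr)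

lemma Lp_add: "Lp f \<Longrightarrow> Lp g \<Longrightarrow> Lp (\<lambda>x. f x + g x)"
  using p unfolding Lp_def by (auto intro!: integrable_powr_norm_add simp: borel_measurable_nu)

lemma Np_triangle: "Lp f \<Longrightarrow> Lp g \<Longrightarrow> Np (\<lambda>x. f x + g x) \<le> Np f + Np g"
  using p unfolding Lp_def Np_def by (intro Minkowski_powr_norm) (auto simp: borel_measurable_nu)

lemma Lp_scaleR: "Lp f \<Longrightarrow> Lp (\<lambda>x. c *\<^sub>R f x)"
  by (auto simp: Lp_def powr_mult)

lemma Np_scaleR: "Np (\<lambda>x. c *\<^sub>R f x) = \<bar>c\<bar> * Np f"
  using p by (simp add: Np_def powr_mult powr_powr)

lemma Lp_cong_AE:
  assumes "Lp f" "g \<in> borel_measurable (lebesgue_on Om)" "AE x in lebesgue_on Om. f x = g x"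
  shows "Lp g" "Np g = Np f"
proof -
  have ae: "AE x in nu. norm (f x) powr p = norm (g x) powr p"
    using AE_nuI[OF assms(3)] by eventually_elim simp
  have m: "(\<lambda>x. norm (f x) powr p) \<in> borel_measurable nu" "(\<lambda>x. norm (g x) powr p) \<in> borel_measurable nu"
    using assms(1,2) by (auto simp: Lp_def borel_measurable_nu)
  show "Lp g" using assms(1,2) integrable_cong_AE[OF m ae] by (simp add: Lp_def)
  show "Np g = Np f" using integral_cong_AE[OF m ae] by (simp add: Np_def)
qed

lemma Np_mono:
  assumes "Lp g" "f \<in> borel_measurable (lebesgue_on Om)" "\<And>x. x \<in> Om \<Longrightarrow> norm (f x) \<le> norm (g x)"
  shows "Lp f" "Np f \<le> Np g"
proof -
  have i: "integrable nu (\<lambda>x. norm (f x) powr p)"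
  proof (rule Bochner_Integration.integrable_bound)
    show "integrable nu (\<lambda>x. norm (g x) powr p)" using assms by (simp add: Lp_def)
    show "AE x in nu. norm (norm (f x) powr p) \<le> norm (norm (g x) powr p)"
      by (rule AE_I2) (use assms(3) p in \<open>auto intro!: powr_mono2\<close>)
  qed (use assms(2) in \<open>simp add: borel_measurable_nu\<close>)
  then show "Lp f" using assms by (simp add: Lp_def)
  have "(\<integral>x. norm (f x) powr p \<partial>nu) \<le> (\<integral>x. norm (g x) powr p \<partial>nu)"
    using i assms p by (intro integral_mono) (auto simp: Lp_def intro!: powr_mono2)
  then show "Np f \<le> Np g" unfolding Np_def using p by (intro powr_mono2) auto
qed

lemma Lp_sum: "finite I \<Longrightarrow> (\<And>i. i \<in> I \<Longrightarrow> Lp (f i)) \<Longrightarrow> Lp (\<lambda>x. \<Sum>i\<in>I. f i x)"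
proof (induction I rule: finite_induct)
  case empty
  then show ?case using p by (simp add: Lp_def)
qed (simp add: Lp_add)

lemma Np_sum: "finite I \<Longrightarrow> (\<And>i. i \<in> I \<Longrightarrow> Lp (f i)) \<Longrightarrow> Np (\<lambda>x. \<Sum>i\<in>I. f i x) \<le> (\<Sum>i\<in>I. Np (f i))"
proof (induction I rule: finite_induct)
  case empty
  then show ?case using p by (simp add: Np_def)
next
  case (insert i I)
  have "Np (\<lambda>x. f i x + (\<Sum>i\<in>I. f i x)) \<le> Np (f i) + Np (\<lambda>x. \<Sum>i\<in>I. f i x)"
    using insert by (intro Np_triangle Lp_sum) auto
  then show ?case using insert by simp
qed

text \<open>\<open>H_norm\<close> adds up the norms of the components of the gradient, whereas the
  energy uses its Euclidean norm; this comparison makes the two equivalent.\<close>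

lemma Lp_components:
  fixes f :: "'n point \<Rightarrow> 'b::euclidean_space"
  shows "Lp f \<longleftrightarrow> (\<forall>b\<in>Basis. Lp (\<lambda>x. f x \<bullet> b))"
    and "Lp f \<Longrightarrow> b \<in> Basis \<Longrightarrow> Np (\<lambda>x. f x \<bullet> b) \<le> Np f"
    and "Lp f \<Longrightarrow> Np f \<le> (\<Sum>b\<in>Basis. Np (\<lambda>x. f x \<bullet> b))"
proof -
  have a: "Lp (\<lambda>x. f x \<bullet> b)" "Np (\<lambda>x. f x \<bullet> b) \<le> Np f" if "Lp f" "b \<in> Basis" for b
  proof -
    have m: "(\<lambda>x. f x \<bullet> b) \<in> borel_measurable (lebesgue_on Om)"
      using that by (intro borel_measurable_inner) (auto simp: Lp_def)
    show "Lp (\<lambda>x. f x \<bullet> b)" "Np (\<lambda>x. f x \<bullet> b) \<le> Np f"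
      by (rule Np_mono[OF that(1) m]; simp add: Basis_le_norm that(2))+
  qed
  have l: "Lp (\<lambda>x. (f x \<bullet> b) *\<^sub>R b)" "Np (\<lambda>x. (f x \<bullet> b) *\<^sub>R b) = Np (\<lambda>x. f x \<bullet> b)"
    if "Lp (\<lambda>x. f x \<bullet> b)" "b \<in> Basis" for b
    using that by (auto simp: Lp_def Np_def)
  have "Lp (\<lambda>x. \<Sum>b\<in>Basis. (f x \<bullet> b) *\<^sub>R b)" if "\<forall>b\<in>Basis. Lp (\<lambda>x. f x \<bullet> b)"
    using that l by (intro Lp_sum) auto
  then show "Lp f \<longleftrightarrow> (\<forall>b\<in>Basis. Lp (\<lambda>x. f x \<bullet> b))"
    using a(1) by (auto simp: euclidean_representation)
  show "Lp f \<Longrightarrow> b \<in> Basis \<Longrightarrow> Np (\<lambda>x. f x \<bullet> b) \<le> Np f" by (rule a)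
  assume "Lp f"
  then have "Np (\<lambda>x. \<Sum>b\<in>Basis. (f x \<bullet> b) *\<^sub>R b) \<le> (\<Sum>b\<in>Basis. Np (\<lambda>x. (f x \<bullet> b) *\<^sub>R b))"
    using l a by (intro Np_sum) auto
  also have "\<dots> = (\<Sum>b\<in>Basis. Np (\<lambda>x. f x \<bullet> b))"
    using l a \<open>Lp f\<close> by (intro sum.cong) auto
  finally show "Np f \<le> (\<Sum>b\<in>Basis. Np (\<lambda>x. f x \<bullet> b))" by (simp add: euclidean_representation)
qed

lemma Lp_integrand_eq:
  assumes "x \<in> Om"
  shows "Lp_integrand p ((dimN TYPE('n) - 1) / p) (dimN TYPE('n) / p) u x = fst x * \<bar>u x\<bar> powr p"
proof -
  have e: "dimN TYPE('n) / p - (dimN TYPE('n) - 1) / p = 1 / p" using p by (simp add: field_simps)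
  show ?thesis
    using OmD[OF assms] p unfolding Lp_integrand_def e
    by (simp add: case_prod_unfold abs_mult powr_mult powr_powr)
qed

lemma space_sigma: "space (sigma \<delta> X) = Om" by (simp add: sigma_def space_restrict_space)

lemma Lp_space_iff: "u \<in> Lp_space \<delta> X p ((dimN TYPE('n) - 1) / p) (dimN TYPE('n) / p) \<longleftrightarrow> Lp u"
proof -
  have "integrable (sigma \<delta> X) (Lp_integrand p ((dimN TYPE('n) - 1) / p) (dimN TYPE('n) / p) u)
     \<longleftrightarrow> integrable nu (\<lambda>x. \<bar>u x\<bar> powr p)" if "u \<in> borel_measurable (lebesgue_on Om)"
    using that Lp_integrand_eq
    by (subst sigma_fst(1)[symmetric]) (auto intro!: Bochner_Integration.integrable_cong simp: space_sigma)
  then show ?thesis by (auto simp: Lp_space_def Lp_def)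
qed

lemma Lp_norm_eq:
  assumes "u \<in> borel_measurable (lebesgue_on Om)"
  shows "Lp_norm \<delta> X p ((dimN TYPE('n) - 1) / p) (dimN TYPE('n) / p) u = Np u"
proof -
  have "(\<integral>x. Lp_integrand p ((dimN TYPE('n) - 1) / p) (dimN TYPE('n) / p) u x \<partial>sigma \<delta> X)
     = (\<integral>x. fst x * \<bar>u x\<bar> powr p \<partial>sigma \<delta> X)"
    using Lp_integrand_eq by (intro Bochner_Integration.integral_cong) (auto simp: space_sigma)
  also have "\<dots> = (\<integral>x. \<bar>u x\<bar> powr p \<partial>nu)" using assms by (intro sigma_fst(2)) auto
  finally show ?thesis by (simp add: Lp_norm_def Np_def)
qed

end

section \<open>The energy space\<close>

context corner
begin

definition H :: "('n point \<Rightarrow> real) set" where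
  "H = H_space \<delta> X p ((dimN TYPE('n) - 1) / p) (dimN TYPE('n) / p)"

abbreviation E :: "('n point \<Rightarrow> real) set" where "E \<equiv> E_space \<delta> X p"

abbreviation D :: "('n point \<Rightarrow> real) \<Rightarrow> 'n point \<Rightarrow> 'n point" where "D \<equiv> grad_M \<delta> X"

lemma Basis_point:
  "(1, 0, 0) \<in> (Basis :: 'n point set)" "(0, 1, 0) \<in> (Basis :: 'n point set)"
  "(0, 0, axis i 1) \<in> (Basis :: 'n point set)"
  by (auto simp: Basis_prod_def Basis_vec_def zero_prod_def)

lemma Basis_point_cases:
  assumes "b \<in> (Basis :: 'n point set)"
  obtains "b = (1, 0, 0)" | "b = (0, 1, 0)" | i where "b = (0, 0, axis i 1)"
  using assms by (auto simp: Basis_prod_def Basis_vec_def zero_prod_def)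

text \<open>The stretched gradient as a linear expression in a family of partial derivatives indexed
  by basis vectors, so that weak and classical gradients are treated alike.\<close>

definition stretch :: "'n point \<Rightarrow> ('n point \<Rightarrow> real) \<Rightarrow> 'n point" where
  "stretch x v = (fst x * v (1, 0, 0), fst x * fst (snd x) * v (0, 1, 0), \<chi> i. v (0, 0, axis i 1))"

lemma grad_eq_stretch: "D u x = stretch x (\<lambda>b. weak_partial Om b u x)"
  by (simp add: grad_M_def stretch_def case_prod_unfold)

lemma stretch_linear: "stretch x (\<lambda>b. v b + c * w b) = stretch x v + c *\<^sub>R stretch x w"
  by (simp add: stretch_def vec_eq_iff algebra_simps)

lemma stretch_cong: "(\<And>b. b \<in> Basis \<Longrightarrow> v b = w b) \<Longrightarrow> stretch x v = stretch x w"
  using Basis_point by (simp add: stretch_def)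

lemma stretch_inner:
  "stretch x v \<bullet> (1, 0, 0) = fst x * v (1, 0, 0)"
  "stretch x v \<bullet> (0, 1, 0) = fst x * fst (snd x) * v (0, 1, 0)"
  "stretch x v \<bullet> (0, 0, axis i 1) = v (0, 0, axis i 1)"
  by (simp_all add: stretch_def inner_axis)

lemma stretch_measurable:
  assumes v: "\<And>b. b \<in> Basis \<Longrightarrow> (\<lambda>x. v x b) \<in> borel_measurable (lebesgue_on Om)"
  shows "(\<lambda>x. stretch x (v x)) \<in> borel_measurable (lebesgue_on Om)"
proof -
  have c: "(\<lambda>x::'n point. fst x) \<in> borel_measurable (lebesgue_on Om)"
      "(\<lambda>x::'n point. fst (snd x)) \<in> borel_measurable (lebesgue_on Om)"
    by (intro borel_measurable_lebesgue_onI borel_measurable_continuous_onI continuous_intros)+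
  note [measurable] = c v[OF Basis_point(1)] v[OF Basis_point(2)] v[OF Basis_point(3)]
  show ?thesis
  proof (rule borel_measurable_euclidean_space[THEN iffD2], rule ballI)
    fix b :: "'n point" assume "b \<in> Basis"
    then show "(\<lambda>x. stretch x (v x) \<bullet> b) \<in> borel_measurable (lebesgue_on Om)"
      by (cases rule: Basis_point_cases) (simp_all add: stretch_inner)
  qed
qed

lemma W1p_loc_weak_partial:
  "u \<in> W1p_loc Om p \<Longrightarrow> b \<in> Basis \<Longrightarrow> has_weak_partial Om b u (weak_partial Om b u)"
  unfolding W1p_loc_def by (auto intro: has_weak_partial_weak_partial)

lemma weak_partial_measurable:
  assumes "u \<in> W1p_loc Om p" "b \<in> Basis" shows "weak_partial Om b u \<in> borel_measurable (lebesgue_on Om)"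
  using W1p_loc_weak_partial[OF assms] by (auto simp: has_weak_partial_def Lp_loc_def)

lemma grad_measurable: "u \<in> W1p_loc Om p \<Longrightarrow> D u \<in> borel_measurable (lebesgue_on Om)"
  unfolding grad_eq_stretch[abs_def] by (intro stretch_measurable weak_partial_measurable)

lemma H_iff: "u \<in> H \<longleftrightarrow> u \<in> W1p_loc Om p \<and> Lp u \<and> Lp (D u)"
  unfolding H_def H_space_def mem_Collect_eq Lp_space_iff Lp_components(1)[of "D u"] by simp

text \<open>\<open>weak_partial\<close> picks an arbitrary representative, so gradients can be
  identified only almost everywhere, by uniqueness of weak derivatives.\<close>

lemma AE_weak_partials:
  assumes "\<And>b. b \<in> Basis \<Longrightarrow> has_weak_partial Om b u (v b)" "u \<in> W1p_loc Om p"
  shows "AE x in lebesgue_on Om. D u x = stretch x (\<lambda>b. v b x)"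
proof -
  have "AE x in lebesgue_on Om. \<forall>b\<in>Basis. weak_partial Om b u x = v b x"
    by (rule AE_finite_allI) (auto intro: has_weak_partial_unique[OF open_Om] W1p_loc_weak_partial assms)
  then show ?thesis by eventually_elim (auto simp: grad_eq_stretch intro: stretch_cong)
qed

lemma W1p_loc_linear_combination:
  assumes u: "u \<in> W1p_loc Om p" and v: "v \<in> W1p_loc Om p"
  shows "(\<lambda>x. u x + c * v x) \<in> W1p_loc Om p"
proof -
  have "\<exists>w. has_weak_partial Om b (\<lambda>x. u x + c * v x) w \<and> w \<in> Lp_loc Om p" if b: "b \<in> Basis" for b
  proof -
    have "\<exists>u'. has_weak_partial Om b u u' \<and> u' \<in> Lp_loc Om p" using u b by (simp add: W1p_loc_def)
    then obtain u' where u': "has_weak_partial Om b u u'" "u' \<in> Lp_loc Om p" by blast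
    have "\<exists>v'. has_weak_partial Om b v v' \<and> v' \<in> Lp_loc Om p" using v b by (simp add: W1p_loc_def)
    then obtain v' where "has_weak_partial Om b v v'" "v' \<in> Lp_loc Om p" by blast
    with u' show ?thesis
      using p by (intro exI[of _ "\<lambda>x. u' x + c * v' x"])
        (simp add: has_weak_partial_linear_combination open_Om Lp_loc_linear_combination)
  qed
  then show ?thesis using u v p by (simp add: W1p_loc_def Lp_loc_linear_combination)
qed

lemma grad_linear_combination:
  assumes u: "u \<in> W1p_loc Om p" and v: "v \<in> W1p_loc Om p"
  shows "AE x in lebesgue_on Om. D (\<lambda>x. u x + c * v x) x = D u x + c *\<^sub>R D v x"
proof -
  have "AE x in lebesgue_on Om. D (\<lambda>x. u x + c * v x) x
      = stretch x (\<lambda>b. weak_partial Om b u x + c * weak_partial Om b v x)"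
    by (intro AE_weak_partials has_weak_partial_linear_combination open_Om W1p_loc_weak_partial
        W1p_loc_linear_combination u v)
  then show ?thesis by (simp add: stretch_linear flip: grad_eq_stretch)
qed

lemma
  assumes u: "u \<in> H" and v: "v \<in> H"
  shows H_linear_combination: "(\<lambda>x. u x + c * v x) \<in> H"
    and Np_grad_linear_combination: "Np (D (\<lambda>x. u x + c * v x)) = Np (\<lambda>x. D u x + c *\<^sub>R D v x)"
proof -
  have W: "u \<in> W1p_loc Om p" "v \<in> W1p_loc Om p" using u v by (auto simp: H_iff)
  note Wc = W1p_loc_linear_combination[OF W, of c]
  have L: "Lp (\<lambda>x. D u x + c *\<^sub>R D v x)" using u v by (intro Lp_add Lp_scaleR) (auto simp: H_iff)
  have "AE x in lebesgue_on Om. D u x + c *\<^sub>R D v x = D (\<lambda>x. u x + c * v x) x"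
    using grad_linear_combination[OF W, of c] by eventually_elim simp
  note c = Lp_cong_AE[OF L grad_measurable[OF Wc] this]
  have "Lp (\<lambda>x. u x + c *\<^sub>R v x)" using u v by (intro Lp_add Lp_scaleR) (auto simp: H_iff)
  then show "(\<lambda>x. u x + c * v x) \<in> H" using Wc c(1) by (simp add: H_iff)
  show "Np (D (\<lambda>x. u x + c * v x)) = Np (\<lambda>x. D u x + c *\<^sub>R D v x)" by (rule c(2))
qed

lemma H_diff: "u \<in> H \<Longrightarrow> v \<in> H \<Longrightarrow> (\<lambda>x. u x - v x) \<in> H"
  using H_linear_combination[of u v "-1"] by simp

lemma Np_minus_commute: "Np (\<lambda>x. f x - g x) = Np (\<lambda>x. g x - f x)"
  by (simp add: Np_def norm_minus_commute)

lemma Np_diff_le: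
  assumes "Lp f" "Lp g" shows "\<bar>Np f - Np g\<bar> \<le> Np (\<lambda>x. f x - g x)"
proof -
  have d: "Lp (\<lambda>x. f x - g x)" "Lp (\<lambda>x. g x - f x)"
    using Lp_add[OF assms(1) Lp_scaleR[OF assms(2), of "-1"]] Lp_add[OF assms(2) Lp_scaleR[OF assms(1), of "-1"]]
    by simp_all
  have "Np f \<le> Np (\<lambda>x. f x - g x) + Np g" using Np_triangle[OF d(1) assms(2)] by simp
  moreover have "Np g \<le> Np (\<lambda>x. g x - f x) + Np f" using Np_triangle[OF d(2) assms(1)] by simp
  ultimately show ?thesis using Np_minus_commute[of f g] by linarith
qed

lemma Np_grad_diff_le:
  assumes "u \<in> H" "v \<in> H" shows "\<bar>Np (D u) - Np (D v)\<bar> \<le> Np (D (\<lambda>x. u x - v x))"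
  using Np_grad_linear_combination[OF assms, of "-1"] Np_diff_le[of "D u" "D v"] assms by (simp add: H_iff)

text \<open>Negation is the combination \<open>u + (-2) u\<close>, to which the rule for linear
  combinations applies.\<close>

lemma Np_grad_uminus: "u \<in> H \<Longrightarrow> Np (D (\<lambda>x. - u x)) = Np (D u)"
  using Np_grad_linear_combination[of u u "-2"] by (simp add: scaleR_2 flip: scaleR_left.minus)
    (simp add: Np_def)

text \<open>A norm equivalent to \<open>H_norm\<close> on \<open>H\<close>, with only two terms to
  estimate.\<close>

definition Hn :: "('n point \<Rightarrow> real) \<Rightarrow> real" where "Hn u = Np u + Np (D u)"

lemma Hn_nonneg: "Hn u \<ge> 0" by (simp add: Hn_def)

lemma Hn_linear_combination:
  assumes "u \<in> H" "v \<in> H" shows "Hn (\<lambda>x. u x + c * v x) \<le> Hn u + \<bar>c\<bar> * Hn v"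
proof -
  have L: "Lp u" "Lp v" "Lp (D u)" "Lp (D v)" using assms by (auto simp: H_iff)
  have "Np (\<lambda>x. u x + c *\<^sub>R v x) \<le> Np u + \<bar>c\<bar> * Np v"
    using Np_triangle[OF L(1) Lp_scaleR[OF L(2), of c]] by (simp add: Np_scaleR[of c v, simplified])
  moreover have "Np (\<lambda>x. D u x + c *\<^sub>R D v x) \<le> Np (D u) + \<bar>c\<bar> * Np (D v)"
    using Np_triangle[OF L(3) Lp_scaleR[OF L(4), of c]] by (simp add: Np_scaleR)
  ultimately show ?thesis
    using Np_grad_linear_combination[OF assms, of c] by (simp add: Hn_def algebra_simps)
qed

lemma H_norm_bounds:
  assumes "u \<in> H"
  defines "h \<equiv> H_norm \<delta> X p ((dimN TYPE('n) - 1) / p) (dimN TYPE('n) / p) u"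
  shows "Hn u \<le> h" "h \<le> (1 + real DIM('n point)) * Hn u"
proof -
  have L: "Lp u" "Lp (D u)" using assms by (auto simp: H_iff)
  have "(\<Sum>b\<in>Basis. Lp_norm \<delta> X p ((dimN TYPE('n) - 1) / p) (dimN TYPE('n) / p) (\<lambda>x. D u x \<bullet> b))
      = (\<Sum>b\<in>Basis. Np (\<lambda>x. D u x \<bullet> b))"
  proof (rule sum.cong[OF refl])
    fix b :: "'n point" assume "b \<in> Basis"
    then have "Lp (\<lambda>x. D u x \<bullet> b)" using L(2) Lp_components(1)[of "D u"] by blast
    then show "Lp_norm \<delta> X p ((dimN TYPE('n) - 1) / p) (dimN TYPE('n) / p) (\<lambda>x. D u x \<bullet> b) = Np (\<lambda>x. D u x \<bullet> b)"
      by (intro Lp_norm_eq) (simp add: Lp_def)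
  qed
  moreover have "Lp_norm \<delta> X p ((dimN TYPE('n) - 1) / p) (dimN TYPE('n) / p) u = Np u"
    using L(1) by (intro Lp_norm_eq) (simp add: Lp_def)
  ultimately have h: "h = Np u + (\<Sum>b\<in>Basis. Np (\<lambda>x. D u x \<bullet> b))"
    unfolding h_def H_norm_def by (rule arg_cong2[where f="(+)", rotated])
  show "Hn u \<le> h" using Lp_components(3)[OF L(2)] by (simp add: h Hn_def)
  have "(\<Sum>b\<in>Basis. Np (\<lambda>x. D u x \<bullet> b)) \<le> (\<Sum>b\<in>(Basis::'n point set). Np (D u))"
    using Lp_components(2)[OF L(2)] by (intro sum_mono) auto
  also have "\<dots> = real DIM('n point) * Np (D u)" by (rule sum_constant)
  also have "\<dots> \<le> real DIM('n point) * Hn u" by (intro mult_left_mono) (simp_all add: Hn_def)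
  finally have "(\<Sum>b\<in>Basis. Np (\<lambda>x. D u x \<bullet> b)) \<le> real DIM('n point) * Hn u" .
  moreover have "Np u \<le> Hn u" by (simp add: Hn_def)
  ultimately show "h \<le> (1 + real DIM('n point)) * Hn u"
    unfolding h distrib_right mult_1 by (rule add_mono[rotated])
qed

section \<open>Test functions and their density in the energy space\<close>

lemma continuous_on_fst_snd:
  "continuous_on UNIV (\<lambda>x::'n point. fst x)" "continuous_on UNIV (\<lambda>x::'n point. fst (snd x))"
  by (auto intro!: continuous_intros)

lemma wt_Lp_loc: "wt \<in> Lp_loc Om 1"
  unfolding wt_def[abs_def]
  by (intro continuous_on_imp_Lp_loc open_Om continuous_on_divide continuous_on_mult continuous_on_const
      continuous_on_subset[OF continuous_on_fst_snd(1) subset_UNIV] continuous_on_subset[OF continuous_on_fst_snd(2) subset_UNIV])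
    (auto dest: OmD)

text \<open>The weight blows up at the faces x1 = 0 and x2 = 0 but is continuous on
  \<open>Om\<close>, hence integrable over compact subsets. Here it takes the role of the locally
  integrable factor, and the p-th power of \<open>norm (f x)\<close> that of the continuous
  one.\<close>

lemma Lp_if_compact_support:
  fixes f :: "'n point \<Rightarrow> 'b::euclidean_space"
  assumes f: "continuous_on UNIV f" and K: "compact K" "K \<subseteq> Om" "\<And>x. x \<notin> K \<Longrightarrow> f x = 0"
  shows "Lp f"
proof -
  have fm: "f \<in> borel_measurable (lebesgue_on Om)"
    using f by (intro borel_measurable_lebesgue_onI borel_measurable_continuous_onI)
  have "integrable (lebesgue_on Om) (\<lambda>x. wt x * norm (f x) powr p)"
  proof (rule Lp_loc_mult_integrable[OF wt_Lp_loc open_Om _ K(1,2)])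
    show "continuous_on UNIV (\<lambda>x. norm (f x) powr p)"
      using f p by (intro continuous_on_powr' continuous_on_norm continuous_on_const) auto
    show "{x. norm (f x) powr p \<noteq> 0} \<subseteq> K" using K(3) by auto
  qed
  then show ?thesis using fm by (simp add: Lp_def integrable_nu_iff)
qed

text \<open>The classical stretched gradient. For a test function it is continuous everywhere and 0
  outside the support, while \<open>D \<phi>\<close> is an unspecified representative of the same
  class.\<close>

definition cgrad :: "('n point \<Rightarrow> real) \<Rightarrow> 'n point \<Rightarrow> 'n point" where
  "cgrad \<phi> x = stretch x (frechet_derivative \<phi> (at x))"

lemma continuous_cgrad: "\<phi> \<in> test_functions Om \<Longrightarrow> continuous_on UNIV (cgrad \<phi>)"
  unfolding cgrad_def[abs_def] stretch_def
  by (intro continuous_on_Pair continuous_on_mult continuous_on_vec_lambda continuous_on_fst_snd test_functionD(3))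

lemma
  assumes \<phi>: "\<phi> \<in> test_functions Om"
  shows test_in_H: "\<phi> \<in> H" and Lp_cgrad: "Lp (cgrad \<phi>)" and Np_grad_test: "Np (D \<phi>) = Np (cgrad \<phi>)"
proof -
  note c = test_functionD(2,3)[OF \<phi>]
  have "f \<in> Lp_loc Om p" if "continuous_on UNIV f" for f
    using continuous_on_imp_Lp_loc[OF open_Om continuous_on_subset[OF that subset_UNIV]] p by simp
  then have W: "\<phi> \<in> W1p_loc Om p" unfolding W1p_loc_def
    using test_function_has_weak_partial[OF open_Om \<phi>] c by blast
  have "AE x in lebesgue_on Om. D \<phi> x = stretch x (\<lambda>b. frechet_derivative \<phi> (at x) b)"
    by (rule AE_weak_partials[OF test_function_has_weak_partial[OF open_Om \<phi>] W])
  then have ae: "AE x in lebesgue_on Om. cgrad \<phi> x = D \<phi> x"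
    by eventually_elim (simp add: cgrad_def)
  let ?K = "closure {x. \<phi> x \<noteq> 0}"
  have K: "compact ?K" "?K \<subseteq> Om" using \<phi> by (auto simp: test_functions_def)
  show L: "Lp (cgrad \<phi>)"
  proof (rule Lp_if_compact_support[OF continuous_cgrad[OF \<phi>] K])
    fix x assume "x \<notin> ?K"
    then show "cgrad \<phi> x = 0"
      by (simp add: cgrad_def stretch_def frechet_derivative_outside_support zero_prod_def vec_eq_iff)
  qed
  have "Lp \<phi>"
    using closure_subset[of "{x. \<phi> x \<noteq> 0}"] by (intro Lp_if_compact_support[OF c(1) K]) auto
  moreover note cg = Lp_cong_AE[OF L grad_measurable[OF W] ae]
  ultimately show "\<phi> \<in> H" using W by (simp add: H_iff)
  show "Np (D \<phi>) = Np (cgrad \<phi>)" by (rule cg(2))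
qed

lemma E_iff: "u \<in> E \<longleftrightarrow> u \<in> H \<and> (\<forall>e>0. \<exists>\<phi>\<in>test_functions Om. Hn (\<lambda>x. u x - \<phi> x) < e)"
proof (cases "u \<in> H")
  case True
  let ?h = "\<lambda>\<phi>. H_norm \<delta> X p ((dimN TYPE('n) - 1) / p) (dimN TYPE('n) / p) (\<lambda>x. u x - \<phi> x)"
  have b: "Hn (\<lambda>x. u x - \<phi> x) \<le> ?h \<phi>" "?h \<phi> \<le> (1 + real DIM('n point)) * Hn (\<lambda>x. u x - \<phi> x)"
    if "\<phi> \<in> test_functions Om" for \<phi>
    using H_norm_bounds[OF H_diff[OF True test_in_H[OF that]]] by auto
  have "(\<forall>e>0. \<exists>\<phi>\<in>test_functions Om. ?h \<phi> < e) \<longleftrightarrow> (\<forall>e>0. \<exists>\<phi>\<in>test_functions Om. Hn (\<lambda>x. u x - \<phi> x) < e)"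
  proof (intro iffI allI impI)
    fix e :: real assume "\<forall>e>0. \<exists>\<phi>\<in>test_functions Om. ?h \<phi> < e" "e > 0"
    then obtain \<phi> where "\<phi> \<in> test_functions Om" "?h \<phi> < e" by blast
    then show "\<exists>\<phi>\<in>test_functions Om. Hn (\<lambda>x. u x - \<phi> x) < e" using b(1)[of \<phi>] by (intro bexI[of _ \<phi>]) auto
  next
    fix e :: real assume *: "\<forall>e>0. \<exists>\<phi>\<in>test_functions Om. Hn (\<lambda>x. u x - \<phi> x) < e" and e: "e > 0"
    define N where "N = 1 + real DIM('n point)"
    have N: "N > 0" by (simp add: N_def)
    then have "e / N > 0" using e by simp
    then obtain \<phi> where \<phi>: "\<phi> \<in> test_functions Om" "Hn (\<lambda>x. u x - \<phi> x) < e / N" using * by blast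
    then have "N * Hn (\<lambda>x. u x - \<phi> x) < e" using N by (simp add: field_simps)
    then show "\<exists>\<phi>\<in>test_functions Om. ?h \<phi> < e" using b(2)[OF \<phi>(1)] \<phi>(1) unfolding N_def by (intro bexI[of _ \<phi>]) auto
  qed
  then show ?thesis using True by (simp add: E_space_def H0_space_def H_def)
qed (simp add: E_space_def H0_space_def H_def)

lemma E_imp_H: "u \<in> E \<Longrightarrow> u \<in> H" by (simp add: E_iff)

lemma test_in_E: "\<phi> \<in> test_functions Om \<Longrightarrow> \<phi> \<in> E"
proof -
  assume \<phi>: "\<phi> \<in> test_functions Om"
  \<comment> \<open>The chosen weak gradient of the zero function is 0 only almost everywhere, hence
    the detour through a linear combination.\<close>
  have "Hn (\<lambda>x. \<phi> x - \<phi> x) = 0"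
    using Np_grad_linear_combination[OF test_in_H[OF \<phi>] test_in_H[OF \<phi>], of "-1"] p by (simp add: Hn_def Np_def)
  then show ?thesis using \<phi> by (auto simp: E_iff test_in_H intro!: bexI[of _ \<phi>])
qed

lemma E_linear_combination:
  assumes u: "u \<in> E" and v: "v \<in> E" shows "(\<lambda>x. u x + c * v x) \<in> E"
proof -
  have "\<exists>\<phi>\<in>test_functions Om. Hn (\<lambda>x. u x + c * v x - \<phi> x) < e" if e: "e > 0" for e
  proof -
    obtain \<phi> where \<phi>: "\<phi> \<in> test_functions Om" "Hn (\<lambda>x. u x - \<phi> x) < e / 2"
      using u e unfolding E_iff by (metis half_gt_zero)
    have "e / (2 * (\<bar>c\<bar> + 1)) > 0" using e by simp
    then obtain \<psi> where \<psi>: "\<psi> \<in> test_functions Om" "Hn (\<lambda>x. v x - \<psi> x) < e / (2 * (\<bar>c\<bar> + 1))"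
      using v unfolding E_iff by metis
    have "\<bar>c\<bar> * Hn (\<lambda>x. v x - \<psi> x) \<le> (\<bar>c\<bar> + 1) * Hn (\<lambda>x. v x - \<psi> x)"
      using Hn_nonneg by (intro mult_right_mono) auto
    also have "\<dots> < (\<bar>c\<bar> + 1) * (e / (2 * (\<bar>c\<bar> + 1)))" using \<psi>(2) by (intro mult_strict_left_mono) auto
    also have "\<dots> = e / 2" by (simp add: field_simps)
    finally have "\<bar>c\<bar> * Hn (\<lambda>x. v x - \<psi> x) < e / 2" .
    moreover have "Hn (\<lambda>x. (u x - \<phi> x) + c * (v x - \<psi> x)) \<le> Hn (\<lambda>x. u x - \<phi> x) + \<bar>c\<bar> * Hn (\<lambda>x. v x - \<psi> x)"
      using u v \<phi> \<psi> by (intro Hn_linear_combination H_diff E_imp_H test_in_H)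
    moreover have "(\<lambda>x. (u x - \<phi> x) + c * (v x - \<psi> x)) = (\<lambda>x. u x + c * v x - (\<phi> x + c * \<psi> x))"
      by (simp add: fun_eq_iff algebra_simps)
    ultimately have "Hn (\<lambda>x. u x + c * v x - (\<phi> x + c * \<psi> x)) < e" using \<phi>(2) by simp
    then show ?thesis using test_functions_linear_combination[OF \<phi>(1) \<psi>(1), of c] by (rule bexI)
  qed
  then show ?thesis using u v by (simp add: E_iff H_linear_combination)
qed

lemma E_diff: "u \<in> E \<Longrightarrow> v \<in> E \<Longrightarrow> (\<lambda>x. u x - v x) \<in> E"
  using E_linear_combination[of u v "-1"] by simp

lemma E_uminus: "u \<in> E \<Longrightarrow> (\<lambda>x. - u x) \<in> E"
  using E_linear_combination[of u u "-2"] by simp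

section \<open>Energy and \<open>B_fun\<close> as norms with respect to \<open>nu\<close>\<close>

lemma E_energy_eq: "u \<in> H \<Longrightarrow> E_energy \<delta> X p u = Np (D u) powr p"
  unfolding E_energy_def Np_powr by (intro sigma_fst(2)) (auto simp: H_iff Lp_def)

lemma E_norm_eq: "u \<in> H \<Longrightarrow> E_norm \<delta> X p u = Np (D u)"
  using p by (simp add: E_norm_def E_energy_eq powr_powr)

text \<open>The reciprocal of \<open>wt\<close>. As it is bounded on \<open>Om\<close>,
  \<open>B_fun\<close> is controlled by the norm of the function itself.\<close>

definition mu :: "'n point \<Rightarrow> real" where "mu x = fst x * fst (snd x)"

lemma mu_borel: "mu \<in> borel_measurable borel"
  unfolding mu_def[abs_def]
  by (intro borel_measurable_continuous_onI continuous_on_mult continuous_on_fst_snd)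

lemma mu_bounds: "x \<in> Om \<Longrightarrow> 0 < mu x \<and> mu x \<le> \<delta>\<^sup>2"
  using OmD[of x] by (auto simp: mu_def power2_eq_square intro!: mult_mono)

lemma B_fun_eq:
  assumes u: "u \<in> borel_measurable (lebesgue_on Om)"
  shows "B_fun \<delta> X p u = 1 / p * Np (\<lambda>x. mu x * u x) powr p"
proof -
  have m: "(\<lambda>x. mu x * u x) \<in> borel_measurable (lebesgue_on Om)"
    using u borel_measurable_lebesgue_onI[OF mu_borel] by (rule borel_measurable_times[rotated])
  have "(\<integral>(x1, x2, x'). x1 powr (p + 1) * x2 powr p * \<bar>u (x1, x2, x')\<bar> powr p \<partial>sigma \<delta> X)
     = (\<integral>x. fst x * norm (mu x * u x) powr p \<partial>sigma \<delta> X)"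
  proof (intro Bochner_Integration.integral_cong refl)
    fix x assume "x \<in> space (sigma \<delta> X)"
    then show "(case x of (x1, x2, x') \<Rightarrow> x1 powr (p + 1) * x2 powr p * \<bar>u (x1, x2, x')\<bar> powr p)
        = fst x * norm (mu x * u x) powr p"
      using OmD[of x] by (simp add: space_sigma case_prod_unfold mu_def abs_mult powr_mult powr_add)
  qed
  also have "\<dots> = Np (\<lambda>x. mu x * u x) powr p"
    unfolding Np_powr using m by (intro sigma_fst(2)) auto
  finally show ?thesis by (simp add: B_fun_def)
qed

lemma
  assumes "Lp u" shows Lp_mu: "Lp (\<lambda>x. mu x * u x)" and Np_mu_le: "Np (\<lambda>x. mu x * u x) \<le> \<delta>\<^sup>2 * Np u"
proof -
  have m: "(\<lambda>x. mu x * u x) \<in> borel_measurable (lebesgue_on Om)"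
    using assms borel_measurable_lebesgue_onI[OF mu_borel] by (auto simp: Lp_def)
  have le: "norm (mu x * u x) \<le> norm (\<delta>\<^sup>2 *\<^sub>R u x)" if "x \<in> Om" for x
    using mu_bounds[OF that] by (simp add: abs_mult mult_right_mono)
  show "Lp (\<lambda>x. mu x * u x)" by (rule Np_mono(1)[OF Lp_scaleR[OF assms] m le])
  show "Np (\<lambda>x. mu x * u x) \<le> \<delta>\<^sup>2 * Np u"
    using Np_mono(2)[OF Lp_scaleR[OF assms] m le] by (simp add: Np_scaleR[of "\<delta>\<^sup>2" u, simplified])
qed

end

section \<open>Averages over a grid of cells\<close>

text \<open>The lower corner, in units of \<open>s\<close>, of the half-open cube of side
  \<open>s\<close> that contains the point. Half-open cubes partition the space exactly, without
  overlaps to discard.\<close>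

definition cell_index :: "real \<Rightarrow> 'a::euclidean_space \<Rightarrow> 'a" where
  "cell_index s x = (\<Sum>b\<in>Basis. real_of_int \<lfloor>(x \<bullet> b) / s\<rfloor> *\<^sub>R b)"

definition cell :: "real \<Rightarrow> 'a::euclidean_space \<Rightarrow> 'a set" where
  "cell s z = {x. cell_index s x = z}"

lemma cell_index_inner: "b \<in> Basis \<Longrightarrow> cell_index s x \<bullet> b = real_of_int \<lfloor>(x \<bullet> b) / s\<rfloor>"
  by (simp add: cell_index_def)

lemma cell_index_measurable: "cell_index s \<in> borel_measurable (borel :: 'a::euclidean_space measure)"
  unfolding cell_index_def[abs_def]
  by (intro borel_measurable_sum borel_measurable_scaleR borel_measurable_const
      measurable_compose[OF _ borel_measurable_real_floor] borel_measurable_divide borel_measurable_inner measurable_ident_sets refl)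

lemma cell_sets: "cell s z \<in> sets borel"
proof -
  have "cell s z = cell_index s -` {z} \<inter> space borel" by (auto simp: cell_def)
  then show ?thesis using measurable_sets[OF cell_index_measurable, of "{z}" s] by simp
qed

lemma cell_eq:
  fixes x :: "'a::euclidean_space"
  assumes s: "s > 0"
  shows "cell s (cell_index s x) =
    {y. \<forall>b\<in>Basis. s * (cell_index s x \<bullet> b) \<le> y \<bullet> b \<and> y \<bullet> b < s * (cell_index s x \<bullet> b + 1)}"
proof -
  have "cell_index s y = cell_index s x \<longleftrightarrow> (\<forall>b\<in>Basis. s * (cell_index s x \<bullet> b) \<le> y \<bullet> b \<and> y \<bullet> b < s * (cell_index s x \<bullet> b + 1))" for y
  proof -
    have "cell_index s y = cell_index s x \<longleftrightarrow> (\<forall>b\<in>Basis. \<lfloor>(y \<bullet> b) / s\<rfloor> = \<lfloor>(x \<bullet> b) / s\<rfloor>)"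
      by (auto simp: euclidean_eq_iff[of "cell_index s y"] cell_index_inner)
    also have "\<dots> \<longleftrightarrow> (\<forall>b\<in>Basis. s * (cell_index s x \<bullet> b) \<le> y \<bullet> b \<and> y \<bullet> b < s * (cell_index s x \<bullet> b + 1))"
      using s by (intro ball_cong refl) (simp add: cell_index_inner floor_eq_iff field_simps)
    finally show ?thesis .
  qed
  then show ?thesis by (auto simp: cell_def)
qed

lemma emeasure_cell:
  fixes x :: "'a::euclidean_space"
  assumes s: "s > 0"
  shows "emeasure lborel (cell s (cell_index s x)) = ennreal (s ^ DIM('a))"
proof -
  define l where "l = s *\<^sub>R cell_index s x"
  define u where "u = s *\<^sub>R (cell_index s x + One)"
  have ul: "(u - l) \<bullet> b = s" if "b \<in> Basis" for b
    using that by (simp add: u_def l_def algebra_simps)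
  have le: "l \<bullet> b \<le> u \<bullet> b" if "b \<in> Basis" for b
    using that s by (simp add: u_def l_def algebra_simps)
  have "(\<Prod>b\<in>Basis. (u - l) \<bullet> b) = s ^ DIM('a)" using ul by simp
  then have "emeasure lborel (box l u) = ennreal (s ^ DIM('a))" "emeasure lborel (cbox l u) = ennreal (s ^ DIM('a))"
    using le by (simp_all add: emeasure_lborel_box emeasure_lborel_cbox)
  moreover have "box l u \<subseteq> cell s (cell_index s x)" "cell s (cell_index s x) \<subseteq> cbox l u"
    unfolding cell_eq[OF s] by (auto simp: l_def u_def mem_box algebra_simps less_imp_le)
  ultimately show ?thesis
    using emeasure_mono[of "box l u" "cell s (cell_index s x)" lborel] emeasure_mono[of "cell s (cell_index s x)" "cbox l u" lborel]
    by (intro antisym) (auto simp: cell_sets)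
qed

lemma cell_diff:
  fixes x y :: "'a::euclidean_space"
  assumes s: "s > 0" and eq: "cell_index s x = cell_index s y" and b: "b \<in> Basis"
  shows "\<bar>(y - x) \<bullet> b\<bar> \<le> s"
proof -
  have "y \<in> cell s (cell_index s x)" "x \<in> cell s (cell_index s x)" using eq by (simp_all add: cell_def)
  then have "s * (cell_index s x \<bullet> b) \<le> y \<bullet> b" "y \<bullet> b < s * (cell_index s x \<bullet> b) + s"
    "s * (cell_index s x \<bullet> b) \<le> x \<bullet> b" "x \<bullet> b < s * (cell_index s x \<bullet> b) + s"
    using b unfolding cell_eq[OF s] by (auto simp: distrib_left)
  then show ?thesis unfolding inner_diff_left by linarith
qed

lemma finite_cell_index:
  fixes S :: "'a::euclidean_space set"
  assumes s: "s > 0" and S: "bounded S"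
  shows "finite (cell_index s ` S)"
proof -
  obtain R where R: "\<And>x. x \<in> S \<Longrightarrow> norm x \<le> R" using S by (auto simp: bounded_iff)
  define n where "n = \<lceil>R / s\<rceil> + 1"
  define F where "F = (\<lambda>f::'a \<Rightarrow> int. \<Sum>b\<in>Basis. real_of_int (f b) *\<^sub>R b)"
  have "cell_index s x \<in> F ` (PiE Basis (\<lambda>_. {-n..n}))" if "x \<in> S" for x
  proof
    show "cell_index s x = F (restrict (\<lambda>b. \<lfloor>(x \<bullet> b) / s\<rfloor>) Basis)"
      by (simp add: cell_index_def F_def)
    show "restrict (\<lambda>b. \<lfloor>(x \<bullet> b) / s\<rfloor>) Basis \<in> PiE Basis (\<lambda>_. {-n..n})"
    proof (rule restrict_PiE_iff[THEN iffD2], rule ballI)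
      fix b :: 'a assume "b \<in> Basis"
      then have "\<bar>x \<bullet> b\<bar> \<le> R" using Basis_le_norm R[OF that] by (meson order_trans)
      then have "- (R / s) \<le> (x \<bullet> b) / s" "(x \<bullet> b) / s \<le> R / s"
        using s divide_right_mono[of "- R" "x \<bullet> b" s] divide_right_mono[of "x \<bullet> b" R s] by (auto simp: abs_le_iff)
      then have "- \<lceil>R / s\<rceil> - 1 \<le> \<lfloor>x \<bullet> b / s\<rfloor>" "\<lfloor>x \<bullet> b / s\<rfloor> \<le> \<lceil>R / s\<rceil> + 1" by linarith+
      then show "\<lfloor>(x \<bullet> b) / s\<rfloor> \<in> {-n..n}" unfolding n_def by simp
    qed
  qed
  then have "cell_index s ` S \<subseteq> F ` (PiE Basis (\<lambda>_. {-n..n}))" by blast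
  then show ?thesis by (rule finite_subset) (auto intro!: finite_imageI finite_PiE)
qed

text \<open>The value at \<open>x\<close> is the mean over the cell minus the mean of
  \<open>\<phi> y - \<phi> x\<close> over \<open>y\<close>. Jensen on the cell bounds the second
  part by the integral of the increments.\<close>

lemma nn_integral_cell_le:
  fixes \<phi> :: "'a::euclidean_space \<Rightarrow> real" and x0 :: 'a
  assumes s: "s > 0" and p: "1 \<le> p" and \<phi>: "continuous_on UNIV \<phi>" "integrable lborel \<phi>"
  defines "V \<equiv> s ^ DIM('a)" and "Q \<equiv> cell s (cell_index s x0)"
  shows "(\<integral>\<^sup>+x\<in>Q. ennreal (\<bar>\<phi> x\<bar> powr p) \<partial>lborel)
    \<le> ennreal (2 powr p / V) * (\<integral>\<^sup>+x\<in>Q. (\<integral>\<^sup>+y\<in>Q. ennreal (\<bar>\<phi> y - \<phi> x\<bar> powr p) \<partial>lborel) \<partial>lborel)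
      + ennreal (2 powr p * V powr (1 - p) * \<bar>LINT x:Q|lborel. \<phi> x\<bar> powr p)"
proof -
  have V: "V > 0" using s by (simp add: V_def)
  have Q[measurable]: "Q \<in> sets borel" by (simp add: Q_def cell_sets)
  have eQ: "emeasure lborel Q = ennreal V" by (simp add: Q_def V_def emeasure_cell[OF s])
  have \<phi>m[measurable]: "\<phi> \<in> borel_measurable borel" using \<phi>(1) by (rule borel_measurable_continuous_onI)
  define l where "l = (LINT x:Q|lborel. \<phi> x)"
  let ?M = "restrict_space lborel Q"
  interpret M: finite_measure ?M
    using eQ by (intro finite_measureI) (simp add: emeasure_restrict_space space_restrict_space)
  have mV: "measure ?M (space ?M) = V"
  proof -
    have "emeasure ?M (space ?M) = ennreal V" using eQ by (simp add: emeasure_restrict_space space_restrict_space)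
    then show ?thesis using V by (simp add: measure_def)
  qed
  have i\<phi>: "integrable ?M \<phi>"
    using \<phi>(2) by (subst integrable_restrict_space) (auto intro: integrable_mult_indicator[of Q lborel \<phi>, simplified])
  have il: "integral\<^sup>L ?M \<phi> = l"
    unfolding l_def set_lebesgue_integral_def by (subst integral_restrict_space) auto
  have pt: "ennreal (\<bar>\<phi> x\<bar> powr p) \<le> ennreal (2 powr p / V) * (\<integral>\<^sup>+y\<in>Q. ennreal (\<bar>\<phi> y - \<phi> x\<bar> powr p) \<partial>lborel)
      + ennreal (2 powr p * V powr (- p) * \<bar>l\<bar> powr p)" for x
  proof -
    define J where "J = integral\<^sup>L ?M (\<lambda>y. \<phi> y - \<phi> x)"
    have J: "J = l - V * \<phi> x" unfolding J_def using i\<phi> il mV by simp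
    then have "\<phi> x = l / V - J / V" using V by (simp add: field_simps)
    then have "\<bar>\<phi> x\<bar> \<le> \<bar>J\<bar> / V + \<bar>l\<bar> / V"
      using abs_triangle_ineq4[of "l / V" "J / V"] V by simp
    then have "\<bar>\<phi> x\<bar> powr p \<le> (\<bar>J\<bar> / V + \<bar>l\<bar> / V) powr p" using p by (intro powr_mono2) auto
    also have "\<dots> \<le> 2 powr p * ((\<bar>J\<bar> / V) powr p + (\<bar>l\<bar> / V) powr p)"
      using p V by (intro powr_add_le_two_powr) auto
    also have "\<dots> = 2 powr p * V powr (- p) * \<bar>J\<bar> powr p + 2 powr p * V powr (- p) * \<bar>l\<bar> powr p"
      using V by (simp add: powr_divide powr_minus_divide distrib_left)
    finally have 1: "ennreal (\<bar>\<phi> x\<bar> powr p)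
        \<le> ennreal (2 powr p * V powr (- p)) * ennreal (\<bar>J\<bar> powr p) + ennreal (2 powr p * V powr (- p) * \<bar>l\<bar> powr p)"
      by (simp add: ennreal_leI flip: ennreal_mult ennreal_plus)
    have "ennreal (\<bar>J\<bar> powr p) \<le> ennreal (V powr (p - 1)) * (\<integral>\<^sup>+y. ennreal (\<bar>\<phi> y - \<phi> x\<bar> powr p) \<partial>?M)"
      unfolding J_def using M.powr_integral_le_nn_integral[OF p, of "\<lambda>y. \<phi> y - \<phi> x"] i\<phi> mV by simp
    also have "(\<integral>\<^sup>+y. ennreal (\<bar>\<phi> y - \<phi> x\<bar> powr p) \<partial>?M) = (\<integral>\<^sup>+y\<in>Q. ennreal (\<bar>\<phi> y - \<phi> x\<bar> powr p) \<partial>lborel)"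
      by (rule nn_integral_restrict_space) simp
    finally have 2: "ennreal (2 powr p * V powr (- p)) * ennreal (\<bar>J\<bar> powr p)
        \<le> ennreal (2 powr p * V powr (- p)) * (ennreal (V powr (p - 1)) * (\<integral>\<^sup>+y\<in>Q. ennreal (\<bar>\<phi> y - \<phi> x\<bar> powr p) \<partial>lborel))"
      by (rule mult_left_mono) simp
    have "2 powr p * V powr (- p) * V powr (p - 1) = 2 powr p / V"
      using V by (simp add: powr_minus_divide powr_diff)
    then have 3: "ennreal (2 powr p * V powr (- p)) * (ennreal (V powr (p - 1)) * t) = ennreal (2 powr p / V) * t" for t
      by (simp add: mult.assoc[symmetric] ennreal_mult[symmetric])
    show ?thesis using 1 add_right_mono[OF 2] unfolding 3 by (rule order_trans)
  qed
  have "(\<integral>\<^sup>+x\<in>Q. ennreal (\<bar>\<phi> x\<bar> powr p) \<partial>lborel)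
     \<le> (\<integral>\<^sup>+x. ennreal (2 powr p / V) * ((\<integral>\<^sup>+y\<in>Q. ennreal (\<bar>\<phi> y - \<phi> x\<bar> powr p) \<partial>lborel) * indicator Q x)
        + ennreal (2 powr p * V powr (- p) * \<bar>l\<bar> powr p) * indicator Q x \<partial>lborel)"
    using pt by (intro nn_integral_mono) (auto simp: indicator_def)
  also have "\<dots> = ennreal (2 powr p / V) * (\<integral>\<^sup>+x\<in>Q. (\<integral>\<^sup>+y\<in>Q. ennreal (\<bar>\<phi> y - \<phi> x\<bar> powr p) \<partial>lborel) \<partial>lborel)
      + ennreal (2 powr p * V powr (- p) * \<bar>l\<bar> powr p) * ennreal V"
    using eQ by (simp add: nn_integral_add nn_integral_cmult)
  also have "ennreal (2 powr p * V powr (- p) * \<bar>l\<bar> powr p) * ennreal V = ennreal (2 powr p * V powr (1 - p) * \<bar>l\<bar> powr p)"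
    using V by (simp add: powr_minus_divide powr_diff flip: ennreal_mult)
  finally show ?thesis by (simp add: l_def)
qed

text \<open>Two points of one cell differ by a vector \<open>h\<close> of size \<open>s\<close>, and \<open>\<bar>\<phi> (x + h) - \<phi> x\<bar>\<^sup>p\<close> is bounded by
  the integral of the derivative along the segment; no Poincare inequality on a single cell is needed.\<close>

lemma cell_Poincare:
  fixes \<phi> :: "'a::euclidean_space \<Rightarrow> real"
  assumes s: "s > 0" and p: "1 \<le> p" and \<phi>: "\<forall>k. Ck k \<phi>" "integrable lborel \<phi>"
    and U: "U \<in> sets borel" "convex U" and Z: "finite Z" "Z \<subseteq> range (cell_index s)" "\<And>z. z \<in> Z \<Longrightarrow> cell s z \<subseteq> U"
  defines "V \<equiv> s ^ DIM('a)"
  shows "(\<Sum>z\<in>Z. \<integral>\<^sup>+x\<in>cell s z. ennreal (\<bar>\<phi> x\<bar> powr p) \<partial>lborel)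
    \<le> ennreal (2 powr p * 2 ^ DIM('a) * s powr p) *
        (\<integral>\<^sup>+x\<in>U. ennreal ((\<Sum>b\<in>Basis. \<bar>frechet_derivative \<phi> (at x) b\<bar>) powr p) \<partial>lborel)
      + ennreal (2 powr p * V powr (1 - p) * (\<Sum>z\<in>Z. \<bar>LINT x:cell s z|lborel. \<phi> x\<bar> powr p))"
proof -
  have V: "V > 0" using s by (simp add: V_def)
  have \<phi>c: "continuous_on UNIV \<phi>" by (rule smooth_continuous[OF \<phi>(1)])
  have \<phi>m[measurable]: "\<phi> \<in> borel_measurable borel" using \<phi>c by (rule borel_measurable_continuous_onI)
  have dm[measurable]: "(\<lambda>x. frechet_derivative \<phi> (at x) b) \<in> borel_measurable borel" for b
    using smooth_continuous_derivative[OF \<phi>(1)] by (rule borel_measurable_continuous_onI)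
  note [measurable] = cell_sets U(1)
  define G where "G = (\<lambda>x. ennreal ((\<Sum>b\<in>Basis. \<bar>frechet_derivative \<phi> (at x) b\<bar>) powr p))"
  have Gm[measurable]: "G \<in> borel_measurable borel" unfolding G_def by measurable
  \<comment> \<open>All differences of two points of one cell lie in this cube of volume (2 s)^d.
    Against the factor 1 / V = s^(-d) from \<open>nn_integral_cell_le\<close> it leaves 2^d.\<close>
  define C where "C = cbox (- s *\<^sub>R One) (s *\<^sub>R One :: 'a)"
  have [measurable]: "C \<in> sets borel" by (simp add: C_def)
  have eC: "emeasure lborel C = ennreal ((2 * s) ^ DIM('a))"
  proof -
    have "(\<Prod>b\<in>Basis. (s *\<^sub>R One - - s *\<^sub>R One :: 'a) \<bullet> b) = (\<Prod>b\<in>(Basis::'a set). 2 * s)"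
      by (intro prod.cong refl) (simp add: inner_add_left)
    also have "\<dots> = (2 * s) ^ DIM('a)" by simp
    finally have "(\<Prod>b\<in>Basis. (s *\<^sub>R One - - s *\<^sub>R One :: 'a) \<bullet> b) = (2 * s) ^ DIM('a)" .
    moreover have "emeasure lborel C = ennreal (\<Prod>b\<in>Basis. (s *\<^sub>R One - - s *\<^sub>R One :: 'a) \<bullet> b)"
      unfolding C_def using s by (intro emeasure_lborel_cbox) simp
    ultimately show ?thesis by (simp only:)
  qed
  have dle: "\<bar>frechet_derivative \<phi> (at x) h\<bar> powr p \<le> s powr p * (\<Sum>b\<in>Basis. \<bar>frechet_derivative \<phi> (at x) b\<bar>) powr p"
    if "h \<in> C" for x h
  proof -
    have "\<bar>frechet_derivative \<phi> (at x) h\<bar> \<le> (\<Sum>b\<in>Basis. \<bar>(h \<bullet> b) * frechet_derivative \<phi> (at x) b\<bar>)"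
      by (subst smooth_derivative_eq_sum[OF \<phi>(1)]) (rule sum_abs)
    also have "\<dots> \<le> (\<Sum>b\<in>Basis. s * \<bar>frechet_derivative \<phi> (at x) b\<bar>)"
      using that by (intro sum_mono) (auto simp: C_def mem_box abs_mult abs_le_iff minus_le_iff intro!: mult_right_mono)
    finally have "\<bar>frechet_derivative \<phi> (at x) h\<bar> powr p \<le> (s * (\<Sum>b\<in>Basis. \<bar>frechet_derivative \<phi> (at x) b\<bar>)) powr p"
      using p by (intro powr_mono2) (auto simp: sum_distrib_left)
    then show ?thesis using s by (simp add: powr_mult sum_nonneg)
  qed
  \<comment> \<open>For a fixed difference \<open>h\<close>, convexity of \<open>U\<close> keeps the
    whole segment from \<open>x\<close> to \<open>x + h\<close> in \<open>U\<close>, so translation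
    moves the derivative back to an integral over \<open>U\<close>.\<close>
  have inner: "(\<integral>\<^sup>+x. indicator U x * indicator U (x + h) * ennreal (\<bar>\<phi> (x + h) - \<phi> x\<bar> powr p) \<partial>lborel)
      \<le> ennreal (s powr p) * (\<integral>\<^sup>+x\<in>U. G x \<partial>lborel)" if h: "h \<in> C" for h
  proof -
    have "(\<integral>\<^sup>+x. indicator U x * indicator U (x + h) * ennreal (\<bar>\<phi> (x + h) - \<phi> x\<bar> powr p) \<partial>lborel)
      \<le> (\<integral>\<^sup>+x. (indicator U x * indicator U (x + h)) *
          (\<integral>\<^sup>+t. ennreal (\<bar>frechet_derivative \<phi> (at (x + t *\<^sub>R h)) h\<bar> powr p) * indicator {0..1} t \<partial>lborel) \<partial>lborel)"
      by (intro nn_integral_mono mult_left_mono smooth_increment_powr_le[OF \<phi>(1) p]) simp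
    also have "\<dots> \<le> (\<integral>\<^sup>+x. indicator U x * ennreal (\<bar>frechet_derivative \<phi> (at x) h\<bar> powr p) \<partial>lborel)"
    proof (rule nn_integral_segments_le)
      fix x and t :: real assume t: "0 \<le> t" "t \<le> 1"
      have "x + t *\<^sub>R h \<in> U" if "x \<in> U" "x + h \<in> U"
        using convexD_alt[OF U(2) that t] by (simp add: algebra_simps)
      then show "indicator U x * indicator U (x + h) * ennreal (\<bar>frechet_derivative \<phi> (at (x + t *\<^sub>R h)) h\<bar> powr p)
        \<le> indicator U (x + t *\<^sub>R h) * ennreal (\<bar>frechet_derivative \<phi> (at (x + t *\<^sub>R h)) h\<bar> powr p)"
        by (auto simp: indicator_def)
    qed measurable
    also have "\<dots> \<le> (\<integral>\<^sup>+x. ennreal (s powr p) * (G x * indicator U x) \<partial>lborel)"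
      using dle[OF h] by (intro nn_integral_mono) (auto simp: indicator_def G_def ennreal_leI ennreal_mult[symmetric])
    also have "\<dots> = ennreal (s powr p) * (\<integral>\<^sup>+x\<in>U. G x \<partial>lborel)" by (rule nn_integral_cmult) measurable
    finally show ?thesis .
  qed
  have "(\<Sum>z\<in>Z. \<integral>\<^sup>+x\<in>cell s z. (\<integral>\<^sup>+y\<in>cell s z. ennreal (\<bar>\<phi> y - \<phi> x\<bar> powr p) \<partial>lborel) \<partial>lborel)
      = (\<integral>\<^sup>+x. \<integral>\<^sup>+y. (\<Sum>z\<in>Z. ennreal (\<bar>\<phi> y - \<phi> x\<bar> powr p) * indicator (cell s z) y * indicator (cell s z) x) \<partial>lborel \<partial>lborel)"
    by (simp add: nn_integral_sum nn_integral_multc)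
  also have "\<dots> \<le> (\<integral>\<^sup>+x. \<integral>\<^sup>+y. ennreal (\<bar>\<phi> y - \<phi> x\<bar> powr p) * (indicator C (y - x) * (indicator U x * indicator U y)) \<partial>lborel \<partial>lborel)"
  proof (intro nn_integral_mono)
    fix x y :: 'a
    \<comment> \<open>Two points share at most one cell, so a pair is counted at most once over all
      cells. What is kept of such a pair is that both points lie in \<open>U\<close> and differ by
      an element of \<open>C\<close>.\<close>
    have "(\<Sum>z\<in>Z. indicator (cell s z) y * indicator (cell s z) x) \<le> (indicator C (y - x) * (indicator U x * indicator U y) :: ennreal)"
    proof (cases "cell_index s x = cell_index s y \<and> cell_index s x \<in> Z")
      case True
      have "(\<Sum>z\<in>Z. indicator (cell s z) y * indicator (cell s z) x) = (\<Sum>z\<in>Z. if z = cell_index s x then 1 else 0 :: ennreal)"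
        using True by (intro sum.cong) (auto simp: cell_def indicator_def)
      also have "\<dots> = 1" using conjunct2[OF True] Z(1) by (subst sum.delta) auto
      finally have "(\<Sum>z\<in>Z. indicator (cell s z) y * indicator (cell s z) x) = (1::ennreal)" .
      moreover have "x \<in> U" "y \<in> U" using True Z(3)[of "cell_index s x"] by (auto simp: cell_def)
      moreover have "y - x \<in> C"
        using cell_diff[OF s, of x y] True by (auto simp: C_def mem_box abs_le_iff minus_le_iff)
      ultimately show ?thesis by simp
    next
      case False
      then have "(\<Sum>z\<in>Z. indicator (cell s z) y * indicator (cell s z) x) = (0::ennreal)"
        by (intro sum.neutral) (auto simp: cell_def indicator_def)
      then show ?thesis by simp
    qed
    then show "(\<Sum>z\<in>Z. ennreal (\<bar>\<phi> y - \<phi> x\<bar> powr p) * indicator (cell s z) y * indicator (cell s z) x)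
        \<le> ennreal (\<bar>\<phi> y - \<phi> x\<bar> powr p) * (indicator C (y - x) * (indicator U x * indicator U y))"
      unfolding mult.assoc sum_distrib_left[symmetric] by (intro mult_left_mono) auto
  qed
  \<comment> \<open>With \<open>y = x + h\<close> the order of integration can be exchanged, which
    reduces everything to the estimate for fixed \<open>h\<close>.\<close>
  also have "\<dots> = (\<integral>\<^sup>+x. \<integral>\<^sup>+h. ennreal (\<bar>\<phi> (x + h) - \<phi> x\<bar> powr p) * (indicator C h * (indicator U x * indicator U (x + h))) \<partial>lborel \<partial>lborel)"
  proof (rule nn_integral_cong)
    fix x :: 'a
    show "(\<integral>\<^sup>+y. ennreal (\<bar>\<phi> y - \<phi> x\<bar> powr p) * (indicator C (y - x) * (indicator U x * indicator U y)) \<partial>lborel)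
      = (\<integral>\<^sup>+h. ennreal (\<bar>\<phi> (x + h) - \<phi> x\<bar> powr p) * (indicator C h * (indicator U x * indicator U (x + h))) \<partial>lborel)"
      using nn_integral_lborel_translate[of "\<lambda>y. ennreal (\<bar>\<phi> y - \<phi> x\<bar> powr p) * (indicator C (y - x) * (indicator U x * indicator U y))" x]
      by (simp add: add.commute)
  qed
  also have "\<dots> = (\<integral>\<^sup>+h. \<integral>\<^sup>+x. ennreal (\<bar>\<phi> (x + h) - \<phi> x\<bar> powr p) * (indicator C h * (indicator U x * indicator U (x + h))) \<partial>lborel \<partial>lborel)"
    by (rule lborel_pair.Fubini'[symmetric]) measurable
  also have "\<dots> \<le> (\<integral>\<^sup>+h. ennreal (s powr p) * (\<integral>\<^sup>+x\<in>U. G x \<partial>lborel) * indicator C h \<partial>lborel)"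
  proof (rule nn_integral_mono)
    fix h :: 'a
    show "(\<integral>\<^sup>+x. ennreal (\<bar>\<phi> (x + h) - \<phi> x\<bar> powr p) * (indicator C h * (indicator U x * indicator U (x + h))) \<partial>lborel)
        \<le> ennreal (s powr p) * (\<integral>\<^sup>+x\<in>U. G x \<partial>lborel) * indicator C h"
      using inner[of h] by (cases "h \<in> C") (auto simp: mult_ac)
  qed
  also have "\<dots> = ennreal (s powr p) * (\<integral>\<^sup>+x\<in>U. G x \<partial>lborel) * ennreal ((2 * s) ^ DIM('a))"
    by (subst nn_integral_cmult) (auto simp: eC)
  finally have main: "(\<Sum>z\<in>Z. \<integral>\<^sup>+x\<in>cell s z. (\<integral>\<^sup>+y\<in>cell s z. ennreal (\<bar>\<phi> y - \<phi> x\<bar> powr p) \<partial>lborel) \<partial>lborel)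
      \<le> ennreal (s powr p) * (\<integral>\<^sup>+x\<in>U. G x \<partial>lborel) * ennreal ((2 * s) ^ DIM('a))" .
  have "(\<Sum>z\<in>Z. \<integral>\<^sup>+x\<in>cell s z. ennreal (\<bar>\<phi> x\<bar> powr p) \<partial>lborel)
    \<le> (\<Sum>z\<in>Z. ennreal (2 powr p / V) * (\<integral>\<^sup>+x\<in>cell s z. (\<integral>\<^sup>+y\<in>cell s z. ennreal (\<bar>\<phi> y - \<phi> x\<bar> powr p) \<partial>lborel) \<partial>lborel)
      + ennreal (2 powr p * V powr (1 - p) * \<bar>LINT x:cell s z|lborel. \<phi> x\<bar> powr p))"
    unfolding V_def
  proof (intro sum_mono)
    fix z assume "z \<in> Z"
    then obtain x0 where "z = cell_index s x0" using Z(2) by blast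
    then show "(\<integral>\<^sup>+x\<in>cell s z. ennreal (\<bar>\<phi> x\<bar> powr p) \<partial>lborel)
      \<le> ennreal (2 powr p / s ^ DIM('a)) * (\<integral>\<^sup>+x\<in>cell s z. (\<integral>\<^sup>+y\<in>cell s z. ennreal (\<bar>\<phi> y - \<phi> x\<bar> powr p) \<partial>lborel) \<partial>lborel)
        + ennreal (2 powr p * (s ^ DIM('a)) powr (1 - p) * \<bar>LINT x:cell s z|lborel. \<phi> x\<bar> powr p)"
      using nn_integral_cell_le[OF s p \<phi>c \<phi>(2), of x0] by simp
  qed
  also have "\<dots> = ennreal (2 powr p / V) * (\<Sum>z\<in>Z. \<integral>\<^sup>+x\<in>cell s z. (\<integral>\<^sup>+y\<in>cell s z. ennreal (\<bar>\<phi> y - \<phi> x\<bar> powr p) \<partial>lborel) \<partial>lborel)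
      + ennreal (2 powr p * V powr (1 - p) * (\<Sum>z\<in>Z. \<bar>LINT x:cell s z|lborel. \<phi> x\<bar> powr p))"
    by (simp add: sum.distrib sum_distrib_left sum_ennreal)
  also have "\<dots> \<le> ennreal (2 powr p / V) * (ennreal (s powr p) * (\<integral>\<^sup>+x\<in>U. G x \<partial>lborel) * ennreal ((2 * s) ^ DIM('a)))
      + ennreal (2 powr p * V powr (1 - p) * (\<Sum>z\<in>Z. \<bar>LINT x:cell s z|lborel. \<phi> x\<bar> powr p))"
    by (intro add_right_mono mult_left_mono main) simp
  also have "ennreal (2 powr p / V) * (ennreal (s powr p) * I * ennreal ((2 * s) ^ DIM('a)))
      = ennreal (2 powr p * 2 ^ DIM('a) * s powr p) * I" for I
  proof -
    have "2 powr p / V * (s powr p * (2 * s) ^ DIM('a)) = 2 powr p * 2 ^ DIM('a) * s powr p"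
      using V by (simp add: V_def power_mult_distrib)
    then have "ennreal (2 powr p * 2 ^ DIM('a) * s powr p) = ennreal (2 powr p / V) * (ennreal (s powr p) * ennreal ((2 * s) ^ DIM('a)))"
      using s V by (simp flip: ennreal_mult)
    then show ?thesis by (simp add: mult_ac)
  qed
  finally show ?thesis by (simp add: G_def)
qed

section \<open>Compactness\<close>

context corner
begin

lemma nn_integral_nu:
  fixes g :: "'n point \<Rightarrow> ennreal"
  assumes "g \<in> borel_measurable borel"
  shows "(\<integral>\<^sup>+x. g x \<partial>nu) = (\<integral>\<^sup>+x. ennreal (wt x) * indicator Om x * g x \<partial>lborel)"
proof -
  have [measurable]: "g \<in> borel_measurable (lebesgue_on Om)" by (rule borel_measurable_lebesgue_onI[OF assms])
  have "(\<integral>\<^sup>+x. g x \<partial>nu) = (\<integral>\<^sup>+x. ennreal (wt x) * g x \<partial>lebesgue_on Om)"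
    unfolding nu_def by (rule nn_integral_density) measurable
  also have "\<dots> = (\<integral>\<^sup>+x. ennreal (wt x) * g x * indicator Om x \<partial>lebesgue)"
    by (rule nn_integral_restrict_space[OF Om_sets])
  also have "\<dots> = (\<integral>\<^sup>+x. ennreal (wt x) * g x * indicator Om x \<partial>lborel)"
    by (rule nn_integral_completion)
  finally show ?thesis by (simp add: mult_ac)
qed

lemma ennreal_Np_powr:
  fixes f :: "'n point \<Rightarrow> 'b::euclidean_space"
  assumes f: "f \<in> borel_measurable borel" "Lp f"
  shows "ennreal (Np f powr p) = (\<integral>\<^sup>+x. ennreal (wt x) * indicator Om x * ennreal (norm (f x) powr p) \<partial>lborel)"
proof -
  have [measurable]: "f \<in> borel_measurable borel" by (rule f)
  have "ennreal (Np f powr p) = (\<integral>\<^sup>+x. ennreal (norm (f x) powr p) \<partial>nu)"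
    unfolding Np_powr using f(2) by (intro nn_integral_eq_integral[symmetric]) (auto simp: Lp_def)
  then show ?thesis by (simp add: nn_integral_nu)
qed

lemma Om_borel: "Om \<in> sets borel" using open_Om by simp

text \<open>The three kinds of partial derivatives carry the factors x1, x1 x2 and 1 in the
  stretched gradient. Since \<open>k \<le> 1\<close>, each of these factors is at least k^2.\<close>

lemma abs_partial_le_cgrad:
  assumes b: "b \<in> Basis" and x: "x \<in> Om" and k: "0 < k" "k \<le> 1" "fst x \<ge> k" "fst (snd x) \<ge> k"
  shows "\<bar>frechet_derivative \<phi> (at x) b\<bar> \<le> norm (cgrad \<phi> x) / k\<^sup>2"
proof -
  let ?d = "frechet_derivative \<phi> (at x)"
  have le: "\<bar>stretch x ?d \<bullet> b\<bar> \<le> norm (cgrad \<phi> x)" using Basis_le_norm[OF b] by (simp add: cgrad_def)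
  have k2: "k\<^sup>2 \<le> k" using power_decreasing[of 1 2 k] k by simp
  have "k\<^sup>2 * \<bar>?d b\<bar> \<le> \<bar>stretch x ?d \<bullet> b\<bar>"
    using b
  proof (cases rule: Basis_point_cases)
    case 1
    have "k\<^sup>2 * \<bar>?d b\<bar> \<le> fst x * \<bar>?d b\<bar>" using k2 k by (intro mult_right_mono) auto
    then show ?thesis using 1 k by (simp add: stretch_inner abs_mult)
  next
    case 2
    have "k\<^sup>2 * \<bar>?d b\<bar> \<le> (fst x * fst (snd x)) * \<bar>?d b\<bar>"
      using k unfolding power2_eq_square by (intro mult_right_mono mult_mono) auto
    then show ?thesis using 2 k by (simp add: stretch_inner abs_mult)
  next
    case (3 i)
    have "k\<^sup>2 * \<bar>?d b\<bar> \<le> 1 * \<bar>?d b\<bar>" using k2 k by (intro mult_right_mono) auto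
    then show ?thesis using 3 by (simp add: stretch_inner)
  qed
  then have "k\<^sup>2 * \<bar>?d b\<bar> \<le> norm (cgrad \<phi> x)" using le by linarith
  then show ?thesis using k by (simp add: field_simps)
qed

text \<open>The integration runs along one of the \<open>x'\<close> directions, in which the weight is constant and \<open>X\<close>
  has finite width.\<close>

lemma Poincare_test: "\<exists>L>0. \<forall>\<phi>\<in>test_functions Om. Np \<phi> \<le> L * Np (D \<phi>)"
proof -
  obtain R where R: "R > 0" "\<And>x. x \<in> X \<Longrightarrow> norm x \<le> R" using X(2) by (auto simp: bounded_pos)
  \<comment> \<open>A shift by more than the diameter of \<open>X\<close> moves every point of
    \<open>Om\<close> out of \<open>Om\<close>, so the increment of a test function along it is
    minus its value.\<close>
  define L where "L = 2 * R + 1"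
  have L: "L > 0" using R by (simp add: L_def)
  define i :: 'n where "i = undefined"
  define e :: "'n point" where "e = (0, 0, axis i 1)"
  define h where "h = L *\<^sub>R e"
  have e: "e \<in> Basis" using Basis_point(3) by (simp add: e_def)
  have out: "x + h \<notin> Om" if "x \<in> Om" for x
  proof
    assume "x + h \<in> Om"
    then have "snd (snd (x + h)) \<in> X" using OmD by blast
    then have "norm (snd (snd x) + L *\<^sub>R axis i 1) \<le> R" using R(2) by (simp add: h_def e_def)
    moreover have "norm (snd (snd x)) \<le> R" using R(2) OmD[OF that] by blast
    moreover have "norm (L *\<^sub>R axis i 1 :: real ^ 'n) \<le> norm (snd (snd x) + L *\<^sub>R axis i 1) + norm (snd (snd x))"
      using norm_triangle_ineq4[of "snd (snd x) + L *\<^sub>R axis i 1" "snd (snd x)"] by simp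
    ultimately show False using L by (simp add: L_def)
  qed
  have "Np \<phi> \<le> L * Np (D \<phi>)" if \<phi>: "\<phi> \<in> test_functions Om" for \<phi>
  proof -
    note sm = test_functionD(1)[OF \<phi>]
    have \<phi>m[measurable]: "\<phi> \<in> borel_measurable borel"
      using test_functionD(2)[OF \<phi>] by (rule borel_measurable_continuous_onI)
    have dm[measurable]: "(\<lambda>x. frechet_derivative \<phi> (at x) h) \<in> borel_measurable borel"
      using test_functionD(3)[OF \<phi>] by (rule borel_measurable_continuous_onI)
    have cm[measurable]: "cgrad \<phi> \<in> borel_measurable borel"
      using continuous_cgrad[OF \<phi>] by (rule borel_measurable_continuous_onI)
    note [measurable] = wt_borel Om_borel
    define w where "w = (\<lambda>x. ennreal (wt x) * indicator Om x)"
    have wm[measurable]: "w \<in> borel_measurable borel" unfolding w_def by measurable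
    have L\<phi>: "Lp \<phi>" using test_in_H[OF \<phi>] by (simp add: H_iff)
    have "ennreal (Np \<phi> powr p) = (\<integral>\<^sup>+x. w x * ennreal (\<bar>\<phi> x\<bar> powr p) \<partial>lborel)"
      using ennreal_Np_powr[OF \<phi>m L\<phi>] by (simp add: w_def)
    also have "\<dots> \<le> (\<integral>\<^sup>+x. w x * (\<integral>\<^sup>+t. ennreal (\<bar>frechet_derivative \<phi> (at (x + t *\<^sub>R h)) h\<bar> powr p) * indicator {0..1} t \<partial>lborel) \<partial>lborel)"
    proof (rule nn_integral_mono)
      fix x
      show "w x * ennreal (\<bar>\<phi> x\<bar> powr p)
        \<le> w x * (\<integral>\<^sup>+t. ennreal (\<bar>frechet_derivative \<phi> (at (x + t *\<^sub>R h)) h\<bar> powr p) * indicator {0..1} t \<partial>lborel)"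
      proof (cases "x \<in> Om")
        case True
        then have "\<phi> (x + h) = 0" using test_function_eq_0_outside(1)[OF \<phi>] out by blast
        then show ?thesis using smooth_increment_powr_le[OF sm, of p x h] p by (intro mult_left_mono) auto
      qed (simp add: w_def)
    qed
    also have "\<dots> \<le> (\<integral>\<^sup>+x. w x * ennreal (\<bar>frechet_derivative \<phi> (at x) h\<bar> powr p) \<partial>lborel)"
    proof (rule nn_integral_segments_le)
      fix x and t :: real
      show "w x * ennreal (\<bar>frechet_derivative \<phi> (at (x + t *\<^sub>R h)) h\<bar> powr p)
        \<le> w (x + t *\<^sub>R h) * ennreal (\<bar>frechet_derivative \<phi> (at (x + t *\<^sub>R h)) h\<bar> powr p)"
      proof (cases "x + t *\<^sub>R h \<in> Om")
        case True
        moreover have "wt (x + t *\<^sub>R h) = wt x" by (simp add: wt_def h_def e_def)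
        ultimately have "w x \<le> w (x + t *\<^sub>R h)" by (simp add: w_def indicator_def)
        then show ?thesis by (rule mult_right_mono) simp
      next
        case False
        then show ?thesis using test_function_eq_0_outside(2)[OF \<phi>] p by simp
      qed
    qed measurable
    also have "\<dots> \<le> (\<integral>\<^sup>+x. ennreal (L powr p) * (w x * ennreal (norm (cgrad \<phi> x) powr p)) \<partial>lborel)"
    proof (rule nn_integral_mono)
      fix x
      have "frechet_derivative \<phi> (at x) h = L * frechet_derivative \<phi> (at x) e"
        using linear_scale[OF has_derivative_linear[OF test_functionD(4)[OF \<phi>]]] by (simp add: h_def)
      moreover have "\<bar>frechet_derivative \<phi> (at x) e\<bar> \<le> norm (cgrad \<phi> x)"
        using Basis_le_norm[OF e, of "cgrad \<phi> x"] unfolding cgrad_def e_def stretch_inner .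
      ultimately have "\<bar>frechet_derivative \<phi> (at x) h\<bar> powr p \<le> (L * norm (cgrad \<phi> x)) powr p"
        using L p by (intro powr_mono2) (auto simp: abs_mult)
      then have "ennreal (\<bar>frechet_derivative \<phi> (at x) h\<bar> powr p) \<le> ennreal (L powr p) * ennreal (norm (cgrad \<phi> x) powr p)"
        using L by (simp add: powr_mult ennreal_leI ennreal_mult[symmetric])
      then have "w x * ennreal (\<bar>frechet_derivative \<phi> (at x) h\<bar> powr p)
         \<le> w x * (ennreal (L powr p) * ennreal (norm (cgrad \<phi> x) powr p))" by (rule mult_left_mono) simp
      then show "w x * ennreal (\<bar>frechet_derivative \<phi> (at x) h\<bar> powr p) \<le> ennreal (L powr p) * (w x * ennreal (norm (cgrad \<phi> x) powr p))"
        by (simp add: mult_ac)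
    qed
    also have "\<dots> = ennreal (L powr p) * ennreal (Np (cgrad \<phi>) powr p)"
      using ennreal_Np_powr[OF cm Lp_cgrad[OF \<phi>]] by (simp add: nn_integral_cmult w_def)
    finally have "ennreal (Np \<phi> powr p) \<le> ennreal ((L * Np (cgrad \<phi>)) powr p)"
      using L by (simp add: powr_mult ennreal_mult[symmetric])
    then have "Np \<phi> powr p \<le> (L * Np (cgrad \<phi>)) powr p" by (subst (asm) ennreal_le_iff) auto
    then have "Np \<phi> \<le> L * Np (cgrad \<phi>)"
      using powr_less_mono2[of p "L * Np (cgrad \<phi>)" "Np \<phi>"] L p by fastforce
    then show ?thesis using Np_grad_test[OF \<phi>] by simp
  qed
  then show ?thesis using L by blast
qed

section \<open>From test functions to the energy space\<close>

lemma E_sequence: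
  assumes "u \<in> E"
  obtains \<phi> where "\<And>n::nat. \<phi> n \<in> test_functions Om" "(\<lambda>n. Np (\<lambda>x. u x - \<phi> n x)) \<longlonglongrightarrow> 0"
    "(\<lambda>n. Np (D (\<lambda>x. u x - \<phi> n x))) \<longlonglongrightarrow> 0"
proof -
  have "\<exists>\<phi>\<in>test_functions Om. Hn (\<lambda>x. u x - \<phi> x) < inverse (real (Suc n))" for n
    using assms by (simp add: E_iff)
  then obtain \<phi> where \<phi>: "\<And>n. \<phi> n \<in> test_functions Om" "\<And>n. Hn (\<lambda>x. u x - \<phi> n x) < inverse (real (Suc n))"
    by metis
  show thesis
  proof
    show "\<phi> n \<in> test_functions Om" for n by (rule \<phi>)
    have b: "Np (\<lambda>x. u x - \<phi> n x) \<le> inverse (real (Suc n))" "Np (D (\<lambda>x. u x - \<phi> n x)) \<le> inverse (real (Suc n))" for n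
      using \<phi>(2)[of n] Np_nonneg[of "\<lambda>x. u x - \<phi> n x"] Np_nonneg[of "D (\<lambda>x. u x - \<phi> n x)"] unfolding Hn_def by linarith+
    show "(\<lambda>n. Np (\<lambda>x. u x - \<phi> n x)) \<longlonglongrightarrow> 0" "(\<lambda>n. Np (D (\<lambda>x. u x - \<phi> n x))) \<longlonglongrightarrow> 0"
      by (rule tendsto_sandwich[OF _ _ tendsto_const LIMSEQ_inverse_real_of_nat]; use b in simp)+
  qed
qed

lemma tendsto_if_diff_le:
  fixes a :: "nat \<Rightarrow> real"
  assumes "b \<longlonglongrightarrow> 0" "\<And>n. \<bar>l - a n\<bar> \<le> C * b n" shows "a \<longlonglongrightarrow> l"
proof -
  have "(\<lambda>n. C * b n) \<longlonglongrightarrow> 0" using tendsto_mult_left[OF assms(1), of C] by simp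
  then have "(\<lambda>n. a n - l) \<longlonglongrightarrow> 0"
    by (rule Lim_null_comparison[rotated]) (use assms(2) in \<open>auto simp: abs_minus_commute\<close>)
  then show ?thesis by (rule LIM_zero_cancel)
qed

lemma
  assumes u: "u \<in> H" and \<phi>: "\<And>n::nat. \<phi> n \<in> H" and lim: "(\<lambda>n. Np (\<lambda>x. u x - \<phi> n x)) \<longlonglongrightarrow> 0"
    "(\<lambda>n. Np (D (\<lambda>x. u x - \<phi> n x))) \<longlonglongrightarrow> 0"
  shows Np_tendsto: "(\<lambda>n. Np (\<phi> n)) \<longlonglongrightarrow> Np u" and Np_grad_tendsto: "(\<lambda>n. Np (D (\<phi> n))) \<longlonglongrightarrow> Np (D u)"
    and Np_mu_tendsto: "(\<lambda>n. Np (\<lambda>x. mu x * \<phi> n x)) \<longlonglongrightarrow> Np (\<lambda>x. mu x * u x)"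
proof -
  have L: "Lp u" "Lp (\<phi> n)" for n using u \<phi> by (auto simp: H_iff)
  have Ld: "Lp (\<lambda>x. u x - \<phi> n x)" for n using H_diff[OF u \<phi>] by (simp add: H_iff)
  show "(\<lambda>n. Np (\<phi> n)) \<longlonglongrightarrow> Np u"
    by (rule tendsto_if_diff_le[OF lim(1), of _ _ 1]) (use Np_diff_le L in auto)
  show "(\<lambda>n. Np (D (\<phi> n))) \<longlonglongrightarrow> Np (D u)"
    by (rule tendsto_if_diff_le[OF lim(2), of _ _ 1]) (use Np_grad_diff_le u \<phi> in auto)
  show "(\<lambda>n. Np (\<lambda>x. mu x * \<phi> n x)) \<longlonglongrightarrow> Np (\<lambda>x. mu x * u x)"
  proof (rule tendsto_if_diff_le[OF lim(1), of _ _ "\<delta>\<^sup>2"])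
    fix n
    have "\<bar>Np (\<lambda>x. mu x * u x) - Np (\<lambda>x. mu x * \<phi> n x)\<bar> \<le> Np (\<lambda>x. mu x * (u x - \<phi> n x))"
      using Np_diff_le[OF Lp_mu[OF L(1)] Lp_mu[OF L(2)[of n]]] by (simp add: right_diff_distrib)
    also have "\<dots> \<le> \<delta>\<^sup>2 * Np (\<lambda>x. u x - \<phi> n x)" by (rule Np_mu_le[OF Ld])
    finally show "\<bar>Np (\<lambda>x. mu x * u x) - Np (\<lambda>x. mu x * \<phi> n x)\<bar> \<le> \<delta>\<^sup>2 * Np (\<lambda>x. u x - \<phi> n x)" .
  qed
qed

text \<open>Obtained by density. It makes functionals that are Lipschitz for \<open>Np\<close>
  continuous for the gradient seminorm, which alone defines the topology of
  \<open>E\<close>.\<close>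

lemma Poincare: "\<exists>L>0. \<forall>u\<in>E. Np u \<le> L * Np (D u)"
proof -
  obtain L where L: "L > 0" "\<And>\<phi>. \<phi> \<in> test_functions Om \<Longrightarrow> Np \<phi> \<le> L * Np (D \<phi>)" using Poincare_test by blast
  have "Np u \<le> L * Np (D u)" if u: "u \<in> E" for u
  proof -
    obtain \<phi> where \<phi>: "\<And>n::nat. \<phi> n \<in> test_functions Om" "(\<lambda>n. Np (\<lambda>x. u x - \<phi> n x)) \<longlonglongrightarrow> 0"
      "(\<lambda>n. Np (D (\<lambda>x. u x - \<phi> n x))) \<longlonglongrightarrow> 0" using E_sequence[OF u] by blast
    have t: "(\<lambda>n. Np (\<phi> n)) \<longlonglongrightarrow> Np u" "(\<lambda>n. Np (D (\<phi> n))) \<longlonglongrightarrow> Np (D u)"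
      using Np_tendsto[OF E_imp_H[OF u] test_in_H[OF \<phi>(1)] \<phi>(2,3)]
        Np_grad_tendsto[OF E_imp_H[OF u] test_in_H[OF \<phi>(1)] \<phi>(2,3)] by auto
    show ?thesis
      by (rule LIMSEQ_le[OF t(1) tendsto_mult_left[OF t(2), of L]]) (use L \<phi>(1) in auto)
  qed
  then show ?thesis using L by blast
qed

text \<open>Unweighted, and restricted to \<open>Om\<close>: cells may stick out of
  \<open>Om\<close>, where elements of \<open>E\<close> have unspecified values.\<close>

definition integral_over :: "'n point set \<Rightarrow> ('n point \<Rightarrow> real) \<Rightarrow> real" where
  "integral_over S u = (\<integral>x. indicator S x * u x \<partial>lebesgue_on Om)"

lemma finite_measure_Om: "finite_measure (lebesgue_on Om)"
proof (rule finite_measureI)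
  have "emeasure lebesgue Om < \<infinity>" using bounded_Om Om_borel emeasure_bounded_finite[OF bounded_Om] by simp
  then show "emeasure (lebesgue_on Om) (space (lebesgue_on Om)) \<noteq> \<infinity>"
    using Om_sets by (simp add: emeasure_restrict_space space_restrict_space)
qed

text \<open>On \<open>Om\<close> the weight is at least \<delta>^(-2), so \<open>nu\<close>
  dominates Lebesgue measure up to this factor. As \<open>Om\<close> is bounded, the first power is
  integrable together with the p-th.\<close>

lemma Lp_imp_integrable:
  fixes u :: "'n point \<Rightarrow> real"
  assumes u: "Lp u"
  shows "integrable (lebesgue_on Om) (\<lambda>x. \<bar>u x\<bar> powr p)" "integrable (lebesgue_on Om) u"
    "(\<integral>x. \<bar>u x\<bar> powr p \<partial>lebesgue_on Om) \<le> \<delta>\<^sup>2 * Np u powr p"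
proof -
  interpret finite_measure "lebesgue_on Om" by (rule finite_measure_Om)
  have [measurable]: "u \<in> borel_measurable (lebesgue_on Om)" using u by (simp add: Lp_def)
  have i: "integrable (lebesgue_on Om) (\<lambda>x. wt x * \<bar>u x\<bar> powr p)" using u by (simp add: Lp_def integrable_nu_iff)
  have w: "1 \<le> \<delta>\<^sup>2 * wt x" if "x \<in> Om" for x
    using mu_bounds[OF that] by (simp add: wt_def mu_def field_simps)
  have le: "\<bar>u x\<bar> powr p \<le> \<delta>\<^sup>2 * (wt x * \<bar>u x\<bar> powr p)" if "x \<in> Om" for x
    using mult_right_mono[OF w[OF that], of "\<bar>u x\<bar> powr p"] by (simp add: mult.assoc)
  show ip: "integrable (lebesgue_on Om) (\<lambda>x. \<bar>u x\<bar> powr p)"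
  proof (rule Bochner_Integration.integrable_bound)
    show "integrable (lebesgue_on Om) (\<lambda>x. \<delta>\<^sup>2 * (wt x * \<bar>u x\<bar> powr p))" using i by simp
    show "AE x in lebesgue_on Om. norm (\<bar>u x\<bar> powr p) \<le> norm (\<delta>\<^sup>2 * (wt x * \<bar>u x\<bar> powr p))"
    proof (rule AE_I2)
      fix x assume "x \<in> space (lebesgue_on Om)"
      then have "\<bar>u x\<bar> powr p \<le> \<delta>\<^sup>2 * (wt x * \<bar>u x\<bar> powr p)" using le by (simp add: space_restrict_space)
      then show "norm (\<bar>u x\<bar> powr p) \<le> norm (\<delta>\<^sup>2 * (wt x * \<bar>u x\<bar> powr p))" 
        by (simp only: real_norm_def abs_of_nonneg[OF powr_ge_zero])
    qed
  qed simp
  show "integrable (lebesgue_on Om) u"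
  proof (rule Bochner_Integration.integrable_bound)
    show "integrable (lebesgue_on Om) (\<lambda>x. 1 + \<bar>u x\<bar> powr p)" using ip by simp
    show "AE x in lebesgue_on Om. norm (u x) \<le> norm (1 + \<bar>u x\<bar> powr p)"
    proof (rule AE_I2)
      fix x
      have "\<bar>u x\<bar> \<le> 1 + \<bar>u x\<bar> powr p"
      proof (cases "\<bar>u x\<bar> \<le> 1")
        case True
        then show ?thesis using powr_ge_zero[of "\<bar>u x\<bar>" p] by linarith
      next
        case False
        then show ?thesis using powr_mono[of 1 p "\<bar>u x\<bar>"] p by simp
      qed
      then show "norm (u x) \<le> norm (1 + \<bar>u x\<bar> powr p)" by simp
    qed
  qed simp
  have "(\<integral>x. \<bar>u x\<bar> powr p \<partial>lebesgue_on Om) \<le> (\<integral>x. \<delta>\<^sup>2 * (wt x * \<bar>u x\<bar> powr p) \<partial>lebesgue_on Om)"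
    using ip i le by (intro integral_mono) (auto simp: space_restrict_space)
  also have "\<dots> = \<delta>\<^sup>2 * (\<integral>x. wt x *\<^sub>R \<bar>u x\<bar> powr p \<partial>lebesgue_on Om)" by simp
  also have "(\<integral>x. wt x *\<^sub>R \<bar>u x\<bar> powr p \<partial>lebesgue_on Om) = (\<integral>x. \<bar>u x\<bar> powr p \<partial>nu)"
    unfolding nu_def using wt_nonneg_AE by (intro integral_density[symmetric]) auto
  also have "\<dots> = Np u powr p" by (simp add: Np_powr)
  finally show "(\<integral>x. \<bar>u x\<bar> powr p \<partial>lebesgue_on Om) \<le> \<delta>\<^sup>2 * Np u powr p" .
qed

lemma integral_over_integrable:
  fixes u :: "'n point \<Rightarrow> real"
  assumes "Lp u" "S \<in> sets borel" shows "integrable (lebesgue_on Om) (\<lambda>x. indicator S x * u x)"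
proof -
  have "S \<in> sets lebesgue" using assms(2) by (auto intro: sets_completionI_sets)
  then have "S \<inter> Om \<in> sets (lebesgue_on Om)"
    using Om_sets by (simp add: sets_restrict_space_iff)
  then have "integrable (lebesgue_on Om) (\<lambda>x. indicator (S \<inter> Om) x *\<^sub>R u x)"
    by (intro integrable_mult_indicator Lp_imp_integrable assms)
  then show ?thesis
    by (rule Bochner_Integration.integrable_cong[THEN iffD1, rotated -1]) (auto simp: space_restrict_space indicator_def)
qed

lemma integral_over_diff:
  assumes "Lp u" "Lp v" "S \<in> sets borel"
  shows "integral_over S (\<lambda>x. u x - v x) = integral_over S u - integral_over S v"
  using integral_over_integrable[OF assms(1,3)] integral_over_integrable[OF assms(2,3)]
  by (simp add: integral_over_def right_diff_distrib)

text \<open>Jensen on the bounded set \<open>Om\<close>; the constant is uniform in \<open>S\<close>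
  and so serves all cells at once.\<close>

lemma integral_over_bound: "\<exists>C\<ge>0. \<forall>S u. S \<in> sets borel \<longrightarrow> Lp u \<longrightarrow> \<bar>integral_over S u\<bar> \<le> C * Np u"
proof -
  interpret finite_measure "lebesgue_on Om" by (rule finite_measure_Om)
  define A where "A = measure (lebesgue_on Om) (space (lebesgue_on Om)) powr (p - 1) * \<delta>\<^sup>2"
  have A: "A \<ge> 0" by (simp add: A_def)
  have "\<bar>integral_over S u\<bar> \<le> A powr (1 / p) * Np u" if S: "S \<in> sets borel" and u: "Lp u" for S u
  proof -
    have "\<bar>integral_over S u\<bar> \<le> (\<integral>x. \<bar>indicator S x * u x\<bar> \<partial>lebesgue_on Om)"
      unfolding integral_over_def by (rule integral_abs_bound)
    also have "\<dots> \<le> (\<integral>x. \<bar>u x\<bar> \<partial>lebesgue_on Om)"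
      using integral_over_integrable[OF u S] Lp_imp_integrable(2)[OF u]
      by (intro integral_mono) (auto simp: indicator_def)
    finally have "\<bar>integral_over S u\<bar> powr p \<le> \<bar>\<integral>x. \<bar>u x\<bar> \<partial>lebesgue_on Om\<bar> powr p"
      using p by (intro powr_mono2) auto
    also have "\<dots> \<le> measure (lebesgue_on Om) (space (lebesgue_on Om)) powr (p - 1) * (\<integral>x. \<bar>u x\<bar> powr p \<partial>lebesgue_on Om)"
      using powr_integral_le[of p "\<lambda>x. \<bar>u x\<bar>"] p Lp_imp_integrable[OF u] by simp
    also have "\<dots> \<le> A * Np u powr p"
      unfolding A_def mult.assoc by (intro mult_left_mono Lp_imp_integrable(3)[OF u]) simp
    finally have "(\<bar>integral_over S u\<bar> powr p) powr (1 / p) \<le> (A * Np u powr p) powr (1 / p)"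
      using p by (intro powr_mono2) auto
    then show ?thesis using p A by (simp add: powr_powr powr_mult)
  qed
  then show ?thesis by (intro exI[of _ "A powr (1 / p)"]) simp
qed

lemma integral_over_test:
  assumes \<phi>: "\<phi> \<in> test_functions Om" and S: "S \<in> sets borel"
  shows "integral_over S \<phi> = (LINT x:S|lborel. \<phi> x)"
proof -
  have "(\<lambda>x. indicator S x * \<phi> x) \<in> borel_measurable borel"
    using S borel_measurable_continuous_onI[OF test_functionD(2)[OF \<phi>]] by measurable
  then show ?thesis
    unfolding integral_over_def set_lebesgue_integral_def
    using integral_lebesgue_on_eq_lborel[OF open_Om, of "\<lambda>x. indicator S x * \<phi> x"] test_function_eq_0_outside(1)[OF \<phi>]
    by simp
qed


section \<open>The compactness estimate\<close>

definition core :: "real \<Rightarrow> 'n point set" where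
  "core \<eta> = {x. \<eta> < fst x} \<inter> {x. \<eta> < fst (snd x)}"

lemma core_borel: "core \<eta> \<in> sets borel"
proof -
  have "open (core \<eta>)" unfolding core_def
    by (intro open_Int open_Collect_less continuous_on_const continuous_on_fst_snd)
  then show ?thesis by simp
qed

lemma convex_core: "convex (core \<eta>)"
proof -
  have "core \<eta> = {\<eta><..} \<times> {\<eta><..} \<times> UNIV" by (auto simp: core_def)
  then show ?thesis by (auto intro!: convex_Times simp: convex_real_interval)
qed

text \<open>The constants are explicit because of the order in which they will be chosen: \<eta>
  makes the first term small, and only then is \<open>s\<close> made small, in a gradient
  coefficient that depends on \<eta> but tends to 0 like \<open>s powr p\<close>. Only
  \<open>C\<close> may grow as \<open>s\<close> shrinks.\<close>

lemma compactness_test: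
  assumes \<eta>: "0 < \<eta>" "\<eta> \<le> 1" and s: "0 < s" "s < \<eta> / 2"
  defines "Z \<equiv> cell_index s ` (Om \<inter> core \<eta>)"
  shows "\<exists>C\<ge>0. \<forall>\<phi>\<in>test_functions Om. Np (\<lambda>x. mu x * \<phi> x) powr p
    \<le> (\<eta> * \<delta>) powr p * Np \<phi> powr p
      + (\<delta>\<^sup>2) powr (p - 1) * (2 powr p * 2 ^ DIM('n point) * s powr p) * (\<delta>\<^sup>2 * (real DIM('n point) * 4 / \<eta>\<^sup>2) powr p) * Np (D \<phi>) powr p
      + C * (\<Sum>z\<in>Z. \<bar>integral_over (cell s z) \<phi>\<bar> powr p)"
proof -
  define A where "A = (\<delta>\<^sup>2) powr (p - 1)"
  define V where "V = s ^ DIM('n point)"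
  define C where "C = A * (2 powr p * V powr (1 - p))"
  define N where "N = real DIM('n point)"
  define \<kappa> where "\<kappa> = \<delta>\<^sup>2 * (N * 4 / \<eta>\<^sup>2) powr p"
  define S where "S = 2 powr p * 2 ^ DIM('n point) * s powr p"
  \<comment> \<open>Cells that meet \<open>core \<eta>\<close> have side below \<eta> / 2 and stay
    in this larger region. \<open>U\<close> is not cut down to \<open>Om\<close>: it has to be
    convex while \<open>X\<close> is an arbitrary bounded open set, and test functions vanish
    outside \<open>Om\<close> anyway.\<close>
  define U where "U = core (\<eta> / 2)"
  have pos: "A \<ge> 0" "C \<ge> 0" "\<kappa> \<ge> 0" "S \<ge> 0" by (simp_all add: A_def C_def \<kappa>_def S_def)
  have Zf: "finite Z" unfolding Z_def by (rule finite_cell_index[OF s(1)]) (use bounded_Om in \<open>auto intro: bounded_subset\<close>)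
  have Zr: "Z \<subseteq> range (cell_index s)" by (auto simp: Z_def)
  have ZU: "cell s z \<subseteq> U" if z: "z \<in> Z" for z
  proof
    fix y assume y: "y \<in> cell s z"
    obtain x where x: "x \<in> core \<eta>" "z = cell_index s x" using z by (auto simp: Z_def)
    then have "cell_index s x = cell_index s y" using y by (simp add: cell_def)
    from cell_diff[OF s(1) this Basis_point(1)] cell_diff[OF s(1) this Basis_point(2)]
    have "\<bar>fst y - fst x\<bar> \<le> s" "\<bar>fst (snd y) - fst (snd x)\<bar> \<le> s" by (simp_all add: inner_prod_def)
    then show "y \<in> U" using x(1) s by (auto simp: U_def core_def)
  qed
  have "Np (\<lambda>x. mu x * \<phi> x) powr p \<le> (\<eta> * \<delta>) powr p * Np \<phi> powr p + A * S * \<kappa> * Np (D \<phi>) powr p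
      + C * (\<Sum>z\<in>Z. \<bar>integral_over (cell s z) \<phi>\<bar> powr p)" if \<phi>: "\<phi> \<in> test_functions Om" for \<phi>
  proof -
    note sm = test_functionD(1)[OF \<phi>]
    have \<phi>m[measurable]: "\<phi> \<in> borel_measurable borel"
      using test_functionD(2)[OF \<phi>] by (rule borel_measurable_continuous_onI)
    have cm[measurable]: "cgrad \<phi> \<in> borel_measurable borel"
      using continuous_cgrad[OF \<phi>] by (rule borel_measurable_continuous_onI)
    have dm[measurable]: "(\<lambda>x. frechet_derivative \<phi> (at x) b) \<in> borel_measurable borel" for b
      using test_functionD(3)[OF \<phi>] by (rule borel_measurable_continuous_onI)
    note [measurable] = wt_borel Om_borel mu_borel cell_sets
    have Um[measurable]: "U \<in> sets borel" unfolding U_def by (rule core_borel)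
    have L\<phi>: "Lp \<phi>" using test_in_H[OF \<phi>] by (simp add: H_iff)
    define w where "w = (\<lambda>x. ennreal (wt x) * indicator Om x)"
    have wm[measurable]: "w \<in> borel_measurable borel" unfolding w_def by measurable
    define Q where "Q = (\<lambda>x. \<Sum>z\<in>Z. ennreal (\<bar>\<phi> x\<bar> powr p) * indicator (cell s z) x)"
    have Qm[measurable]: "Q \<in> borel_measurable borel" unfolding Q_def by measurable
    have int\<phi>: "integrable lborel \<phi>"
    proof -
      obtain K where K: "compact K" "{x. \<phi> x \<noteq> 0} \<subseteq> K" using test_function_support[OF \<phi>] by metis
      have "integrable lborel (\<lambda>x. indicator K x *\<^sub>R \<phi> x)"
        by (rule borel_integrable_compact[OF K(1) continuous_on_subset[OF test_functionD(2)[OF \<phi>] subset_UNIV]])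
      also have "(\<lambda>x. indicator K x *\<^sub>R \<phi> x) = \<phi>" using K(2) by (auto simp: indicator_def fun_eq_iff)
      finally show ?thesis .
    qed
    \<comment> \<open>Off the core one of the two coordinates is at most \<eta> and the other below
      \<delta>, so \<open>mu\<close> is at most \<open>\<eta> * \<delta>\<close>. On the core the
      singular weight is absorbed: \<open>wt * mu powr p = mu powr (p - 1) \<le> A\<close>.\<close>
    have pt: "w x * ennreal (norm (mu x * \<phi> x) powr p)
        \<le> ennreal ((\<eta> * \<delta>) powr p) * (w x * ennreal (\<bar>\<phi> x\<bar> powr p)) + ennreal A * Q x" for x
    proof (cases "x \<in> Om")
      case True
      note o = OmD[OF True] mu_bounds[OF True]
      show ?thesis
      proof (cases "x \<in> core \<eta>")
        case True2: True
        have "wt x * (mu x powr p) = mu x powr (p - 1)"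
          using o by (simp add: wt_def mu_def powr_diff)
        also have "\<dots> \<le> A" unfolding A_def using o p by (intro powr_mono2) auto
        finally have "wt x * (mu x powr p * \<bar>\<phi> x\<bar> powr p) \<le> A * \<bar>\<phi> x\<bar> powr p"
          by (simp add: mult_right_mono mult.assoc[symmetric])
        then have "w x * ennreal (norm (mu x * \<phi> x) powr p) \<le> ennreal (A * \<bar>\<phi> x\<bar> powr p)"
          using True o wt_pos[OF True] by (simp add: w_def abs_mult powr_mult ennreal_leI ennreal_mult[symmetric])
        also have "\<dots> = ennreal A * (ennreal (\<bar>\<phi> x\<bar> powr p) * indicator (cell s (cell_index s x)) x)"
          using pos by (simp add: ennreal_mult cell_def)
        also have "\<dots> \<le> ennreal A * Q x"
        proof (rule mult_left_mono)
          have "cell_index s x \<in> Z" using True True2 by (auto simp: Z_def)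
          then show "ennreal (\<bar>\<phi> x\<bar> powr p) * indicator (cell s (cell_index s x)) x \<le> Q x"
            unfolding Q_def by (rule member_le_sum) (use Zf in auto)
        qed simp
        finally show ?thesis by (rule order_trans) simp
      next
        case False
        then have "mu x \<le> \<eta> * \<delta>"
        proof -
          consider "fst x \<le> \<eta>" | "fst (snd x) \<le> \<eta>" using False by (auto simp: core_def not_less)
          then show ?thesis
          proof cases
            case 1
            then show ?thesis using o unfolding mu_def by (intro mult_mono) auto
          next
            case 2
            then show ?thesis using o \<eta> unfolding mu_def by (subst mult.commute) (intro mult_mono, auto)
          qed
        qed
        then have "norm (mu x * \<phi> x) powr p \<le> (\<eta> * \<delta>) powr p * \<bar>\<phi> x\<bar> powr p"
          using o p by (subst powr_mult[symmetric]) (auto simp: abs_mult intro!: powr_mono2 mult_right_mono)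
        then have "w x * ennreal (norm (mu x * \<phi> x) powr p) \<le> w x * (ennreal ((\<eta> * \<delta>) powr p) * ennreal (\<bar>\<phi> x\<bar> powr p))"
          by (intro mult_left_mono) (auto simp: ennreal_leI ennreal_mult[symmetric])
        also have "\<dots> = ennreal ((\<eta> * \<delta>) powr p) * (w x * ennreal (\<bar>\<phi> x\<bar> powr p))" by (simp add: mult_ac)
        finally show ?thesis by (rule order_trans) simp
      qed
    qed (simp add: w_def)
    \<comment> \<open>The estimate on cells is for Lebesgue measure. The weight is put back by
      \<open>1 \<le> \<delta>\<^sup>2 * wt x\<close>, and on \<open>U\<close> the stretched gradient
      bounds the ordinary derivatives.\<close>
    have grad: "ennreal ((\<Sum>b\<in>Basis. \<bar>frechet_derivative \<phi> (at x) b\<bar>) powr p) * indicator U x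
        \<le> ennreal \<kappa> * (w x * ennreal (norm (cgrad \<phi> x) powr p))" for x
    proof (cases "x \<in> Om \<and> x \<in> U")
      case True
      note o = OmD[OF conjunct1[OF True]]
      have "\<bar>frechet_derivative \<phi> (at x) b\<bar> \<le> norm (cgrad \<phi> x) / (\<eta> / 2)\<^sup>2" if "b \<in> Basis" for b
        using True \<eta> that by (intro abs_partial_le_cgrad) (auto simp: U_def core_def)
      then have "(\<Sum>b\<in>Basis. \<bar>frechet_derivative \<phi> (at x) b\<bar>) \<le> (\<Sum>b\<in>(Basis::'n point set). norm (cgrad \<phi> x) / (\<eta> / 2)\<^sup>2)"
        by (rule sum_mono)
      also have "\<dots> = (N * 4 / \<eta>\<^sup>2) * norm (cgrad \<phi> x)" unfolding sum_constant N_def by (simp add: power_divide)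
      finally have "(\<Sum>b\<in>Basis. \<bar>frechet_derivative \<phi> (at x) b\<bar>) powr p \<le> ((N * 4 / \<eta>\<^sup>2) * norm (cgrad \<phi> x)) powr p"
        using p by (intro powr_mono2) (auto intro: sum_nonneg)
      also have "\<dots> = (N * 4 / \<eta>\<^sup>2) powr p * norm (cgrad \<phi> x) powr p"
        by (rule powr_mult) 
      also have "\<dots> \<le> (\<delta>\<^sup>2 * wt x) * ((N * 4 / \<eta>\<^sup>2) powr p * norm (cgrad \<phi> x) powr p)"
      proof -
        have "1 \<le> \<delta>\<^sup>2 * wt x" using mu_bounds[OF conjunct1[OF True]] by (simp add: wt_def mu_def field_simps)
        from mult_right_mono[OF this, of "(N * 4 / \<eta>\<^sup>2) powr p * norm (cgrad \<phi> x) powr p"] show ?thesis by simp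
      qed
      also have "\<dots> = \<kappa> * (wt x * norm (cgrad \<phi> x) powr p)" by (simp add: \<kappa>_def mult_ac)
      finally show ?thesis
        using True pos wt_pos[OF conjunct1[OF True]] by (simp add: w_def ennreal_leI ennreal_mult[symmetric])
    next
      case False
      then consider "x \<notin> U" | "x \<notin> Om" by blast
      then show ?thesis
      proof cases
        case 2
        then show ?thesis using test_function_eq_0_outside(2)[OF \<phi>] p by simp
      qed simp
    qed
    have "(\<integral>\<^sup>+x\<in>U. ennreal ((\<Sum>b\<in>Basis. \<bar>frechet_derivative \<phi> (at x) b\<bar>) powr p) \<partial>lborel)
        \<le> (\<integral>\<^sup>+x. ennreal \<kappa> * (w x * ennreal (norm (cgrad \<phi> x) powr p)) \<partial>lborel)"
      by (rule nn_integral_mono[OF grad])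
    also have "\<dots> = ennreal \<kappa> * ennreal (Np (cgrad \<phi>) powr p)"
      using ennreal_Np_powr[OF cm Lp_cgrad[OF \<phi>]] by (simp add: nn_integral_cmult w_def)
    finally have gr: "(\<integral>\<^sup>+x\<in>U. ennreal ((\<Sum>b\<in>Basis. \<bar>frechet_derivative \<phi> (at x) b\<bar>) powr p) \<partial>lborel)
        \<le> ennreal (\<kappa> * Np (D \<phi>) powr p)" using pos Np_grad_test[OF \<phi>] by (simp add: ennreal_mult)
    have "(\<integral>\<^sup>+x. Q x \<partial>lborel) = (\<Sum>z\<in>Z. \<integral>\<^sup>+x\<in>cell s z. ennreal (\<bar>\<phi> x\<bar> powr p) \<partial>lborel)"
      unfolding Q_def by (rule nn_integral_sum) measurable
    also have "\<dots> \<le> ennreal S * (\<integral>\<^sup>+x\<in>U. ennreal ((\<Sum>b\<in>Basis. \<bar>frechet_derivative \<phi> (at x) b\<bar>) powr p) \<partial>lborel)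
        + ennreal (2 powr p * V powr (1 - p) * (\<Sum>z\<in>Z. \<bar>LINT x:cell s z|lborel. \<phi> x\<bar> powr p))"
      unfolding S_def V_def
      using p by (intro cell_Poincare[OF s(1) _ sm int\<phi> Um _ Zf Zr ZU]) (auto simp: U_def convex_core)
    also have "\<dots> \<le> ennreal S * ennreal (\<kappa> * Np (D \<phi>) powr p)
        + ennreal (2 powr p * V powr (1 - p) * (\<Sum>z\<in>Z. \<bar>LINT x:cell s z|lborel. \<phi> x\<bar> powr p))"
      by (intro add_right_mono mult_left_mono gr) simp
    also have "(\<Sum>z\<in>Z. \<bar>LINT x:cell s z|lborel. \<phi> x\<bar> powr p) = (\<Sum>z\<in>Z. \<bar>integral_over (cell s z) \<phi>\<bar> powr p)"
      by (simp add: integral_over_test[OF \<phi> cell_sets])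
    finally have q: "(\<integral>\<^sup>+x. Q x \<partial>lborel) \<le> ennreal (S * (\<kappa> * Np (D \<phi>) powr p)
        + 2 powr p * V powr (1 - p) * (\<Sum>z\<in>Z. \<bar>integral_over (cell s z) \<phi>\<bar> powr p))"
      using pos by (simp add: ennreal_mult[symmetric] ennreal_plus[symmetric] sum_nonneg del: ennreal_plus)
    have m\<phi>: "(\<lambda>x. mu x * \<phi> x) \<in> borel_measurable borel" by measurable
    have "ennreal (Np (\<lambda>x. mu x * \<phi> x) powr p) = (\<integral>\<^sup>+x. w x * ennreal (norm (mu x * \<phi> x) powr p) \<partial>lborel)"
      using ennreal_Np_powr[OF m\<phi> Lp_mu[OF L\<phi>]] by (simp add: w_def)
    also have "\<dots> \<le> (\<integral>\<^sup>+x. ennreal ((\<eta> * \<delta>) powr p) * (w x * ennreal (\<bar>\<phi> x\<bar> powr p)) + ennreal A * Q x \<partial>lborel)"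
      by (rule nn_integral_mono[OF pt])
    also have "\<dots> = ennreal ((\<eta> * \<delta>) powr p) * ennreal (Np \<phi> powr p) + ennreal A * (\<integral>\<^sup>+x. Q x \<partial>lborel)"
      using ennreal_Np_powr[OF \<phi>m L\<phi>] by (simp add: nn_integral_add nn_integral_cmult w_def)
    also have "\<dots> \<le> ennreal ((\<eta> * \<delta>) powr p) * ennreal (Np \<phi> powr p)
        + ennreal A * ennreal (S * (\<kappa> * Np (D \<phi>) powr p) + 2 powr p * V powr (1 - p) * (\<Sum>z\<in>Z. \<bar>integral_over (cell s z) \<phi>\<bar> powr p))"
      by (intro add_left_mono mult_left_mono q) simp
    also have "\<dots> = ennreal ((\<eta> * \<delta>) powr p * Np \<phi> powr p
        + A * (S * (\<kappa> * Np (D \<phi>) powr p) + 2 powr p * V powr (1 - p) * (\<Sum>z\<in>Z. \<bar>integral_over (cell s z) \<phi>\<bar> powr p)))"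
      using pos by (simp add: ennreal_mult[symmetric] ennreal_plus[symmetric] sum_nonneg del: ennreal_plus)
    finally have "Np (\<lambda>x. mu x * \<phi> x) powr p \<le> (\<eta> * \<delta>) powr p * Np \<phi> powr p
        + A * (S * (\<kappa> * Np (D \<phi>) powr p) + 2 powr p * V powr (1 - p) * (\<Sum>z\<in>Z. \<bar>integral_over (cell s z) \<phi>\<bar> powr p))"
      using pos by (subst (asm) ennreal_le_iff) (auto intro!: add_nonneg_nonneg mult_nonneg_nonneg sum_nonneg)
    then show ?thesis by (simp add: C_def algebra_simps)
  qed
  then show ?thesis using pos(2) unfolding A_def S_def \<kappa>_def N_def by blast
qed


text \<open>The Poincare inequality absorbs the contribution near the faces x1 = 0 and x2 = 0 into
  the gradient term. Along test functions that approximate \<open>u\<close> every term converges,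
  cell integrals included, so the inequality passes to \<open>E\<close>.\<close>

theorem compactness:
  assumes \<epsilon>: "\<epsilon> > 0"
  shows "\<exists>Z s C. finite Z \<and> C \<ge> 0 \<and> (\<forall>u\<in>E. Np (\<lambda>x. mu x * u x) powr p
    \<le> \<epsilon> * Np (D u) powr p + C * (\<Sum>z\<in>Z. \<bar>integral_over (cell s z) u\<bar> powr p))"
proof -
  obtain L where L: "L > 0" "\<And>\<phi>. \<phi> \<in> test_functions Om \<Longrightarrow> Np \<phi> \<le> L * Np (D \<phi>)" using Poincare_test by blast
  define \<eta> where "\<eta> = min 1 ((\<epsilon> / 2) powr (1 / p) / (\<delta> * L))"
  have \<eta>: "0 < \<eta>" "\<eta> \<le> 1" using \<epsilon> \<delta> L by (auto simp: \<eta>_def)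
  have "\<eta> * \<delta> * L \<le> (\<epsilon> / 2) powr (1 / p)"
  proof -
    have "\<eta> * (\<delta> * L) \<le> (\<epsilon> / 2) powr (1 / p) / (\<delta> * L) * (\<delta> * L)"
      using \<delta> L unfolding \<eta>_def by (intro mult_right_mono min.cobounded2) auto
    then show ?thesis using \<delta> L by (simp add: mult.assoc)
  qed
  then have "(\<eta> * \<delta> * L) powr p \<le> ((\<epsilon> / 2) powr (1 / p)) powr p"
    using p \<eta> \<delta> L by (intro powr_mono2) auto
  then have e1: "(\<eta> * \<delta> * L) powr p \<le> \<epsilon> / 2" using p \<epsilon> by (simp add: powr_powr)
  define K where "K = (\<delta>\<^sup>2) powr (p - 1) * (2 powr p * 2 ^ DIM('n point)) * (\<delta>\<^sup>2 * (real DIM('n point) * 4 / \<eta>\<^sup>2) powr p)"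
  have K: "K \<ge> 0" by (simp add: K_def)
  \<comment> \<open>\<open>K\<close> does not involve \<open>s\<close>, so \<open>s\<close> may be
    chosen after it; \<open>K + 1\<close> keeps the denominator positive.\<close>
  define s where "s = min (\<eta> / 4) ((\<epsilon> / (2 * (K + 1))) powr (1 / p))"
  have s: "0 < s" "s < \<eta> / 2" using \<eta> \<epsilon> K by (auto simp: s_def)
  have "s powr p \<le> ((\<epsilon> / (2 * (K + 1))) powr (1 / p)) powr p"
    using s p by (intro powr_mono2) (auto simp: s_def)
  then have "s powr p \<le> \<epsilon> / (2 * (K + 1))" using p \<epsilon> K by (simp add: powr_powr)
  then have "(K + 1) * s powr p \<le> \<epsilon> / 2" using K by (simp add: field_simps)
  moreover have "K * s powr p \<le> (K + 1) * s powr p" by (intro mult_right_mono) auto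
  ultimately have e2: "K * s powr p \<le> \<epsilon> / 2" by linarith
  define Z where "Z = cell_index s ` (Om \<inter> core \<eta>)"
  have Zf: "finite Z" unfolding Z_def by (rule finite_cell_index[OF s(1)]) (use bounded_Om in \<open>auto intro: bounded_subset\<close>)
  obtain C where C: "C \<ge> 0" "\<And>\<phi>. \<phi> \<in> test_functions Om \<Longrightarrow> Np (\<lambda>x. mu x * \<phi> x) powr p
    \<le> (\<eta> * \<delta>) powr p * Np \<phi> powr p
      + (\<delta>\<^sup>2) powr (p - 1) * (2 powr p * 2 ^ DIM('n point) * s powr p) * (\<delta>\<^sup>2 * (real DIM('n point) * 4 / \<eta>\<^sup>2) powr p) * Np (D \<phi>) powr p
      + C * (\<Sum>z\<in>Z. \<bar>integral_over (cell s z) \<phi>\<bar> powr p)"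
    using compactness_test[OF \<eta> s] unfolding Z_def by blast
  have test: "Np (\<lambda>x. mu x * \<phi> x) powr p \<le> \<epsilon> * Np (D \<phi>) powr p + C * (\<Sum>z\<in>Z. \<bar>integral_over (cell s z) \<phi>\<bar> powr p)"
    if \<phi>: "\<phi> \<in> test_functions Om" for \<phi>
  proof -
    have "Np \<phi> powr p \<le> (L * Np (D \<phi>)) powr p" using L(2)[OF \<phi>] p by (intro powr_mono2) auto
    then have "(\<eta> * \<delta>) powr p * Np \<phi> powr p \<le> (\<eta> * \<delta>) powr p * (L * Np (D \<phi>)) powr p" by (rule mult_left_mono) simp
    also have "\<dots> = (\<eta> * \<delta> * L) powr p * Np (D \<phi>) powr p" by (simp add: powr_mult mult.assoc)
    also have "\<dots> \<le> \<epsilon> / 2 * Np (D \<phi>) powr p" using e1 by (rule mult_right_mono) simp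
    finally have 1: "(\<eta> * \<delta>) powr p * Np \<phi> powr p \<le> \<epsilon> / 2 * Np (D \<phi>) powr p" .
    have "K * s powr p * Np (D \<phi>) powr p \<le> \<epsilon> / 2 * Np (D \<phi>) powr p" using e2 by (rule mult_right_mono) simp
    moreover have "K * s powr p = (\<delta>\<^sup>2) powr (p - 1) * (2 powr p * 2 ^ DIM('n point) * s powr p) * (\<delta>\<^sup>2 * (real DIM('n point) * 4 / \<eta>\<^sup>2) powr p)"
      unfolding K_def by (simp only: mult_ac)
    ultimately show ?thesis using C(2)[OF \<phi>] 1 by (simp add: field_simps)
  qed
  obtain M where M: "M \<ge> 0" "\<And>S u. S \<in> sets borel \<Longrightarrow> Lp u \<Longrightarrow> \<bar>integral_over S u\<bar> \<le> M * Np u"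
    using integral_over_bound by blast
  have "Np (\<lambda>x. mu x * u x) powr p \<le> \<epsilon> * Np (D u) powr p + C * (\<Sum>z\<in>Z. \<bar>integral_over (cell s z) u\<bar> powr p)"
    if u: "u \<in> E" for u
  proof -
    obtain \<phi> where \<phi>: "\<And>n::nat. \<phi> n \<in> test_functions Om" "(\<lambda>n. Np (\<lambda>x. u x - \<phi> n x)) \<longlonglongrightarrow> 0"
      "(\<lambda>n. Np (D (\<lambda>x. u x - \<phi> n x))) \<longlonglongrightarrow> 0" using E_sequence[OF u] by blast
    note uH = E_imp_H[OF u] and \<phi>H = test_in_H[OF \<phi>(1)]
    have t: "(\<lambda>n. Np (\<lambda>x. mu x * \<phi> n x)) \<longlonglongrightarrow> Np (\<lambda>x. mu x * u x)" "(\<lambda>n. Np (D (\<phi> n))) \<longlonglongrightarrow> Np (D u)"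
      using Np_mu_tendsto[OF uH \<phi>H \<phi>(2,3)] Np_grad_tendsto[OF uH \<phi>H \<phi>(2,3)] by auto
    have m: "(\<lambda>n. integral_over (cell s z) (\<phi> n)) \<longlonglongrightarrow> integral_over (cell s z) u" for z
    proof (rule tendsto_if_diff_le[OF \<phi>(2), of _ _ M])
      fix n
      have L: "Lp u" "Lp (\<phi> n)" "Lp (\<lambda>x. u x - \<phi> n x)"
        using uH \<phi>H H_diff[OF uH \<phi>H] by (auto simp: H_iff)
      show "\<bar>integral_over (cell s z) u - integral_over (cell s z) (\<phi> n)\<bar> \<le> M * Np (\<lambda>x. u x - \<phi> n x)"
        using M(2)[OF cell_sets L(3)] integral_over_diff[OF L(1,2) cell_sets] by simp
    qed
    have pw: "(\<lambda>n. a n powr p) \<longlonglongrightarrow> l powr p" if "a \<longlonglongrightarrow> l" "\<And>n. 0 \<le> a n" for a :: "nat \<Rightarrow> real" and l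
      using that p by (intro tendsto_powr' tendsto_const) auto
    have "(\<lambda>n. \<epsilon> * Np (D (\<phi> n)) powr p + C * (\<Sum>z\<in>Z. \<bar>integral_over (cell s z) (\<phi> n)\<bar> powr p))
      \<longlonglongrightarrow> \<epsilon> * Np (D u) powr p + C * (\<Sum>z\<in>Z. \<bar>integral_over (cell s z) u\<bar> powr p)"
      by (intro tendsto_add tendsto_mult tendsto_const tendsto_sum pw t(2) tendsto_rabs m) auto
    moreover have "(\<lambda>n. Np (\<lambda>x. mu x * \<phi> n x) powr p) \<longlonglongrightarrow> Np (\<lambda>x. mu x * u x) powr p"
      by (intro pw t(1)) auto
    ultimately show ?thesis using test[OF \<phi>(1)] by (intro LIMSEQ_le) auto
  qed
  then show ?thesis using Zf C(1) by blast
qed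

end

section \<open>Genus\<close>

context corner
begin

abbreviation T :: "('n point \<Rightarrow> real) topology" where "T \<equiv> E_topology \<delta> X p"

lemma openin_T:
  "openin T U \<longleftrightarrow> U \<subseteq> E \<and> (\<forall>u\<in>U. \<exists>e>0. \<forall>v\<in>E. Np (D (\<lambda>x. v x - u x)) < e \<longrightarrow> v \<in> U)"
proof -
  have "E_norm \<delta> X p (\<lambda>x. v x - u x) = Np (D (\<lambda>x. v x - u x))" if "u \<in> E" "v \<in> E" for u v
    using that by (intro E_norm_eq E_imp_H E_diff)
  note eq = this
  show ?thesis unfolding openin_E_topology
  proof (rule conj_cong[OF refl], rule ball_cong[OF refl])
    fix u assume "U \<subseteq> E" "u \<in> U"
    then have "u \<in> E" by blast
    then show "(\<exists>e>0. \<forall>v\<in>E. E_norm \<delta> X p (\<lambda>x. v x - u x) < e \<longrightarrow> v \<in> U)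
        = (\<exists>e>0. \<forall>v\<in>E. Np (D (\<lambda>x. v x - u x)) < e \<longrightarrow> v \<in> U)"
      by (simp add: eq cong: ball_cong)
  qed
qed

lemma topspace_T: "topspace T = E"
proof
  show "topspace T \<subseteq> E" using openin_T[of "topspace T"] by blast
  have "openin T E" unfolding openin_T
  proof (intro conjI ballI)
    show "\<exists>e>0. \<forall>v\<in>E. Np (D (\<lambda>x. v x - u x)) < e \<longrightarrow> v \<in> E" for u
      by (intro exI[of _ 1]) simp
  qed simp
  then show "E \<subseteq> topspace T" by (rule openin_subset)
qed

lemma continuous_map_T_Lipschitz:
  assumes "\<And>u v. u \<in> E \<Longrightarrow> v \<in> E \<Longrightarrow> \<bar>\<Phi> v - \<Phi> u\<bar> \<le> C * Np (D (\<lambda>x. v x - u x))"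
  shows "continuous_map T euclideanreal \<Phi>"
proof -
  have "openin T {u \<in> E. \<Phi> u \<in> U}" if U: "open U" for U
    unfolding openin_T
  proof (intro conjI ballI)
    fix u assume u: "u \<in> {u \<in> E. \<Phi> u \<in> U}"
    then obtain e where e: "e > 0" "\<And>y. \<bar>y - \<Phi> u\<bar> < e \<Longrightarrow> y \<in> U"
      using U by (auto simp: open_dist dist_real_def)
    have "v \<in> {u \<in> E. \<Phi> u \<in> U}" if v: "v \<in> E" "Np (D (\<lambda>x. v x - u x)) < e / (\<bar>C\<bar> + 1)" for v
    proof -
      have "\<bar>\<Phi> v - \<Phi> u\<bar> \<le> C * Np (D (\<lambda>x. v x - u x))" using assms u v by blast
      also have "\<dots> \<le> (\<bar>C\<bar> + 1) * Np (D (\<lambda>x. v x - u x))" by (intro mult_right_mono) auto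
      also have "\<dots> < (\<bar>C\<bar> + 1) * (e / (\<bar>C\<bar> + 1))" using v by (intro mult_strict_left_mono) auto
      also have "\<dots> = e" by simp
      finally show ?thesis using e v by blast
    qed
    moreover have "e / (\<bar>C\<bar> + 1) > 0" using e by simp
    ultimately show "\<exists>e>0. \<forall>v\<in>E. Np (D (\<lambda>x. v x - u x)) < e \<longrightarrow> v \<in> {u \<in> E. \<Phi> u \<in> U}" by blast
  qed auto
  then show ?thesis by (simp add: continuous_map_def topspace_T)
qed

lemma continuous_Np_grad: "continuous_map T euclideanreal (\<lambda>u. Np (D u))"
  by (rule continuous_map_T_Lipschitz[of _ 1]) (simp add: Np_grad_diff_le E_imp_H)

lemma continuous_Np_mu: "continuous_map T euclideanreal (\<lambda>u. Np (\<lambda>x. mu x * u x))"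
proof -
  obtain L where L: "L > 0" "\<And>u. u \<in> E \<Longrightarrow> Np u \<le> L * Np (D u)" using Poincare by blast
  show ?thesis
  proof (rule continuous_map_T_Lipschitz[of _ "\<delta>\<^sup>2 * L"])
    fix u v assume uv: "u \<in> E" "v \<in> E"
    then have l: "Lp u" "Lp v" "Lp (\<lambda>x. v x - u x)" using E_imp_H E_diff by (auto simp: H_iff)
    have "\<bar>Np (\<lambda>x. mu x * v x) - Np (\<lambda>x. mu x * u x)\<bar> \<le> Np (\<lambda>x. mu x * (v x - u x))"
      using Np_diff_le[OF Lp_mu[OF l(2)] Lp_mu[OF l(1)]] by (simp add: right_diff_distrib)
    also have "\<dots> \<le> \<delta>\<^sup>2 * Np (\<lambda>x. v x - u x)" by (rule Np_mu_le[OF l(3)])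
    also have "\<dots> \<le> \<delta>\<^sup>2 * (L * Np (D (\<lambda>x. v x - u x)))" using L(2)[OF E_diff[OF uv(2,1)]] by (rule mult_left_mono) simp
    finally show "\<bar>Np (\<lambda>x. mu x * v x) - Np (\<lambda>x. mu x * u x)\<bar> \<le> \<delta>\<^sup>2 * L * Np (D (\<lambda>x. v x - u x))" by (simp add: mult.assoc)
  qed
qed

lemma continuous_integral_over:
  assumes S: "S \<in> sets borel" shows "continuous_map T euclideanreal (integral_over S)"
proof -
  obtain L where L: "L > 0" "\<And>u. u \<in> E \<Longrightarrow> Np u \<le> L * Np (D u)" using Poincare by blast
  obtain M where M: "M \<ge> 0" "\<And>S u. S \<in> sets borel \<Longrightarrow> Lp u \<Longrightarrow> \<bar>integral_over S u\<bar> \<le> M * Np u"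
    using integral_over_bound by blast
  show ?thesis
  proof (rule continuous_map_T_Lipschitz[of _ "M * L"])
    fix u v assume uv: "u \<in> E" "v \<in> E"
    then have l: "Lp u" "Lp v" "Lp (\<lambda>x. v x - u x)" using E_imp_H E_diff by (auto simp: H_iff)
    have "\<bar>integral_over S v - integral_over S u\<bar> \<le> M * Np (\<lambda>x. v x - u x)"
      using M(2)[OF S l(3)] integral_over_diff[OF l(2,1) S] by simp
    also have "\<dots> \<le> M * (L * Np (D (\<lambda>x. v x - u x)))" using L(2)[OF E_diff[OF uv(2,1)]] M(1) by (rule mult_left_mono)
    finally show "\<bar>integral_over S v - integral_over S u\<bar> \<le> M * L * Np (D (\<lambda>x. v x - u x))" by (simp add: mult.assoc)
  qed
qed

lemma integral_over_uminus: "integral_over S (\<lambda>x. - u x) = - integral_over S u"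
  by (simp add: integral_over_def)

lemma Np_mu_uminus: "Np (\<lambda>x. mu x * - u x) = Np (\<lambda>x. mu x * u x)"
  by (simp add: Np_def)

lemma B_fun_E: "u \<in> E \<Longrightarrow> B_fun \<delta> X p u = 1 / p * Np (\<lambda>x. mu x * u x) powr p"
  using E_imp_H[of u] by (intro B_fun_eq) (simp add: H_iff Lp_def)

lemma M_set_iff:
  assumes \<alpha>: "\<alpha> > 0"
  shows "u \<in> M_set \<delta> X p \<alpha> \<longleftrightarrow> u \<in> E \<and> Np (D u) = (p * \<alpha>) powr (1 / p)"
proof -
  have "1 / p * Np (D u) powr p = \<alpha> \<longleftrightarrow> Np (D u) = (p * \<alpha>) powr (1 / p)"
  proof
    assume "1 / p * Np (D u) powr p = \<alpha>"
    then have "p * \<alpha> = Np (D u) powr p" using p by (simp add: field_simps)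
    then show "Np (D u) = (p * \<alpha>) powr (1 / p)" using p by (simp add: powr_powr)
  qed (use p \<alpha> in \<open>simp add: powr_powr\<close>)
  then show ?thesis using E_imp_H[of u] by (auto simp: M_set_def E_energy_eq)
qed

lemma genus_le:
  assumes "A \<noteq> {}" "1 \<le> m"
    and "continuous_map (subtopology T A) (subtopology (Euclidean_space m) (- {\<lambda>i. 0})) f"
    and "\<forall>u\<in>A. f (\<lambda>x. - u x) = (\<lambda>i. - f u i)"
  shows "genus T A \<le> enat m"
  unfolding genus_def using assms by (auto intro!: Inf_lower)

text \<open>On a set of large genus some element is annihilated by all the finitely many averages in the
  compactness estimate, so \<open>B\<close> is small there.\<close>

lemma small_B_on_large_genus:
  assumes \<alpha>: "\<alpha> > 0" and e: "e > 0"
  shows "\<exists>m. \<forall>k>m. \<forall>A\<in>A_class \<delta> X p \<alpha> k. \<exists>u\<in>A. B_fun \<delta> X p u \<le> e"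
proof -
  \<comment> \<open>On \<open>M_set\<close> the p-th power of the gradient norm is p \<alpha>. With
    this coefficient the gradient term equals e p, which the factor 1 / p in \<open>B_fun\<close>
    turns into \<open>e\<close>.\<close>
  have "e / \<alpha> > 0" using e \<alpha> by simp
  from compactness[OF this] obtain Z s C where Z: "finite Z" "C \<ge> 0" and
    est: "\<And>u. u \<in> E \<Longrightarrow> Np (\<lambda>x. mu x * u x) powr p
      \<le> e / \<alpha> * Np (D u) powr p + C * (\<Sum>z\<in>Z. \<bar>integral_over (cell s z) u\<bar> powr p)"
    by blast
  obtain zs where zs: "set zs = Z" using finite_list[OF Z(1)] by blast
  \<comment> \<open>The genus admits only target dimensions at least 1, and \<open>Z\<close> may be
    empty; hence one additional coordinate that is always 0.\<close>
  define m where "m = Suc (length zs)"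
  have "\<exists>u\<in>A. B_fun \<delta> X p u \<le> e" if k: "k > m" and A: "A \<in> A_class \<delta> X p \<alpha> k" for k A
  proof (rule ccontr)
    assume neg: "\<not> (\<exists>u\<in>A. B_fun \<delta> X p u \<le> e)"
    have AM: "A \<subseteq> M_set \<delta> X p \<alpha>" and g: "enat k \<le> genus T A" using A by (auto simp: A_class_def)
    have AE: "u \<in> E" "Np (D u) = (p * \<alpha>) powr (1 / p)" if "u \<in> A" for u
      using that AM M_set_iff[OF \<alpha>] by auto
    have ne: "A \<noteq> {}"
    proof
      assume "A = {}"
      then have "enat k \<le> 0" using g by (simp add: genus_def)
      then show False using k by (simp add: zero_enat_def)
    qed
    define f where "f = (\<lambda>u i. if i < m then (if i < length zs then integral_over (cell s (zs ! i)) u else 0) else 0)"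
    have nz: "f u \<noteq> (\<lambda>i. 0)" if u: "u \<in> A" for u
    proof
      assume f0: "f u = (\<lambda>i. 0)"
      have "integral_over (cell s z) u = 0" if "z \<in> Z" for z
      proof -
        obtain i where "i < length zs" "z = zs ! i" using \<open>z \<in> Z\<close> zs by (metis in_set_conv_nth)
        then show ?thesis using fun_cong[OF f0, of i] by (simp add: f_def m_def)
      qed
      then have "Np (\<lambda>x. mu x * u x) powr p \<le> e / \<alpha> * Np (D u) powr p"
        using est[OF AE(1)[OF u]] p by simp
      also have "\<dots> = e * p" using AE(2)[OF u] p \<alpha> by (simp add: powr_powr)
      finally have "B_fun \<delta> X p u \<le> e" using p by (simp add: B_fun_E[OF AE(1)[OF u]] field_simps)
      then show False using neg u by blast
    qed
    have "continuous_map (subtopology T A) (Euclidean_space m) f"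
      unfolding f_def continuous_map_componentwise_Euclidean_space
      by (intro allI impI continuous_map_from_subtopology)
        (simp add: continuous_integral_over[OF cell_sets, unfolded eta_contract_eq])
    then have "continuous_map (subtopology T A) (subtopology (Euclidean_space m) (- {\<lambda>i. 0})) f"
      using nz by (auto simp: continuous_map_in_subtopology topspace_T)
    then have "genus T A \<le> enat m"
      by (rule genus_le[OF ne, rotated]) (auto simp: f_def m_def integral_over_uminus fun_eq_iff)
    then have "enat k \<le> enat m" using g by (rule order_trans[rotated])
    then show False using k by simp
  qed
  then show ?thesis by blast
qed

text \<open>At every point at most one summand is nonzero, so the p-th powers add up without cross
  terms.\<close>

lemma Np_sum_disjoint:
  fixes f :: "nat \<Rightarrow> 'n point \<Rightarrow> 'b::euclidean_space"
  assumes f: "\<And>i. i \<in> I \<Longrightarrow> Lp (f i)" and I: "finite I"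
    and disj: "\<And>i j x. i \<in> I \<Longrightarrow> j \<in> I \<Longrightarrow> i \<noteq> j \<Longrightarrow> f i x = 0 \<or> f j x = 0"
  shows "Np (\<lambda>x. \<Sum>i\<in>I. d i *\<^sub>R f i x) powr p = (\<Sum>i\<in>I. \<bar>d i\<bar> powr p * Np (f i) powr p)"
proof -
  have pt: "norm (\<Sum>i\<in>I. d i *\<^sub>R f i x) powr p = (\<Sum>i\<in>I. \<bar>d i\<bar> powr p * norm (f i x) powr p)" for x
  proof (cases "\<exists>i\<in>I. f i x \<noteq> 0")
    case True
    then obtain i where i: "i \<in> I" "f i x \<noteq> 0" by blast
    have z: "f j x = 0" if "j \<in> I - {i}" for j using disj[of i j x] i that by auto
    have "(\<Sum>i\<in>I. d i *\<^sub>R f i x) = d i *\<^sub>R f i x + (\<Sum>j\<in>I - {i}. d j *\<^sub>R f j x)"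
      using I i by (intro sum.remove) auto
    also have "(\<Sum>j\<in>I - {i}. d j *\<^sub>R f j x) = 0" using z by (intro sum.neutral) simp
    finally have 1: "(\<Sum>i\<in>I. d i *\<^sub>R f i x) = d i *\<^sub>R f i x" by simp
    have "(\<Sum>i\<in>I. \<bar>d i\<bar> powr p * norm (f i x) powr p) = \<bar>d i\<bar> powr p * norm (f i x) powr p
        + (\<Sum>j\<in>I - {i}. \<bar>d j\<bar> powr p * norm (f j x) powr p)"
      using I i by (intro sum.remove) auto
    also have "(\<Sum>j\<in>I - {i}. \<bar>d j\<bar> powr p * norm (f j x) powr p) = 0" using z p by (intro sum.neutral) simp
    finally show ?thesis unfolding 1 by (simp add: powr_mult)
  next
    case False
    then have "(\<Sum>i\<in>I. d i *\<^sub>R f i x) = 0" "(\<Sum>i\<in>I. \<bar>d i\<bar> powr p * norm (f i x) powr p) = 0"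
      using p by (auto intro!: sum.neutral)
    then show ?thesis using p by simp
  qed
  have "Np (\<lambda>x. \<Sum>i\<in>I. d i *\<^sub>R f i x) powr p = (\<integral>x. (\<Sum>i\<in>I. \<bar>d i\<bar> powr p * norm (f i x) powr p) \<partial>nu)"
    unfolding Np_powr pt ..
  also have "\<dots> = (\<Sum>i\<in>I. \<bar>d i\<bar> powr p * Np (f i) powr p)"
    unfolding Np_powr using f by (subst Bochner_Integration.integral_sum) (auto simp: Lp_def)
  finally show ?thesis .
qed

text \<open>Otherwise the bump would vanish almost everywhere, although it is positive on a nonempty
  open box.\<close>

lemma Np_mu_box_bump_pos:
  assumes sub: "cbox a c \<subseteq> Om" and ne: "box a c \<noteq> {}"
  shows "Np (\<lambda>x. mu x * box_bump a c 1 x) > 0"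
proof (rule ccontr)
  define \<phi>' where "\<phi>' = box_bump a c 1"
  have \<phi>: "\<phi>' \<in> test_functions Om" unfolding \<phi>'_def by (rule box_bump_test_function[OF sub]) simp
  have m: "\<phi>' \<in> borel_measurable borel"
    using test_functionD(2)[OF \<phi>] by (rule borel_measurable_continuous_onI)
  have L: "Lp \<phi>'" using test_in_H[OF \<phi>] by (simp add: H_iff)
  have [measurable]: "(\<lambda>x. mu x * \<phi>' x) \<in> borel_measurable borel" "wt \<in> borel_measurable borel" "Om \<in> sets borel"
    using mu_borel m wt_borel Om_borel by auto
  assume "\<not> 0 < Np (\<lambda>x. mu x * box_bump a c 1 x)"
  then have "Np (\<lambda>x. mu x * \<phi>' x) = 0" using Np_nonneg[of "\<lambda>x. mu x * \<phi>' x"] unfolding \<phi>'_def by linarith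
  then have "(\<integral>\<^sup>+x. ennreal (wt x) * indicator Om x * ennreal (norm (mu x * \<phi>' x) powr p) \<partial>lborel) = 0"
    using ennreal_Np_powr[of "\<lambda>x. mu x * \<phi>' x"] Lp_mu[OF L] p by simp
  then have "AE x in lborel. ennreal (wt x) * indicator Om x * ennreal (norm (mu x * \<phi>' x) powr p) = 0"
    by (subst (asm) nn_integral_0_iff_AE) auto
  then have "AE x in lborel. x \<notin> box a c"
  proof eventually_elim
    case (elim x)
    show ?case
    proof
      assume x: "x \<in> box a c"
      then have o: "x \<in> Om" using sub box_subset_cbox by blast
      have "\<phi>' x > 0" using box_bump_pos[of 1 a c x] x by (simp add: \<phi>'_def)
      then have "norm (mu x * \<phi>' x) powr p > 0" using mu_bounds[OF o] by simp
      then show False using elim o wt_pos[OF o] by (simp add: ennreal_eq_0_iff)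
    qed
  qed
  then have "box a c \<in> null_sets lborel" using AE_iff_null_sets[of "box a c" lborel] by simp
  then have "negligible (box a c)" by (simp add: negligible_iff_null_sets null_sets_completionI)
  then show False using ne by (simp add: negligible_interval)
qed

lemma disjoint_boxes:
  "\<exists>a c :: nat \<Rightarrow> 'n point. \<forall>i\<le>n. cbox (a i) (c i) \<subseteq> Om \<and> box (a i) (c i) \<noteq> {} \<and>
     (\<forall>j\<le>n. i \<noteq> j \<longrightarrow> cbox (a i) (c i) \<inter> cbox (a j) (c j) = {})"
proof -
  obtain x0 where "x0 \<in> X" using X(3) by blast
  then have "(\<delta> / 2, \<delta> / 2, x0) \<in> Om" using \<delta> by (simp add: MM_def)
  then obtain a c where ac: "cbox a c \<subseteq> Om" and memb: "\<forall>b\<in>Basis. a \<bullet> b < c \<bullet> b"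
    by (rule open_contains_cbox[OF open_Om])
  \<comment> \<open>A box in \<open>Om\<close> is cut into 2 n + 2 slabs across the first
    coordinate; taking every other one keeps the closed boxes apart.\<close>
  define w where "w = (fst c - fst a) / real (2 * n + 2)"
  have "fst a < fst c" using bspec[OF memb Basis_point(1)] by (simp add: inner_prod_def)
  then have w: "w > 0" unfolding w_def by (intro divide_pos_pos) simp_all
  have wn: "real (2 * n + 2) * w = fst c - fst a" unfolding w_def by (subst times_divide_eq_right, rule nonzero_mult_div_cancel_left) simp
  define a' where "a' = (\<lambda>i. (fst a + real (2 * i) * w, snd a))"
  define c' where "c' = (\<lambda>i. (fst a + real (2 * i + 1) * w, snd c))"
  have mem: "y \<in> cbox l u \<longleftrightarrow> fst l \<le> fst y \<and> fst y \<le> fst u \<and> snd y \<in> cbox (snd l) (snd u)" for y l u :: "'n point"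
    by (subst cbox_prod) (simp add: mem_Times_iff)
  have sub: "cbox (a' i) (c' i) \<subseteq> Om" if "i \<le> n" for i
  proof -
    have "real (2 * i + 1) * w \<le> real (2 * n + 2) * w" using that w by (intro mult_right_mono) auto
    then have "fst a + real (2 * i + 1) * w \<le> fst c" using wn by simp
    moreover have "0 \<le> real (2 * i) * w" using w by (intro mult_nonneg_nonneg) auto
    ultimately have "y \<in> cbox a c" if "y \<in> cbox (a' i) (c' i)" for y
      using that unfolding mem[of y] a'_def c'_def fst_conv snd_conv by linarith
    then show ?thesis using ac by blast
  qed
  have ne: "box (a' i) (c' i) \<noteq> {}" for i
  proof -
    have "a' i \<bullet> b < c' i \<bullet> b" if "b \<in> Basis" for b
      using that
    proof (cases rule: Basis_point_cases)
      case 1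
      then show ?thesis using w by (simp add: a'_def c'_def inner_prod_def algebra_simps)
    next
      case 2
      then show ?thesis using bspec[OF memb Basis_point(2)] by (simp add: a'_def c'_def inner_prod_def)
    next
      case (3 j)
      then show ?thesis using bspec[OF memb Basis_point(3)[of j]] by (simp add: a'_def c'_def inner_prod_def)
    qed
    then show ?thesis by (simp add: box_ne_empty)
  qed
  have disj: "cbox (a' i) (c' i) \<inter> cbox (a' j) (c' j) = {}" if "i \<noteq> j" for i j
  proof -
    have lt: "cbox (a' i) (c' i) \<inter> cbox (a' j) (c' j) = {}" if "i < j" for i j
    proof -
      have "real (2 * i + 1) * w < real (2 * j) * w" using that w by (intro mult_strict_right_mono) auto
      then have "\<not> (y \<in> cbox (a' i) (c' i) \<and> y \<in> cbox (a' j) (c' j))" for y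
        unfolding mem[of y] a'_def c'_def by simp
      then show ?thesis by blast
    qed
    consider "i < j" | "j < i" using \<open>i \<noteq> j\<close> by linarith
    then show ?thesis by cases (use lt[of i j] lt[of j i] in \<open>simp_all add: Int_commute\<close>)
  qed
  have "\<forall>i\<le>n. cbox (a' i) (c' i) \<subseteq> Om \<and> box (a' i) (c' i) \<noteq> {} \<and>
     (\<forall>j\<le>n. i \<noteq> j \<longrightarrow> cbox (a' i) (c' i) \<inter> cbox (a' j) (c' j) = {})"
    using sub ne disj by simp
  then show ?thesis by (intro exI)
qed

end

text \<open>This is the sign of \<open>t\<close> times \<open>\<bar>t\<bar> powr q\<close>. For q =
  2 / p it carries the Euclidean unit sphere, coordinate by coordinate, onto the unit sphere of the
  l^p norm by an odd continuous map.\<close>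

definition odd_root :: "real \<Rightarrow> real \<Rightarrow> real" where
  "odd_root q t = (max t 0) powr q - (max (- t) 0) powr q"

lemma odd_root_uminus: "odd_root q (- t) = - odd_root q t"
  by (simp add: odd_root_def)

lemma continuous_odd_root: "q > 0 \<Longrightarrow> continuous_on UNIV (odd_root q)"
  unfolding odd_root_def[abs_def]
  by (intro continuous_on_diff continuous_on_powr' continuous_on_max continuous_on_const continuous_on_id continuous_on_minus) auto

lemma abs_odd_root_powr:
  assumes "p > 0" shows "\<bar>odd_root (2 / p) t\<bar> powr p = t\<^sup>2"
proof -
  have "\<bar>odd_root (2 / p) t\<bar> = \<bar>t\<bar> powr (2 / p)" by (auto simp: odd_root_def max_def)
  then show ?thesis using assms by (simp add: powr_powr)
qed

lemma test_functions_sum: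
  assumes "finite I" "\<And>i. i \<in> I \<Longrightarrow> \<phi> i \<in> test_functions \<Omega>"
  shows "(\<lambda>x. \<Sum>i\<in>I. d i * \<phi> i x) \<in> test_functions \<Omega>"
  using assms
proof (induction I rule: finite_induct)
  case empty
  then show ?case by (simp add: test_functions_def Ck_const)
next
  case (insert i I)
  then have "(\<lambda>x. d i * \<phi> i x + (\<Sum>i\<in>I. d i * \<phi> i x)) \<in> test_functions \<Omega>"
    by (intro test_functions_add test_functions_cmult) auto
  then show ?case using insert by simp
qed

context corner
begin

lemma stretch_sum: "stretch x (\<lambda>b. \<Sum>i\<in>I. d i * v i b) = (\<Sum>i\<in>I. d i *\<^sub>R stretch x (v i))"
  by (simp add: stretch_def prod_eq_iff fst_sum snd_sum vec_eq_iff sum_distrib_left mult_ac)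

lemma cgrad_sum:
  assumes "\<And>i. i \<in> I \<Longrightarrow> \<phi> i \<in> test_functions Om"
  shows "cgrad (\<lambda>x. \<Sum>i\<in>I. d i * \<phi> i x) x = (\<Sum>i\<in>I. d i *\<^sub>R cgrad (\<phi> i) x)"
proof -
  have "((\<lambda>x. \<Sum>i\<in>I. d i * \<phi> i x) has_derivative (\<lambda>h. \<Sum>i\<in>I. d i * frechet_derivative (\<phi> i) (at x) h)) (at x)"
    using test_functionD(4)[OF assms] by (intro has_derivative_sum has_derivative_mult_right) auto
  then have "frechet_derivative (\<lambda>x. \<Sum>i\<in>I. d i * \<phi> i x) (at x) = (\<lambda>h. \<Sum>i\<in>I. d i * frechet_derivative (\<phi> i) (at x) h)"
    by (rule frechet_derivative_at[symmetric])
  then show ?thesis by (simp add: cgrad_def stretch_sum)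
qed

lemma stretch_0: "stretch x (\<lambda>b. 0) = 0"
  by (simp add: stretch_def zero_prod_def vec_eq_iff)

text \<open>The majorant \<open>\<Psi>\<close> bounds the p-th power of the seminorm, because for
  sums of functions with disjoint supports that power is an explicit continuous expression in the
  coefficients.\<close>

lemma continuous_map_into_T:
  fixes j :: "(nat \<Rightarrow> real) \<Rightarrow> 'n point \<Rightarrow> real"
  assumes j: "\<And>c. c \<in> S \<Longrightarrow> j c \<in> E"
    and \<Psi>: "\<And>c0. c0 \<in> S \<Longrightarrow> continuous_on S (\<Psi> c0)" "\<And>c0. c0 \<in> S \<Longrightarrow> \<Psi> c0 c0 = 0"
    and le: "\<And>c c0. c \<in> S \<Longrightarrow> c0 \<in> S \<Longrightarrow> Np (D (\<lambda>x. j c x - j c0 x)) powr p \<le> \<Psi> c0 c"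
  shows "continuous_map (top_of_set S) T j"
  unfolding continuous_map_def
proof (intro conjI allI impI)
  show "j \<in> topspace (top_of_set S) \<rightarrow> topspace T" using j by (simp add: topspace_T)
  fix U assume U: "openin T U"
  show "openin (top_of_set S) {c \<in> topspace (top_of_set S). j c \<in> U}"
  proof (subst openin_subopen, rule ballI)
    fix c0 assume c0: "c0 \<in> {c \<in> topspace (top_of_set S). j c \<in> U}"
    then have c0S: "c0 \<in> S" "j c0 \<in> U" by auto
    obtain e where e: "e > 0" "\<And>v. v \<in> E \<Longrightarrow> Np (D (\<lambda>x. v x - j c0 x)) < e \<Longrightarrow> v \<in> U"
      using U c0S(2) unfolding openin_T by blast
    let ?V = "S \<inter> \<Psi> c0 -` {..<e powr p}"
    have "openin (top_of_set S) ?V" by (rule continuous_openin_preimage_gen[OF \<Psi>(1)[OF c0S(1)]]) simp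
    moreover have "c0 \<in> ?V" using c0S \<Psi>(2) e by simp
    moreover have "?V \<subseteq> {c \<in> topspace (top_of_set S). j c \<in> U}"
    proof
      fix c assume c: "c \<in> ?V"
      then have cS: "c \<in> S" by simp
      have "Np (D (\<lambda>x. j c x - j c0 x)) powr p < e powr p" using le[OF cS c0S(1)] c by simp
      then have "Np (D (\<lambda>x. j c x - j c0 x)) < e"
        using p e powr_mono2[of p e "Np (D (\<lambda>x. j c x - j c0 x))"] by fastforce
      then show "c \<in> {c \<in> topspace (top_of_set S). j c \<in> U}" using e(2)[OF j[OF cS]] cS by simp
    qed
    ultimately show "\<exists>W. openin (top_of_set S) W \<and> c0 \<in> W \<and> W \<subseteq> {c \<in> topspace (top_of_set S). j c \<in> U}" by blast
  qed
qed

text \<open>Sums of bumps with disjoint supports, with coefficients \<open>\<plusminus>\<bar>c\<^sub>i\<bar>\<^sup>2\<^sup>/\<^sup>p\<close>, embed a sphere oddly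
  into the level set of the energy; the Borsuk-Ulam theorem bounds the genus from below.\<close>

lemma large_genus_set:
  assumes \<alpha>: "\<alpha> > 0"
  shows "\<exists>A\<in>A_class \<delta> X p \<alpha> (Suc n). \<exists>b>0. \<forall>u\<in>A. b \<le> B_fun \<delta> X p u"
proof -
  obtain a c :: "nat \<Rightarrow> 'n point" where ac: "\<And>i. i \<le> n \<Longrightarrow> cbox (a i) (c i) \<subseteq> Om"
    "\<And>i. i \<le> n \<Longrightarrow> box (a i) (c i) \<noteq> {}"
    "\<And>i j. i \<le> n \<Longrightarrow> j \<le> n \<Longrightarrow> i \<noteq> j \<Longrightarrow> cbox (a i) (c i) \<inter> cbox (a j) (c j) = {}"
    using disjoint_boxes[of n] by metis
  define \<phi> where "\<phi> = (\<lambda>i. box_bump (a i) (c i) 1)"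
  have \<phi>: "\<phi> i \<in> test_functions Om" if "i \<le> n" for i
    unfolding \<phi>_def by (rule box_bump_test_function[OF ac(1)[OF that]]) simp
  have \<phi>c: "\<phi> i \<in> test_functions (cbox (a i) (c i))" for i
    unfolding \<phi>_def by (rule box_bump_test_function[OF subset_refl]) simp
  have out: "\<phi> i x = 0" "cgrad (\<phi> i) x = 0" if "x \<notin> cbox (a i) (c i)" for i x
    using test_function_eq_0_outside[OF \<phi>c that] by (simp_all add: cgrad_def stretch_0 flip: fun_eq_iff)
      (simp add: stretch_def zero_prod_def vec_eq_iff)
  have disj: "x \<notin> cbox (a i) (c i) \<or> x \<notin> cbox (a j) (c j)" if "i \<le> n" "j \<le> n" "i \<noteq> j" for i j x
    using ac(3)[OF that] by blast
  define N where "N = (\<lambda>i. Np (D (\<phi> i)))"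
  define b where "b = (\<lambda>i. Np (\<lambda>x. mu x * \<phi> i x))"
  define \<rho> where "\<rho> = (p * \<alpha>) powr (1 / p)"
  have \<rho>: "\<rho> > 0" using p \<alpha> by (simp add: \<rho>_def)
  have bpos: "b i > 0" if "i \<le> n" for i
    unfolding b_def \<phi>_def by (rule Np_mu_box_bump_pos[OF ac(1,2)[OF that]])
  \<comment> \<open>The gradient norm of a bump is positive because its \<open>mu\<close>-weighted
    norm is, through the Poincare inequality.\<close>
  have Npos: "N i > 0" if i: "i \<le> n" for i
  proof -
    obtain L where L: "L > 0" "\<And>u. u \<in> E \<Longrightarrow> Np u \<le> L * Np (D u)" using Poincare by blast
    have "0 < b i" by (rule bpos[OF i])
    also have "b i \<le> \<delta>\<^sup>2 * Np (\<phi> i)"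
      using Np_mu_le test_in_H[OF \<phi>[OF i]] by (simp add: b_def H_iff)
    also have "\<dots> \<le> \<delta>\<^sup>2 * (L * N i)"
      using L(2)[OF test_in_E[OF \<phi>[OF i]]] by (intro mult_left_mono) (simp_all add: N_def)
    finally show ?thesis using L(1) \<delta> by (simp add: zero_less_mult_iff)
  qed
  define F where "F = (\<lambda>d x. \<Sum>i\<le>n. d i * \<phi> i x)"
  have Ft: "F d \<in> test_functions Om" for d
    unfolding F_def by (rule test_functions_sum) (auto intro: \<phi>)
  have FE: "F d \<in> E" for d by (rule test_in_E[OF Ft])
  have FD: "Np (D (F d)) powr p = (\<Sum>i\<le>n. \<bar>d i\<bar> powr p * N i powr p)" for d
  proof -
    have "cgrad (F d) = (\<lambda>x. \<Sum>i\<le>n. d i *\<^sub>R cgrad (\<phi> i) x)"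
      unfolding F_def by (intro ext cgrad_sum) (simp add: \<phi>)
    then have "Np (D (F d)) = Np (\<lambda>x. \<Sum>i\<le>n. d i *\<^sub>R cgrad (\<phi> i) x)"
      using Np_grad_test[OF Ft, of d] by (simp only:)
    also have "\<dots> powr p = (\<Sum>i\<le>n. \<bar>d i\<bar> powr p * Np (cgrad (\<phi> i)) powr p)"
    proof (rule Np_sum_disjoint)
      show "cgrad (\<phi> i) x = 0 \<or> cgrad (\<phi> j) x = 0" if "i \<in> {..n}" "j \<in> {..n}" "i \<noteq> j" for i j x
        using disj[of i j x] out(2)[of x i] out(2)[of x j] that by auto
    qed (auto intro: Lp_cgrad \<phi>)
    also have "\<dots> = (\<Sum>i\<le>n. \<bar>d i\<bar> powr p * N i powr p)"
      by (intro sum.cong) (simp_all add: N_def Np_grad_test[OF \<phi>])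
    finally show ?thesis .
  qed
  have Fmu: "Np (\<lambda>x. mu x * F d x) powr p = (\<Sum>i\<le>n. \<bar>d i\<bar> powr p * b i powr p)" for d
  proof -
    have "(\<lambda>x. mu x * F d x) = (\<lambda>x. \<Sum>i\<le>n. d i *\<^sub>R (mu x * \<phi> i x))"
      by (simp add: F_def sum_distrib_left mult_ac)
    moreover have "Np (\<lambda>x. \<Sum>i\<le>n. d i *\<^sub>R (mu x * \<phi> i x)) powr p = (\<Sum>i\<le>n. \<bar>d i\<bar> powr p * b i powr p)"
      unfolding b_def
    proof (rule Np_sum_disjoint)
      show "mu x * \<phi> i x = 0 \<or> mu x * \<phi> j x = 0" if "i \<in> {..n}" "j \<in> {..n}" "i \<noteq> j" for i j x
        using disj[of i j x] out(1)[of x i] out(1)[of x j] that by auto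
      show "Lp (\<lambda>x. mu x * \<phi> i x)" if "i \<in> {..n}" for i
        using that test_in_H[OF \<phi>] by (intro Lp_mu) (simp add: H_iff)
    qed auto
    ultimately show ?thesis by simp
  qed
  \<comment> \<open>Each bump is rescaled to gradient norm \<rho>, and the p-th power turns the
    coefficient into \<open>(c i)\<^sup>2\<close>. Thus the energy is constant on the
    sphere.\<close>
  define r where "r = (\<lambda>c i. odd_root (2 / p) (c i) * (\<rho> / N i))"
  define j where "j = (\<lambda>c. F (r c))"
  have r_powr: "\<bar>r c i\<bar> powr p = (c i)\<^sup>2 * (\<rho> / N i) powr p" if "i \<le> n" for c i
  proof -
    have "\<rho> / N i > 0" using Npos[OF that] \<rho> by simp
    then have "\<bar>r c i\<bar> = \<bar>odd_root (2 / p) (c i)\<bar> * (\<rho> / N i)" unfolding r_def abs_mult by (simp only: abs_of_pos)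
    then have "\<bar>r c i\<bar> powr p = \<bar>odd_root (2 / p) (c i)\<bar> powr p * (\<rho> / N i) powr p" by (simp only: powr_mult)
    then show ?thesis using abs_odd_root_powr[of p "c i"] p by simp
  qed
  have jD: "Np (D (j c)) = \<rho>" if c: "c \<in> sph n" for c
  proof -
    have "Np (D (j c)) powr p = (\<Sum>i\<le>n. (c i)\<^sup>2 * \<rho> powr p)"
      unfolding j_def FD
    proof (rule sum.cong[OF refl])
      fix i assume "i \<in> {..n}"
      then have i: "i \<le> n" by simp
      have "(\<rho> / N i) powr p * N i powr p = \<rho> powr p"
        using Npos[OF i] \<rho> by (simp add: powr_divide)
      then show "\<bar>r c i\<bar> powr p * N i powr p = (c i)\<^sup>2 * \<rho> powr p" by (simp add: r_powr[OF i] mult.assoc)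
    qed
    also have "\<dots> = (\<Sum>i\<le>n. (c i)\<^sup>2) * \<rho> powr p" by (rule sum_distrib_right[symmetric])
    also have "(\<Sum>i\<le>n. (c i)\<^sup>2) = 1" using c by (simp add: sph_def)
    finally have "(Np (D (j c)) powr p) powr (1 / p) = (\<rho> powr p) powr (1 / p)" by simp
    then show ?thesis using p \<rho> by (simp add: powr_powr)
  qed
  \<comment> \<open>On the sphere the p-th power of the \<open>mu\<close>-weighted norm is a convex
    combination of these numbers, with weights \<open>(c i)\<^sup>2\<close>.\<close>
  define m0 where "m0 = Min ((\<lambda>i. (\<rho> / N i) powr p * b i powr p) ` {..n})"
  have m0: "m0 > 0" 
  proof -
    have "0 < (\<rho> / N i) powr p * b i powr p" if "i \<le> n" for i
    proof (rule mult_pos_pos)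
      show "0 < (\<rho> / N i) powr p" using Npos[OF that] \<rho> by simp
      show "0 < b i powr p" using bpos[OF that] by simp
    qed
    then show ?thesis unfolding m0_def by (subst Min_gr_iff) auto
  qed
  have m0_le: "m0 \<le> (\<rho> / N i) powr p * b i powr p" if "i \<le> n" for i
    unfolding m0_def using that by (intro Min_le) auto
  define m1 where "m1 = m0 powr (1 / p)"
  have jmu: "m1 \<le> Np (\<lambda>x. mu x * j c x)" if c: "c \<in> sph n" for c
  proof -
    have "m0 = (\<Sum>i\<le>n. (c i)\<^sup>2) * m0" using c by (simp add: sph_def)
    also have "\<dots> = (\<Sum>i\<le>n. (c i)\<^sup>2 * m0)" by (rule sum_distrib_right)
    also have "\<dots> \<le> (\<Sum>i\<le>n. (c i)\<^sup>2 * ((\<rho> / N i) powr p * b i powr p))"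
      by (intro sum_mono mult_left_mono m0_le) auto
    also have "\<dots> = (\<Sum>i\<le>n. \<bar>r c i\<bar> powr p * b i powr p)"
      by (intro sum.cong refl) (simp add: r_powr)
    also have "\<dots> = Np (\<lambda>x. mu x * j c x) powr p" by (simp add: j_def Fmu)
    finally have "m1 \<le> (Np (\<lambda>x. mu x * j c x) powr p) powr (1 / p)"
      unfolding m1_def using m0 p by (intro powr_mono2) auto
    then show ?thesis using p by (simp add: powr_powr)
  qed
  have juminus: "j (\<lambda>i. - c i) = (\<lambda>x. - j c x)" for c
    by (simp add: j_def F_def r_def odd_root_uminus sum_negf fun_eq_iff)
  \<comment> \<open>The image of the sphere itself is not closed in \<open>T\<close>: it consists of
    single representatives of classes modulo null sets. The set below contains it and is closed as
    an intersection of preimages of closed sets under continuous functionals.\<close>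
  define A where "A = {u \<in> E. Np (D u) = \<rho> \<and> m1 \<le> Np (\<lambda>x. mu x * u x)}"
  have AM: "A \<subseteq> M_set \<delta> X p \<alpha>" by (auto simp: A_def M_set_iff[OF \<alpha>] \<rho>_def)
  have jA: "j c \<in> A" if "c \<in> sph n" for c
    using jD[OF that] jmu[OF that] FE by (simp add: A_def j_def)
  have Aneg: "(\<lambda>x. - u x) \<in> A" if "u \<in> A" for u
    using that by (simp add: A_def E_uminus Np_grad_uminus[OF E_imp_H] Np_mu_uminus[simplified])
  have Asym: "A = (\<lambda>u x. - u x) ` A"
  proof
    show "A \<subseteq> (\<lambda>u x. - u x) ` A"
    proof
      fix u assume "u \<in> A"
      then show "u \<in> (\<lambda>u x. - u x) ` A" using Aneg[of u] by (intro image_eqI[of _ _ "\<lambda>x. - u x"]) auto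
    qed
  qed (use Aneg in blast)
  have Acl: "closedin T A"
  proof -
    have "closedin T {u \<in> topspace T. Np (D u) \<in> {\<rho>}}"
      by (rule closedin_continuous_map_preimage[OF continuous_Np_grad]) simp
    moreover have "closedin T {u \<in> topspace T. Np (\<lambda>x. mu x * u x) \<in> {m1..}}"
      by (rule closedin_continuous_map_preimage[OF continuous_Np_mu]) simp
    ultimately have "closedin T ({u \<in> topspace T. Np (D u) \<in> {\<rho>}} \<inter> {u \<in> topspace T. Np (\<lambda>x. mu x * u x) \<in> {m1..}})"
      by (rule closedin_Int)
    also have "{u \<in> topspace T. Np (D u) \<in> {\<rho>}} \<inter> {u \<in> topspace T. Np (\<lambda>x. mu x * u x) \<in> {m1..}} = A"
      by (auto simp: A_def topspace_T)
    finally show ?thesis .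
  qed
  have jT: "continuous_map (nsphere n) T j"
    unfolding nsphere_eq_sph
  proof (rule continuous_map_into_T)
    let ?\<Psi> = "\<lambda>c0 c. \<Sum>i\<le>n. \<bar>r c i - r c0 i\<bar> powr p * N i powr p"
    show "j c \<in> E" if "c \<in> sph n" for c using FE by (simp add: j_def)
    show "continuous_on (sph n) (?\<Psi> c0)" for c0
    proof -
      have root: "continuous_on UNIV (odd_root (2 / p))" by (rule continuous_odd_root) (use p in simp)
      have co: "continuous_on (sph n) (\<lambda>c. c i)" for i
        by (rule continuous_on_subset[OF continuous_on_product_coordinates subset_UNIV])
      have rt: "continuous_on (sph n) (\<lambda>c. odd_root (2 / p) (c i))" for i
        by (rule continuous_on_compose2[OF root co subset_UNIV])
      have rc: "continuous_on (sph n) (\<lambda>c. r c i)" for i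
        unfolding r_def by (rule continuous_on_mult[OF rt continuous_on_const])
      have ab: "continuous_on (sph n) (\<lambda>c. \<bar>r c i - r c0 i\<bar>)" for i
        by (rule continuous_on_rabs[OF continuous_on_diff[OF rc continuous_on_const]])
      have "continuous_on (sph n) (\<lambda>c. \<bar>r c i - r c0 i\<bar> powr p)" for i
        by (rule continuous_on_powr'[OF ab continuous_on_const]) (use p in simp)
      then show ?thesis
        by (rule continuous_on_sum[OF continuous_on_mult[OF _ continuous_on_const]])
    qed
    show "?\<Psi> c0 c0 = 0" for c0 using p by simp
    show "Np (D (\<lambda>x. j c x - j c0 x)) powr p \<le> ?\<Psi> c0 c" for c c0
    proof -
      have "(\<lambda>x. j c x - j c0 x) = F (\<lambda>i. r c i - r c0 i)"
        by (simp add: j_def F_def sum_subtractf left_diff_distrib fun_eq_iff)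
      then show ?thesis by (simp add: FD)
    qed
  qed
  then have jmap: "continuous_map (nsphere n) (subtopology T A) j"
    unfolding continuous_map_in_subtopology
  proof
    show "j \<in> topspace (nsphere n) \<rightarrow> A" unfolding topspace_nsphere_sph using jA by (rule funcsetI)
  qed
  obtain c1 where c1: "c1 \<in> sph n" using in_topspace_nsphere[of n] unfolding topspace_nsphere_sph by (rule that)
  have "A \<noteq> {}" using jA[OF c1] by blast
  moreover have "Suc n \<le> m"
    if m: "continuous_map (subtopology T A) (subtopology (Euclidean_space m) (- {\<lambda>i. 0})) f"
      "\<forall>u\<in>A. f (\<lambda>x. - u x) = (\<lambda>i. - f u i)" for m f
  proof (rule ccontr)
    assume "\<not> Suc n \<le> m"
    then have "m \<le> n" by simp
    moreover have "continuous_map (nsphere n) (subtopology (Euclidean_space m) (- {\<lambda>i. 0})) (f \<circ> j)"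
      by (rule continuous_map_compose[OF jmap m(1)])
    moreover have "(f \<circ> j) (\<lambda>i. - x i) = (\<lambda>i. - (f \<circ> j) x i)" if "x \<in> sph n" for x
    proof -
      have "j x \<in> A" using that by (rule jA)
      with m(2) have "f (\<lambda>y. - j x y) = (\<lambda>i. - f (j x) i)" by (rule bspec)
      then show ?thesis unfolding o_apply juminus .
    qed
    ultimately show False by (rule Borsuk_Ulam_nsphere)
  qed
  ultimately have "enat (Suc n) \<le> genus T A"
    unfolding genus_def by (auto intro!: Inf_greatest)
  then have "A \<in> A_class \<delta> X p \<alpha> (Suc n)" using AM Acl Asym by (simp add: A_class_def)
  moreover have "m0 / p \<le> B_fun \<delta> X p u" if "u \<in> A" for u
  proof -
    have u: "u \<in> E" "m1 \<le> Np (\<lambda>x. mu x * u x)" using that by (auto simp: A_def)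
    have "m0 = m1 powr p" using m0 p by (simp add: m1_def powr_powr)
    also have "\<dots> \<le> Np (\<lambda>x. mu x * u x) powr p" using u(2) p by (intro powr_mono2) (auto simp: m1_def)
    finally show ?thesis using p by (simp add: B_fun_E[OF u(1)] divide_right_mono)
  qed
  moreover have "m0 / p > 0" using m0 p by simp
  ultimately show ?thesis by blast
qed

section \<open>Bounds and limit of the minimax values\<close>

lemma A_class_nonempty_members:
  assumes "A \<in> A_class \<delta> X p \<alpha> (Suc n)" shows "A \<noteq> {}" "A \<subseteq> M_set \<delta> X p \<alpha>"
proof -
  have g: "enat (Suc n) \<le> genus T A" using assms by (simp add: A_class_def)
  show "A \<noteq> {}"
  proof
    assume "A = {}"
    then have "enat (Suc n) \<le> 0" using g by (simp add: genus_def)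
    then show False by (simp add: zero_enat_def)
  qed
  show "A \<subseteq> M_set \<delta> X p \<alpha>" using assms by (simp add: A_class_def)
qed

text \<open>\<open>beta\<close> is formed in the reals, where suprema and infima are meaningful only
  for nonempty bounded families. The bounds come from the Poincare inequality.\<close>

lemma B_fun_bounded_on_M:
  assumes \<alpha>: "\<alpha> > 0"
  shows "\<exists>C. \<forall>u\<in>M_set \<delta> X p \<alpha>. 0 \<le> B_fun \<delta> X p u \<and> B_fun \<delta> X p u \<le> C"
proof -
  obtain L where L: "L > 0" "\<And>u. u \<in> E \<Longrightarrow> Np u \<le> L * Np (D u)" using Poincare by blast
  define \<rho> where "\<rho> = (p * \<alpha>) powr (1 / p)"
  have "0 \<le> B_fun \<delta> X p u \<and> B_fun \<delta> X p u \<le> 1 / p * (\<delta>\<^sup>2 * (L * \<rho>)) powr p" if "u \<in> M_set \<delta> X p \<alpha>" for u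
  proof -
    have u: "u \<in> E" "Np (D u) = \<rho>" using that by (auto simp: M_set_iff[OF \<alpha>] \<rho>_def)
    have "Np (\<lambda>x. mu x * u x) \<le> \<delta>\<^sup>2 * Np u" using Np_mu_le E_imp_H[OF u(1)] by (simp add: H_iff)
    also have "\<dots> \<le> \<delta>\<^sup>2 * (L * \<rho>)" using L(2)[OF u(1)] u(2) by (intro mult_left_mono) auto
    finally have "Np (\<lambda>x. mu x * u x) powr p \<le> (\<delta>\<^sup>2 * (L * \<rho>)) powr p" using p by (intro powr_mono2) auto
    then show ?thesis using p by (simp add: B_fun_E[OF u(1)] divide_right_mono)
  qed
  then show ?thesis by blast
qed

lemma beta_pos:
  assumes \<alpha>: "\<alpha> > 0" shows "beta \<delta> X p \<alpha> (Suc n) > 0"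
proof -
  obtain C where C: "\<And>u. u \<in> M_set \<delta> X p \<alpha> \<Longrightarrow> 0 \<le> B_fun \<delta> X p u" "\<And>u. u \<in> M_set \<delta> X p \<alpha> \<Longrightarrow> B_fun \<delta> X p u \<le> C"
    using B_fun_bounded_on_M[OF \<alpha>] by blast
  obtain A b where A: "A \<in> A_class \<delta> X p \<alpha> (Suc n)" "b > 0" "\<And>u. u \<in> A \<Longrightarrow> b \<le> B_fun \<delta> X p u"
    using large_genus_set[OF \<alpha>, of n] by blast
  have "b \<le> (INF u\<in>A. B_fun \<delta> X p u)"
    using A_class_nonempty_members(1)[OF A(1)] A(3) by (rule cINF_greatest)
  also have "\<dots> \<le> beta \<delta> X p \<alpha> (Suc n)"
    unfolding beta_def
  proof (rule cSUP_upper[OF A(1)])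
    show "bdd_above ((\<lambda>A. INF u\<in>A. B_fun \<delta> X p u) ` A_class \<delta> X p \<alpha> (Suc n))"
    proof (rule bdd_aboveI2)
      fix A' assume A': "A' \<in> A_class \<delta> X p \<alpha> (Suc n)"
      note mem = A_class_nonempty_members[OF A']
      then obtain u where u: "u \<in> A'" "u \<in> M_set \<delta> X p \<alpha>" by blast
      have "(INF u\<in>A'. B_fun \<delta> X p u) \<le> B_fun \<delta> X p u"
        by (rule cINF_lower[OF bdd_belowI2[of _ 0] u(1)]) (use C(1) mem in blast)
      then show "(INF u\<in>A'. B_fun \<delta> X p u) \<le> C" using C(2)[OF u(2)] by linarith
    qed
  qed
  finally show ?thesis using A(2) by linarith
qed

lemma beta_le_eventually:
  assumes \<alpha>: "\<alpha> > 0" and e: "e > 0"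
  shows "\<forall>\<^sub>F k in sequentially. beta \<delta> X p \<alpha> k \<le> e"
proof -
  obtain C where C: "\<And>u. u \<in> M_set \<delta> X p \<alpha> \<Longrightarrow> 0 \<le> B_fun \<delta> X p u"
    using B_fun_bounded_on_M[OF \<alpha>] by blast
  obtain m where m: "\<And>k A. k > m \<Longrightarrow> A \<in> A_class \<delta> X p \<alpha> k \<Longrightarrow> \<exists>u\<in>A. B_fun \<delta> X p u \<le> e"
    using small_B_on_large_genus[OF \<alpha> e] by blast
  have "beta \<delta> X p \<alpha> k \<le> e" if k: "k > m" for k
  proof -
    obtain n where n: "k = Suc n" using k by (cases k) auto
    show ?thesis
      unfolding beta_def
    proof (rule cSUP_least)
      \<comment> \<open>The supremum over an empty class would be an unspecified real, so the upper
        bound on \<open>beta\<close> also rests on the existence of sets of large genus.\<close>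
      show "A_class \<delta> X p \<alpha> k \<noteq> {}" using large_genus_set[OF \<alpha>, of n] n by blast
      fix A assume A: "A \<in> A_class \<delta> X p \<alpha> k"
      then have sub: "A \<subseteq> M_set \<delta> X p \<alpha>" using A_class_nonempty_members(2) n by blast
      obtain u where u: "u \<in> A" "B_fun \<delta> X p u \<le> e" using m[OF k A] by blast
      have "(INF u\<in>A. B_fun \<delta> X p u) \<le> B_fun \<delta> X p u"
        by (rule cINF_lower[OF bdd_belowI2[of _ 0] u(1)]) (use C sub in blast)
      then show "(INF u\<in>A. B_fun \<delta> X p u) \<le> e" using u(2) by linarith
    qed
  qed
  then show ?thesis using eventually_gt_at_top[of m] by (rule eventually_mono[rotated])
qed

theorem lambda_ev_at_top:
  assumes \<alpha>: "\<alpha> > 0" shows "filterlim (\<lambda>k. lambda_ev \<delta> X p \<alpha> k) at_top sequentially"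
  unfolding filterlim_at_top_gt[where c = 0]
proof (intro allI impI)
  fix Z :: real assume Z: "Z > 0"
  then have "\<alpha> / Z > 0" using \<alpha> by simp
  from beta_le_eventually[OF \<alpha> this] eventually_gt_at_top[of 0]
  show "\<forall>\<^sub>F k in sequentially. Z \<le> lambda_ev \<delta> X p \<alpha> k"
  proof eventually_elim
    case (elim k)
    then obtain n where "k = Suc n" by (cases k) auto
    then have "beta \<delta> X p \<alpha> k > 0" using beta_pos[OF \<alpha>] by simp
    then show ?case using elim(1) Z by (simp add: lambda_ev_def field_simps)
  qed
qed

end

theorem theorem1p4:
  fixes X :: "(real ^ 'n::finite) set" and \<delta> p \<alpha> :: real
  assumes "\<delta> > 0"
    and "open X" and "bounded X" and "X \<noteq> {}"
    and "2 < p" and "p < real (CARD('n) + 2)"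
    and "\<alpha> > 0"
  shows "filterlim (\<lambda>k. lambda_ev \<delta> X p \<alpha> k) at_top sequentially"
proof -
  interpret corner \<delta> p X
    using assms by unfold_locales auto
  show ?thesis using assms(7) by (rule lambda_ev_at_top)
qed

end
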